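(* Let $\alpha_2=4\pi$. For every $\alpha\in(0,\alpha_2)$ there exists a constant $C_\alpha>0$, depending only on $\alpha$, such that $$\int_{\mathbb{R}^2_+}\left(e^{\alpha\frac{|u(x)|^2}{|\nabla_{\mathbb{B}}u|_2^2}}-1\right)\frac{dx_1}{x_1}dx_2\le C_\alpha\frac{|u|_2^2}{|\nabla_{\mathbb{B}}u|_2^2}$$ for all $u\in\mathcal{H}_2^{1,1}(\mathbb{R}^2_+)\setminus\{0\}$. In particular, if $A(s)=A_\alpha(s)=e^{\alpha s^2}-1$ for $s\ge 0$, then $$|u|_A\le|\nabla_{\mathbb{B}}u|_2$$ for all $u\in\mathcal{H}_2^{1,1}(\mathbb{R}^2_+)$.
   Context: $\mathbb{R}^2_+=\{(x_1,x_2): x_1>0,\ x_2\in\mathbb{R}\}$, equipped with the measure $\frac{dx_1}{x_1}dx_2$. The gradient is $\nabla_{\mathbb{B}}=(x_1\partial_{x_1},\partial_{x_2})$, and $|\cdot|_2$ is the $L^2$ norm over $\mathbb{R}^2_+$ with respect to $\frac{dx_1}{x_1}dx_2$: $|u|_2^2=\int_{\mathbb{R}^2_+}|u|^2\frac{dx_1}{x_1}dx_2$ and $|\nabla_{\mathbb{B}}u|_2^2=\int_{\mathbb{R}^2_+}\left(|x_1\partial_{x_1}u|^2+|\partial_{x_2}u|^2\right)\frac{dx_1}{x_1}dx_2$. The cone Sobolev space $\mathcal{H}_2^{1,1}(\mathbb{R}^2_+)$ is the space of distributions $u$ on $\mathbb{R}^2_+$ such that $u$, $x_1\partial_{x_1}u$,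 $\partial_{x_2}u$ are square integrable with respect to $\frac{dx_1}{x_1}dx_2$. The Orlicz-type quantity $|u|_A$ is defined by $$|u|_A=\inf\left\{\lambda>0:\ \int_{\mathbb{R}^2_+}A\left(\frac{|u(x)|}{\lambda}\right)\frac{dx_1}{x_1}dx_2<+\infty\right\}.$$ *)

theory Defs
  imports "HOL-Analysis.Analysis"
begin

definition half_plane :: "(real \<times> real) set" where
  "half_plane = {x. 0 < fst x}"

definition cone_measure :: "(real \<times> real) measure" where
  "cone_measure = density (lebesgue_on half_plane) (\<lambda>x. ennreal (1 / fst x))"

definition square_integrable :: "(real \<times> real \<Rightarrow> real) \<Rightarrow> bool" where
  "square_integrable f \<longleftrightarrow>
     f \<in> borel_measurable cone_measure \<and> integrable cone_measure (\<lambda>x. \<bar>f x\<bar>\<^sup>2)"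

text \<open>Used both for scalar functions and for gradients; on pairs \<^const>\<open>norm\<close> is the
  Euclidean norm.\<close>

definition L2_cone_norm :: "(real \<times> real \<Rightarrow> 'a::real_normed_vector) \<Rightarrow> real" where
  "L2_cone_norm f = sqrt (\<integral>x. (norm (f x))\<^sup>2 \<partial>cone_measure)"


definition pd1 :: "(real \<times> real \<Rightarrow> real) \<Rightarrow> real \<times> real \<Rightarrow> real" where
  "pd1 \<phi> x = deriv (\<lambda>t. \<phi> (t, snd x)) (fst x)"

definition pd2 :: "(real \<times> real \<Rightarrow> real) \<Rightarrow> real \<times> real \<Rightarrow> real" where
  "pd2 \<phi> x = deriv (\<lambda>t. \<phi> (fst x, t)) (snd x)"

primrec C_k :: "nat \<Rightarrow> (real \<times> real \<Rightarrow> real) \<Rightarrow> bool" where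
  "C_k 0 \<phi> \<longleftrightarrow> continuous_on UNIV \<phi>"
| "C_k (Suc k) \<phi> \<longleftrightarrow> \<phi> differentiable_on UNIV \<and> C_k k (pd1 \<phi>) \<and> C_k k (pd2 \<phi>)"

text \<open>Test functions on the half-plane, identified with their extension by zero to the plane.\<close>

definition test_functions :: "(real \<times> real \<Rightarrow> real) set" where
  "test_functions = {\<phi>. (\<forall>k. C_k k \<phi>) \<and>
     compact (closure {x. \<phi> x \<noteq> 0}) \<and> closure {x. \<phi> x \<noteq> 0} \<subseteq> half_plane}"

text \<open>Distributions are given by their action on test functions. A function is identified with
  a distribution by pairing with respect to plain Lebesgue measure (not the cone measure).\<close>

type_synonym distribution = "(real \<times> real \<Rightarrow> real) \<Rightarrow> real"

definition regular_distribution :: "(real \<times> real \<Rightarrow> real) \<Rightarrow> distribution" where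
  "regular_distribution f = (\<lambda>\<phi>. \<integral>x. f x * \<phi> x \<partial>lebesgue_on half_plane)"

definition dist_pd1 :: "distribution \<Rightarrow> distribution" where
  "dist_pd1 T = (\<lambda>\<phi>. - T (pd1 \<phi>))"

definition dist_pd2 :: "distribution \<Rightarrow> distribution" where
  "dist_pd2 T = (\<lambda>\<phi>. - T (pd2 \<phi>))"

definition dist_mult :: "(real \<times> real \<Rightarrow> real) \<Rightarrow> distribution \<Rightarrow> distribution" where
  "dist_mult a T = (\<lambda>\<phi>. T (\<lambda>x. a x * \<phi> x))"

definition represented_in_L2 :: "distribution \<Rightarrow> (real \<times> real \<Rightarrow> real) \<Rightarrow> bool" where
  "represented_in_L2 T g \<longleftrightarrow>
     square_integrable g \<and> (\<forall>\<phi>\<in>test_functions. T \<phi> = regular_distribution g \<phi>)"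

definition dist_cone_d1 :: "(real \<times> real \<Rightarrow> real) \<Rightarrow> distribution" where
  "dist_cone_d1 u = dist_mult fst (dist_pd1 (regular_distribution u))"

definition dist_cone_d2 :: "(real \<times> real \<Rightarrow> real) \<Rightarrow> distribution" where
  "dist_cone_d2 u = dist_pd2 (regular_distribution u)"

text \<open>Since \<open>u\<close> itself is required to be square integrable, the elements are functions;
  they are not quotiented by equality almost everywhere, and values off the half-plane are
  irrelevant.\<close>

definition cone_sobolev :: "(real \<times> real \<Rightarrow> real) set" where
  "cone_sobolev = {u. square_integrable u \<and>
     (\<exists>g. represented_in_L2 (dist_cone_d1 u) g) \<and>
     (\<exists>g. represented_in_L2 (dist_cone_d2 u) g)}"

text \<open>The representing functions are unique up to null sets, so integrals of the gradient do
  not depend on the choice.\<close>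

definition cone_grad :: "(real \<times> real \<Rightarrow> real) \<Rightarrow> real \<times> real \<Rightarrow> real \<times> real" where
  "cone_grad u x =
     ((SOME g. represented_in_L2 (dist_cone_d1 u) g) x,
      (SOME g. represented_in_L2 (dist_cone_d2 u) g) x)"

text \<open>Valued in \<^typ>\<open>ennreal\<close> so that the infimum of the empty set is infinity.\<close>

definition orlicz :: "(real \<Rightarrow> real) \<Rightarrow> (real \<times> real \<Rightarrow> real) \<Rightarrow> ennreal" where
  "orlicz A u =
     Inf (ennreal ` {l. 0 < l \<and> (\<integral>\<^sup>+x. ennreal (A (\<bar>u x\<bar> / l)) \<partial>cone_measure) < \<infinity>})"

end

theory Submission
  imports Defs "HOL-Computational_Algebra.Polynomial"
begin

text \<open>
  The substitution \<open>t = ln x\<^sub>1\<close> carries the cone measure to Lebesgue measure on the plane and the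
  cone gradient to the ordinary gradient, so the claim is the Trudinger-Moser inequality on the
  whole plane in the subcritical, scale invariant form of Adachi and Tanaka. By homogeneity it
  suffices to treat \<open>v\<close> with \<open>\<integral>\<bar>\<nabla>v\<bar>\<^sup>2 \<le> 1\<close> and to put \<open>M = \<bar>v\<bar>\<^sub>2\<close>. The sharp constant
  \<open>4\<pi>\<close> comes from an estimate for the measure of a single superlevel set, in place of the usual
  symmetrization.

  For smooth \<open>v\<close>, averaging \<open>v (x + z) - v x = \<integral>\<^sub>0\<^sup>1 z \<bullet> \<nabla>v (x + \<tau>z) d\<tau>\<close> over the disc
  \<open>\<bar>z\<bar> < R\<close> and rescaling \<open>w = \<tau>z\<close> bounds \<open>\<bar>v x\<bar>\<close> by a disc average plus the truncated potential
  \<open>(1/2\<pi>) \<integral>\<^bsub>\<bar>w\<bar><R\<^esub> \<bar>\<nabla>v (x + w)\<bar> / \<bar>w\<bar> dw\<close> (lemma \<open>disc_average_bound\<close>). Let \<open>E\<close> have measure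
  \<open>t = \<pi>r\<^sup>2\<close> and take \<open>R = M\<close>. The part of the potential over \<open>r \<le> \<bar>w\<bar> < R\<close> is at most
  \<open>sqrt ((ln (R/r) + 1/2) / (2\<pi>))\<close> at every point by Cauchy-Schwarz; the part over \<open>\<bar>w\<bar> < r\<close> is
  integrated over \<open>E\<close> first, where Cauchy-Schwarz and Fubini give \<open>O(t)\<close>. This is lemma
  \<open>integral_over_set_bound\<close>:
  \<open>\<integral>\<^sub>E \<bar>v\<bar> \<le> t (2/sqrt \<pi> + sqrt ((ln\<^sup>+ (\<pi>M\<^sup>2/t) + 1) / (4\<pi>)))\<close>. If \<open>v > s\<close> on \<open>E\<close>, the left side
  is at least \<open>s t\<close>, and solving for \<open>t\<close> yields, for \<open>s \<ge> 2\<close>,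
  \<open>t \<le> \<pi>M\<^sup>2 exp (1 - 4\<pi>(s - 2/sqrt \<pi>)\<^sup>2)\<close>
  (lemma \<open>emeasure_superlevel_le\<close>). Since \<open>\<alpha> < 4\<pi>\<close>, this decay beats \<open>exp (\<alpha>s\<^sup>2)\<close>; summing over
  integer levels controls the part where \<open>\<bar>v\<bar> > 2\<close>, while for \<open>\<bar>v\<bar> \<le> 2\<close> the integrand is at most
  a multiple of \<open>v\<^sup>2\<close>. Every term is proportional to \<open>M\<^sup>2\<close>.

  The bound for a general Sobolev function follows by mollification. As the estimate only involves
  \<open>\<integral>\<^sub>K v\<close> for compact \<open>K\<close>, it survives the limit as soon as \<open>\<integral>\<^sub>K v\<^sub>\<epsilon> \<rightarrow> \<integral>\<^sub>K v\<close>, and by duality this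
  only requires that the indicator of \<open>K\<close> moves continuously under translation
  (lemma \<open>integral_mollify_close\<close>). The mollifiers are tensor products of one-variable bumps, so that
  all test functions occurring are products \<open>a (ln x\<^sub>1) / x\<^sub>1 * c (x\<^sub>2)\<close>, whose smoothness is a
  one-variable matter.
\<close>

section \<open>The potential bound for a function with a gradient\<close>

lemma nn_integral_lborel_shift:
  fixes f :: "'a::euclidean_space \<Rightarrow> ennreal"
  assumes [measurable]: "f \<in> borel_measurable borel"
  shows "(\<integral>\<^sup>+x. f (c + x) \<partial>lborel) = (\<integral>\<^sup>+x. f x \<partial>lborel)"
proof -
  have "(\<integral>\<^sup>+x. f x \<partial>lborel) = (\<integral>\<^sup>+x. f x \<partial>distr lborel borel ((+) c))"
    by (simp add: lborel_distr_plus)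
  also have "\<dots> = (\<integral>\<^sup>+x. f (c + x) \<partial>lborel)"
    by (subst nn_integral_distr) auto
  finally show ?thesis by simp
qed

lemma nn_integral_lborel_scale:
  fixes f :: "'a::euclidean_space \<Rightarrow> ennreal"
  assumes [measurable]: "f \<in> borel_measurable borel" and "c > 0"
  shows "(\<integral>\<^sup>+x. f x \<partial>lborel) = ennreal (c ^ DIM('a)) * (\<integral>\<^sup>+x. f (c *\<^sub>R x) \<partial>lborel)"
proof -
  have "(\<integral>\<^sup>+x. f x \<partial>lborel) = (\<integral>\<^sup>+x. f x \<partial>density (distr lborel borel (\<lambda>x. 0 + c *\<^sub>R x)) (\<lambda>_. \<bar>c\<bar>^DIM('a)))"
    using lborel_affine[of c "0::'a"] \<open>c > 0\<close> by simp
  also have "\<dots> = (\<integral>\<^sup>+x. ennreal (c ^ DIM('a)) * f x \<partial>distr lborel borel (\<lambda>x. 0 + c *\<^sub>R x))"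
    using \<open>c > 0\<close> by (subst nn_integral_density) auto
  also have "\<dots> = ennreal (c ^ DIM('a)) * (\<integral>\<^sup>+x. f (c *\<^sub>R x) \<partial>lborel)"
    by (subst nn_integral_distr) (auto simp: nn_integral_cmult)
  finally show ?thesis .
qed

text \<open>
  The weight \<open>1/\<tau>\<^sup>3\<close> is what remains of \<open>\<bar>z\<bar>\<close> and of the area element after the substitution
  \<open>w = \<tau>z\<close>; integrating it over the admissible \<open>\<tau>\<close> produces the kernel \<open>1/\<bar>w\<bar>\<close>.
\<close>

lemma nn_integral_inverse_cube:
  fixes a :: real assumes "0 < a"
  shows "(\<integral>\<^sup>+\<tau>. ennreal (1 / \<tau>^3) * indicator {a..1} \<tau> \<partial>lborel) \<le> ennreal (1 / (2 * a\<^sup>2))"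
proof (cases "a \<le> 1")
  case True
  have "(\<integral>\<^sup>+\<tau>. ennreal (1 / \<tau>^3) * indicator {a..1} \<tau> \<partial>lborel)
      = ennreal ((- 1 / (2 * 1\<^sup>2)) - (- 1 / (2 * a\<^sup>2)))"
    using assms True
    by (intro nn_integral_FTC_Icc[where F="\<lambda>\<tau>. - 1 / (2 * \<tau>\<^sup>2)"])
       (auto intro!: derivative_eq_intros simp: field_simps power2_eq_square power3_eq_cube)
  then show ?thesis by (simp add: ennreal_leI)
next
  case False
  then show ?thesis by (simp)
qed

lemma emeasure_ball_plane: 
  "0 \<le> r \<Longrightarrow> emeasure lborel (ball (0::real\<times>real) r) = ennreal (pi * r\<^sup>2)"
  by (simp add: emeasure_ball unit_ball_vol_2 ennreal_mult power2_eq_square)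

text \<open>
  For \<open>U = \<bar>u\<bar>\<close> and \<open>G = \<bar>\<nabla>u\<bar>\<close> the hypothesis is the fundamental theorem of calculus along the
  segment from \<open>x\<close> to \<open>x + z\<close>. It is integrated over the disc of radius \<open>R\<close>; after exchanging the integrals and substituting
  \<open>w = \<tau>z\<close>, a fixed \<open>w\<close> is reached for \<open>\<bar>w\<bar>/R \<le> \<tau> \<le> 1\<close>. Linear scaling thus does the work of
  polar coordinates.
\<close>

lemma disc_average_bound:
  fixes U G :: "real \<times> real \<Rightarrow> ennreal"
  assumes [measurable]: "U \<in> borel_measurable borel" "G \<in> borel_measurable borel"
    and R: "R > 0"
    and H: "\<And>x z. U x \<le> U (x + z)
        + ennreal (norm z) * (\<integral>\<^sup>+\<tau>. G (x + \<tau> *\<^sub>R z) * indicator {0..1} \<tau> \<partial>lborel)"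
  shows "ennreal (pi * R\<^sup>2) * U x \<le> (\<integral>\<^sup>+z. U (x + z) * indicator (ball 0 R) z \<partial>lborel)
     + ennreal (R\<^sup>2 / 2) * (\<integral>\<^sup>+w. G (x + w) * ennreal (1 / norm w) * indicator (ball 0 R) w \<partial>lborel)"
proof -
  let ?B = "ball (0::real\<times>real) R"
  have [measurable]: "?B \<in> sets borel" by simp
  have "ennreal (pi * R\<^sup>2) * U x = (\<integral>\<^sup>+z. U x * indicator ?B z \<partial>lborel)"
    using R by (subst nn_integral_cmult_indicator) (auto simp: emeasure_ball_plane mult.commute)
  also have "\<dots> \<le> (\<integral>\<^sup>+z. U (x + z) * indicator ?B z
      + ennreal (norm z) * (\<integral>\<^sup>+\<tau>. G (x + \<tau> *\<^sub>R z) * indicator {0..1} \<tau> \<partial>lborel) * indicator ?B z \<partial>lborel)"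
    using H by (intro nn_integral_mono) (auto split: split_indicator)
  also have "\<dots> = (\<integral>\<^sup>+z. U (x + z) * indicator ?B z \<partial>lborel)
     + (\<integral>\<^sup>+z. ennreal (norm z) * (\<integral>\<^sup>+\<tau>. G (x + \<tau> *\<^sub>R z) * indicator {0..1} \<tau> \<partial>lborel) * indicator ?B z \<partial>lborel)"
    by (rule nn_integral_add) measurable
  also have "(\<integral>\<^sup>+z. ennreal (norm z) * (\<integral>\<^sup>+\<tau>. G (x + \<tau> *\<^sub>R z) * indicator {0..1} \<tau> \<partial>lborel) * indicator ?B z \<partial>lborel)
     = (\<integral>\<^sup>+z. \<integral>\<^sup>+\<tau>. ennreal (norm z) * G (x + \<tau> *\<^sub>R z) * indicator {0..1} \<tau> * indicator ?B z \<partial>lborel \<partial>lborel)"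
    by (simp add: nn_integral_cmult[symmetric] nn_integral_multc[symmetric] mult.assoc)
  also have "\<dots> = (\<integral>\<^sup>+\<tau>. \<integral>\<^sup>+z. ennreal (norm z) * G (x + \<tau> *\<^sub>R z) * indicator {0..1} \<tau> * indicator ?B z \<partial>lborel \<partial>lborel)"
    by (rule lborel_pair.Fubini') measurable
  \<comment> \<open>substitute \<open>w = \<tau>z\<close> in the inner integral, for each \<open>\<tau> > 0\<close>\<close>
  also have "\<dots> \<le> (\<integral>\<^sup>+\<tau>. \<integral>\<^sup>+w. ennreal (norm w) * G (x + w) * ennreal (1 / \<tau>^3) * indicator {norm w / R..1} \<tau> \<partial>lborel \<partial>lborel)"
  proof (rule nn_integral_mono_AE)
    have "AE \<tau> in lborel. \<tau> \<noteq> (0::real)" by (simp add: AE_lborel_singleton)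
    then show "AE \<tau> in lborel. (\<integral>\<^sup>+z. ennreal (norm z) * G (x + \<tau> *\<^sub>R z) * indicator {0..1} \<tau> * indicator ?B z \<partial>lborel)
       \<le> (\<integral>\<^sup>+w. ennreal (norm w) * G (x + w) * ennreal (1 / \<tau>^3) * indicator {norm w / R..1} \<tau> \<partial>lborel)"
    proof eventually_elim
      case (elim \<tau>)
      show ?case
      proof (cases "\<tau> \<in> {0..1}")
        case True
        then have \<tau>: "0 < \<tau>" "\<tau> \<le> 1" using elim by auto
        have [measurable]: "Measurable.pred borel (\<lambda>z::real\<times>real. \<tau> \<in> {norm z / R..1})"
          "Measurable.pred borel (\<lambda>z::real\<times>real. \<tau> \<in> {norm (\<tau> *\<^sub>R z) / R..1})"
          unfolding atLeastAtMost_iff by measurable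
        have "(\<integral>\<^sup>+w. ennreal (norm w) * G (x + w) * ennreal (1 / \<tau>^3) * indicator {norm w / R..1} \<tau> \<partial>lborel)
           = ennreal (\<tau>\<^sup>2) * (\<integral>\<^sup>+z. ennreal (norm (\<tau> *\<^sub>R z)) * G (x + \<tau> *\<^sub>R z) * ennreal (1 / \<tau>^3) * indicator {norm (\<tau> *\<^sub>R z) / R..1} \<tau> \<partial>lborel)"
        proof (subst nn_integral_lborel_scale[OF _ \<tau>(1)])
          show "(\<lambda>w. ennreal (norm w) * G (x + w) * ennreal (1 / \<tau>^3) * indicator {norm w / R..1} \<tau>) \<in> borel_measurable borel"
            by measurable
        qed (simp add: power2_eq_square)
        also have "\<dots> = (\<integral>\<^sup>+z. ennreal (\<tau>\<^sup>2) * (ennreal (norm (\<tau> *\<^sub>R z)) * G (x + \<tau> *\<^sub>R z) * ennreal (1 / \<tau>^3) * indicator {norm (\<tau> *\<^sub>R z) / R..1} \<tau>) \<partial>lborel)"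
          by (rule nn_integral_cmult[symmetric]) measurable
        also have "\<dots> \<ge> (\<integral>\<^sup>+z. ennreal (norm z) * G (x + \<tau> *\<^sub>R z) * indicator {0..1} \<tau> * indicator ?B z \<partial>lborel)"
        proof (rule nn_integral_mono)
          fix z :: "real \<times> real"
          show "ennreal (norm z) * G (x + \<tau> *\<^sub>R z) * indicator {0..1} \<tau> * indicator ?B z
            \<le> ennreal (\<tau>\<^sup>2) * (ennreal (norm (\<tau> *\<^sub>R z)) * G (x + \<tau> *\<^sub>R z) * ennreal (1 / \<tau>^3) * indicator {norm (\<tau> *\<^sub>R z) / R..1} \<tau>)"
          proof (cases "norm z < R")
            case True
            have "ennreal (\<tau>\<^sup>2) * (ennreal (norm (\<tau> *\<^sub>R z)) * G (x + \<tau> *\<^sub>R z) * ennreal (1 / \<tau>^3))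
               = ennreal (\<tau>\<^sup>2 * norm (\<tau> *\<^sub>R z) * (1 / \<tau>^3)) * G (x + \<tau> *\<^sub>R z)"
              using \<tau> by (simp only: ennreal_mult norm_ge_zero zero_le_power2 zero_le_divide_1_iff
                zero_le_power less_imp_le mult_nonneg_nonneg mult_ac)
            also have "\<tau>\<^sup>2 * norm (\<tau> *\<^sub>R z) * (1 / \<tau>^3) = norm z"
              using \<tau> by (simp add: field_simps power2_eq_square power3_eq_cube)
            finally show ?thesis using True \<tau> R
              by (simp add: indicator_def field_simps)
          qed (auto)
        qed
        finally show ?thesis .
      qed auto
    qed
  qed
  also have "\<dots> = (\<integral>\<^sup>+w. \<integral>\<^sup>+\<tau>. ennreal (norm w) * G (x + w) * ennreal (1 / \<tau>^3) * indicator {norm w / R..1} \<tau> \<partial>lborel \<partial>lborel)"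
  proof (rule lborel_pair.Fubini')
    have [measurable]: "Measurable.pred (lborel \<Otimes>\<^sub>M lborel)
        (\<lambda>p::(real\<times>real)\<times>real. snd p \<in> {norm (fst p) / R..1})"
      unfolding atLeastAtMost_iff by measurable
    show "(\<lambda>(w, \<tau>). ennreal (norm w) * G (x + w) * ennreal (1 / \<tau>^3) * indicator {norm w / R..1} \<tau>)
      \<in> borel_measurable (lborel \<Otimes>\<^sub>M lborel)"
      unfolding case_prod_beta by measurable
  qed
  also have "\<dots> \<le> (\<integral>\<^sup>+w. ennreal (R\<^sup>2 / 2) * (G (x + w) * ennreal (1 / norm w) * indicator ?B w) \<partial>lborel)"
  proof (rule nn_integral_mono_AE)
    \<comment> \<open>for \<open>\<bar>w\<bar> = R\<close> the interval \<open>{1..1}\<close> is nonempty although \<open>w\<close> lies outside the open disc\<close>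
    have "AE w in lborel. norm (w :: real \<times> real) \<noteq> R" 
    proof -
      have "AE w in lborel. w \<notin> sphere (0::real\<times>real) R"
        using negligible_sphere[of "0::real\<times>real" R]
        by (intro AE_not_in) (auto simp: negligible_iff_null_sets null_sets_completion_iff)
      then show ?thesis by simp
    qed
    then show "AE w in lborel. (\<integral>\<^sup>+\<tau>. ennreal (norm w) * G (x + w) * ennreal (1 / \<tau>^3) * indicator {norm w / R..1} \<tau> \<partial>lborel)
       \<le> ennreal (R\<^sup>2 / 2) * (G (x + w) * ennreal (1 / norm w) * indicator ?B w)"
    proof eventually_elim
      case (elim w)
      have "(\<integral>\<^sup>+\<tau>. ennreal (norm w) * G (x + w) * ennreal (1 / \<tau>^3) * indicator {norm w / R..1} \<tau> \<partial>lborel)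
         = ennreal (norm w) * G (x + w) * (\<integral>\<^sup>+\<tau>. ennreal (1 / \<tau>^3) * indicator {norm w / R..1} \<tau> \<partial>lborel)"
        by (simp add: nn_integral_cmult[symmetric] mult.assoc)
      also have "\<dots> \<le> ennreal (R\<^sup>2 / 2) * (G (x + w) * ennreal (1 / norm w) * indicator ?B w)"
      proof (cases "w = 0 \<or> norm w > R")
        case True
        then show ?thesis using R by (auto simp: )
      next
        case False
        then have w: "norm w < R" "w \<noteq> 0" using elim by auto
        have "ennreal (norm w) * (\<integral>\<^sup>+\<tau>. ennreal (1 / \<tau>^3) * indicator {norm w / R..1} \<tau> \<partial>lborel)
          \<le> ennreal (norm w) * ennreal (1 / (2 * (norm w / R)\<^sup>2))"
          using w R by (intro mult_left_mono nn_integral_inverse_cube) auto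
        also have "\<dots> = ennreal (norm w * (1 / (2 * (norm w / R)\<^sup>2)))"
          by (subst ennreal_mult) auto
        also have "norm w * (1 / (2 * (norm w / R)\<^sup>2)) = R\<^sup>2 / 2 * (1 / norm w)"
          using w R by (simp add: field_simps power2_eq_square)
        also have "ennreal (R\<^sup>2 / 2 * (1 / norm w)) = ennreal (R\<^sup>2 / 2) * ennreal (1 / norm w)"
          by (subst ennreal_mult) auto
        finally have "G (x + w) * (ennreal (norm w) * (\<integral>\<^sup>+\<tau>. ennreal (1 / \<tau>^3) * indicator {norm w / R..1} \<tau> \<partial>lborel))
           \<le> G (x + w) * (ennreal (R\<^sup>2 / 2) * ennreal (1 / norm w))"
          by (rule mult_left_mono) auto
        then show ?thesis using w by (simp add: mult_ac)
      qed
      finally show ?case .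
    qed
  qed
  also have "\<dots> = ennreal (R\<^sup>2 / 2) * (\<integral>\<^sup>+w. G (x + w) * ennreal (1 / norm w) * indicator ?B w \<partial>lborel)"
    by (rule nn_integral_cmult) measurable
  finally show ?thesis by (simp add: add_left_mono)
qed

lemma Cauchy_Schwarz_nn_integral_bound:
  assumes [measurable]: "f \<in> borel_measurable M" "g \<in> borel_measurable M"
    and "(\<integral>\<^sup>+x. f x ^ 2 \<partial>M) \<le> ennreal (a\<^sup>2)" "(\<integral>\<^sup>+x. g x ^ 2 \<partial>M) \<le> ennreal (b\<^sup>2)" "0 \<le> a" "0 \<le> b"
  shows "(\<integral>\<^sup>+x. f x * g x \<partial>M) \<le> ennreal (a * b)"
proof -
  let ?X = "\<integral>\<^sup>+x. f x * g x \<partial>M"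
  have "?X\<^sup>2 \<le> (\<integral>\<^sup>+x. f x ^ 2 \<partial>M) * (\<integral>\<^sup>+x. g x ^ 2 \<partial>M)"
    by (rule Cauchy_Schwarz_nn_integral) measurable
  also have "\<dots> \<le> ennreal (a\<^sup>2) * ennreal (b\<^sup>2)"
    using assms(3,4) by (rule mult_mono) simp_all
  also have "\<dots> = ennreal ((a * b)\<^sup>2)"
    by (subst ennreal_mult[symmetric]) (simp_all add: power_mult_distrib)
  finally have *: "?X\<^sup>2 \<le> ennreal ((a * b)\<^sup>2)" .
  show ?thesis
  proof (cases ?X)
    case (real x)
    have "ennreal (x\<^sup>2) \<le> ennreal ((a * b)\<^sup>2)"
      using * unfolding real(2) ennreal_power[OF real(1)] .
    then have "x\<^sup>2 \<le> (a * b)\<^sup>2" by (rule ennreal_le_iff[THEN iffD1, rotated]) simp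
    then have "x \<le> a * b" by (rule power2_le_imp_le) (rule mult_nonneg_nonneg[OF assms(5,6)])
    then show ?thesis unfolding real(2) by (rule ennreal_leI)
  next
    case top
    have "ennreal ((a * b)\<^sup>2) < top" by (rule ennreal_less_top)
    with * have "?X\<^sup>2 < top" by (rule le_less_trans)
    then show ?thesis unfolding top by (simp add: power2_eq_square)
  qed
qed

text \<open>
  Layer-cake formula: for \<open>\<bar>w\<bar> \<le> b\<close> write \<open>F \<bar>w\<bar> = F b + \<integral> f s ds\<close> over \<open>\<bar>w\<bar> \<le> s \<le> b\<close> and exchange
  the integrals; the points \<open>w\<close> contributing to a given \<open>s\<close> lie in the disc of area \<open>\<pi>s\<^sup>2\<close>.
\<close>

lemma nn_integral_radial_decreasing_le:
  fixes F f :: "real \<Rightarrow> real"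
  assumes ab: "0 \<le> a" "a < b" and [measurable]: "f \<in> borel_measurable borel"
    and F: "\<And>s. 0 < s \<Longrightarrow> s \<le> b \<Longrightarrow> (F has_real_derivative - f s) (at s)"
    and f: "\<And>s. 0 < s \<Longrightarrow> s \<le> b \<Longrightarrow> 0 \<le> f s" and Fb: "0 \<le> F b"
  shows "(\<integral>\<^sup>+w. ennreal (F (norm w)) * indicator {w. a \<le> norm w \<and> norm w < b} w \<partial>(lborel :: (real \<times> real) measure))
    \<le> ennreal (pi * b\<^sup>2 * F b) + (\<integral>\<^sup>+s. ennreal (f s * (pi * s\<^sup>2)) * indicator {a..b} s \<partial>lborel)"
proof -
  have [measurable]: "{w. a \<le> norm w \<and> norm w < b} \<in> sets (borel :: (real \<times> real) measure)"
    by simp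
  have [measurable]: "Measurable.pred (lborel \<Otimes>\<^sub>M lborel)
        (\<lambda>p::(real\<times>real)\<times>real. snd p \<in> {norm (fst p)..b})"
      unfolding atLeastAtMost_iff by measurable
  have [measurable]: "Measurable.pred (borel \<Otimes>\<^sub>M borel)
        (\<lambda>p::real\<times>(real\<times>real). fst p \<in> {norm (snd p)..b})"
      "Measurable.pred (lborel \<Otimes>\<^sub>M lborel)
        (\<lambda>p::real\<times>(real\<times>real). fst p \<in> {norm (snd p)..b})"
      unfolding atLeastAtMost_iff by measurable
  have [measurable]: "ball (0::real\<times>real) b \<in> sets borel" by simp
  have [measurable]: "Measurable.pred borel (\<lambda>w::real\<times>real. s \<in> {norm w..b})" for s
      unfolding atLeastAtMost_iff by measurable
  let ?A = "{w::real\<times>real. a \<le> norm w \<and> norm w < b}"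
  have "(\<integral>\<^sup>+w. ennreal (F (norm w)) * indicator ?A w \<partial>(lborel :: (real \<times> real) measure))
    \<le> (\<integral>\<^sup>+w. ennreal (F b) * indicator (ball (0::real\<times>real) b) w 
       + (\<integral>\<^sup>+s. ennreal (f s) * indicator {norm w..b} s * indicator ?A w \<partial>lborel) \<partial>lborel)"
  proof (rule nn_integral_mono_AE)
    have "AE w in lborel. w \<noteq> (0::real\<times>real)" by (simp add: AE_lborel_singleton)
    then show "AE w in lborel. ennreal (F (norm w)) * indicator ?A w \<le> ennreal (F b) * indicator (ball (0::real\<times>real) b) w 
       + (\<integral>\<^sup>+s. ennreal (f s) * indicator {norm w..b} s * indicator ?A w \<partial>lborel)"
    proof eventually_elim
      case (elim w)
      show ?case
      proof (cases "w \<in> ?A")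
        case True
        have "(\<integral>\<^sup>+s. ennreal (f s) * indicator {norm w..b} s \<partial>lborel) = ennreal ((- F b) - (- F (norm w)))"
        proof (rule nn_integral_FTC_Icc)
          have "0 < norm w" using elim by simp
          then have s: "0 < s" "s \<le> b" if "norm w \<le> s" "s \<le> b" for s
            using that by linarith+
          show "((\<lambda>s. - F s) has_real_derivative f s) (at s)" "0 \<le> f s"
            if "s \<in> {norm w..b}" for s
            using DERIV_minus[OF F[OF s]] f[OF s] that by auto
        qed (use True assms(3) in auto)
        moreover have "ennreal (F (norm w)) \<le> ennreal (F b) + ennreal (F (norm w) - F b)"
        proof (cases "F (norm w) \<ge> F b")
          case True
          then show ?thesis using Fb by (simp flip: ennreal_plus)
        next
          case False
          then show ?thesis by (simp add: ennreal_neg ennreal_leI)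
        qed
        ultimately show ?thesis using True by simp
      qed simp
    qed
  qed
  also have "\<dots> = (\<integral>\<^sup>+w. ennreal (F b) * indicator (ball (0::real\<times>real) b) w \<partial>lborel)
     + (\<integral>\<^sup>+w. (\<integral>\<^sup>+s. ennreal (f s) * indicator {norm w..b} s * indicator ?A w \<partial>lborel) \<partial>lborel)"
    by (rule nn_integral_add) measurable
  also have "(\<integral>\<^sup>+w. ennreal (F b) * indicator (ball (0::real\<times>real) b) w \<partial>lborel) = ennreal (pi * b\<^sup>2 * F b)"
    using ab Fb by (subst nn_integral_cmult_indicator) (auto simp: emeasure_ball_plane ennreal_mult mult_ac)
  also have "(\<integral>\<^sup>+w. (\<integral>\<^sup>+s. ennreal (f s) * indicator {norm w..b} s * indicator ?A w \<partial>lborel) \<partial>lborel)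
     = (\<integral>\<^sup>+s. (\<integral>\<^sup>+w. ennreal (f s) * indicator {norm w..b} s * indicator ?A w \<partial>lborel) \<partial>lborel)"
    by (rule lborel_pair.Fubini') (unfold case_prod_beta, measurable)
  also have "\<dots> \<le> (\<integral>\<^sup>+s. ennreal (f s * (pi * s\<^sup>2)) * indicator {a..b} s \<partial>lborel)"
  proof (rule nn_integral_mono)
    fix s :: real
    show "(\<integral>\<^sup>+w. ennreal (f s) * indicator {norm w..b} s * indicator ?A w \<partial>lborel)
       \<le> ennreal (f s * (pi * s\<^sup>2)) * indicator {a..b} s"
    proof (cases "s \<in> {a..b} \<and> 0 < s")
      case True
      have "(\<integral>\<^sup>+w. ennreal (f s) * indicator {norm w..b} s * indicator ?A w \<partial>lborel)
        \<le> (\<integral>\<^sup>+w. ennreal (f s) * indicator (cball (0::real\<times>real) s) w \<partial>lborel)"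
        by (intro nn_integral_mono) (auto split: split_indicator)
      also have "\<dots> = ennreal (f s) * ennreal (pi * s\<^sup>2)"
        using True by (subst nn_integral_cmult_indicator)
          (auto simp: emeasure_cball unit_ball_vol_2 ennreal_mult power2_eq_square)
      also have "\<dots> = ennreal (f s * (pi * s\<^sup>2))"
        using True f by (subst ennreal_mult) auto
      finally show ?thesis using True by simp
    next
      case False
      have "(\<integral>\<^sup>+w. ennreal (f s) * indicator {norm w..b} s * indicator ?A w \<partial>lborel)
         = (\<integral>\<^sup>+w. 0 \<partial>(lborel :: (real\<times>real) measure))"
      proof (rule nn_integral_cong_AE)
        have "AE w in lborel. w \<noteq> (0::real\<times>real)" by (simp add: AE_lborel_singleton)
        then show "AE w in lborel. ennreal (f s) * indicator {norm w..b} s * indicator ?A w = 0"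
        proof eventually_elim
          case (elim w)
          then have "norm w > 0" by simp
          then have "\<not> (norm w \<le> s \<and> s \<le> b \<and> a \<le> norm w)"
            using False unfolding atLeastAtMost_iff by linarith
          then show ?case by (auto simp: indicator_def)
        qed
      qed
      then show ?thesis by simp
    qed
  qed
  finally show ?thesis by (simp add: add_left_mono)
qed

lemma nn_integral_inverse_norm_ball:
  assumes "0 < r"
  shows "(\<integral>\<^sup>+w. ennreal (1 / norm w) * indicator (ball 0 r) w \<partial>(lborel :: (real \<times> real) measure)) \<le> ennreal (2 * pi * r)"
proof -
  have "(\<integral>\<^sup>+w. ennreal (1 / norm w) * indicator (ball 0 r) w \<partial>(lborel :: (real \<times> real) measure))
      = (\<integral>\<^sup>+w. ennreal (1 / norm w) * indicator {w. 0 \<le> norm w \<and> norm w < r} w \<partial>(lborel :: (real \<times> real) measure))"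
    by (intro nn_integral_cong) (auto split: split_indicator)
  also have "\<dots> \<le> ennreal (pi * r\<^sup>2 * (1 / r)) 
      + (\<integral>\<^sup>+s. ennreal (1 / s\<^sup>2 * (pi * s\<^sup>2)) * indicator {0..r} s \<partial>lborel)"
    using assms
    by (intro nn_integral_radial_decreasing_le[where F="\<lambda>s. 1 / s"])
       (auto intro!: derivative_eq_intros simp: power2_eq_square)
  also have "(\<integral>\<^sup>+s. ennreal (1 / s\<^sup>2 * (pi * s\<^sup>2)) * indicator {0..r} s \<partial>lborel)
     \<le> (\<integral>\<^sup>+s. ennreal pi * indicator {0..r} s \<partial>lborel)"
    by (intro nn_integral_mono) (auto split: split_indicator)
  also have "\<dots> = ennreal (pi * r)"
    using assms by (subst nn_integral_cmult_indicator) (auto simp: ennreal_mult)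
  also have "ennreal (pi * r\<^sup>2 * (1 / r)) + ennreal (pi * r) = ennreal (2 * pi * r)"
    using assms by (subst ennreal_plus[symmetric]) (auto simp: power2_eq_square field_simps)
  finally show ?thesis by (simp add: add_left_mono)
qed

lemma nn_integral_inverse_norm_square_annulus:
  assumes "0 < r"
  shows "(\<integral>\<^sup>+w. ennreal (1 / (norm w)\<^sup>2) * indicator {w. r \<le> norm w \<and> norm w < R} w \<partial>(lborel :: (real \<times> real) measure))
     \<le> ennreal (2 * pi * max 0 (ln (R / r)) + pi)"
proof (cases "r < R")
  case True
  have "(\<integral>\<^sup>+w. ennreal (1 / (norm w)\<^sup>2) * indicator {w. r \<le> norm w \<and> norm w < R} w \<partial>(lborel :: (real \<times> real) measure))
     \<le> ennreal (pi * R\<^sup>2 * (1 / R\<^sup>2)) 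
      + (\<integral>\<^sup>+s. ennreal (2 / s^3 * (pi * s\<^sup>2)) * indicator {r..R} s \<partial>lborel)"
    using assms True
    by (intro nn_integral_radial_decreasing_le[where F="\<lambda>s. 1 / s\<^sup>2"])
       (auto intro!: derivative_eq_intros simp: power2_eq_square power3_eq_cube field_simps)
  also have "(\<integral>\<^sup>+s. ennreal (2 / s^3 * (pi * s\<^sup>2)) * indicator {r..R} s \<partial>lborel) 
     = ennreal (2 * pi * ln R - 2 * pi * ln r)"
    using assms True
    by (intro nn_integral_FTC_Icc)
       (auto intro!: derivative_eq_intros simp: power2_eq_square power3_eq_cube field_simps)
  also have "2 * pi * ln R - 2 * pi * ln r = 2 * pi * max 0 (ln (R / r))"
    using assms True by (simp add: ln_div max_def right_diff_distrib)
  also have "pi * R\<^sup>2 * (1 / R\<^sup>2) = pi" using assms True by simp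
  finally show ?thesis
    by (subst (asm) ennreal_plus[symmetric]) (auto simp: add.commute)
next
  case False
  then have *: "{w::real\<times>real. r \<le> norm w \<and> norm w < R} = {}" by auto
  show ?thesis unfolding * by simp
qed

section \<open>Integrals over sets of given measure\<close>

text \<open>
  The radius \<open>r\<close> with \<open>\<pi>r\<^sup>2 = t\<close> splits the potential of \<open>disc_average_bound\<close> (with \<open>R = M\<close>). Outside
  radius \<open>r\<close> the kernel has \<open>L\<^sup>2\<close> norm squared at most \<open>2\<pi> ln (M/r) + \<pi>\<close>, and this term alone carries
  the sharp constant, as \<open>ln (M/r)\<close> is half of \<open>ln (\<pi>M\<^sup>2/t)\<close>. Inside radius \<open>r\<close> the kernel is not square
  integrable, but integrating over \<open>E\<close> first leaves its \<open>L\<^sup>1\<close> norm \<open>2\<pi>r\<close> times \<open>sqrt t\<close>, which is of order \<open>t\<close>.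
\<close>

lemma integral_over_set_bound:
  fixes U G :: "real \<times> real \<Rightarrow> ennreal"
  assumes [measurable]: "U \<in> borel_measurable borel" "G \<in> borel_measurable borel"
    and H: "\<And>x z. U x \<le> U (x + z)
        + ennreal (norm z) * (\<integral>\<^sup>+\<tau>. G (x + \<tau> *\<^sub>R z) * indicator {0..1} \<tau> \<partial>lborel)"
    and U2: "(\<integral>\<^sup>+x. U x ^ 2 \<partial>lborel) \<le> ennreal (M\<^sup>2)" and M: "M > 0"
    and G2: "(\<integral>\<^sup>+x. G x ^ 2 \<partial>lborel) \<le> 1"
    and E[measurable]: "E \<in> sets borel" and t: "emeasure lborel E = ennreal t" "t > 0"
  shows "(\<integral>\<^sup>+x. U x * indicator E x \<partial>lborel)
    \<le> ennreal (t * (2 / sqrt pi + sqrt ((max 0 (ln (pi * M\<^sup>2 / t)) + 1) / (4 * pi))))"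
proof -
  let ?B = "ball (0::real\<times>real) M"
  define r where "r = sqrt (t / pi)"
  have r: "r > 0" using t by (simp add: r_def)
  define K where "K = 2 * pi * max 0 (ln (M / r)) + pi"
  have K: "K \<ge> 0" by (simp add: K_def)
  let ?A = "{w::real\<times>real. r \<le> norm w \<and> norm w < M}"
  have [measurable]: "?B \<in> sets borel" "ball (0::real\<times>real) r \<in> sets borel" "?A \<in> sets borel" by simp_all
  have indE: "(\<integral>\<^sup>+x. (indicator E x)\<^sup>2 \<partial>lborel) \<le> ennreal ((sqrt t)\<^sup>2)"
  proof -
    have "(\<integral>\<^sup>+x. (indicator E x)\<^sup>2 \<partial>lborel) = (\<integral>\<^sup>+x. indicator E x \<partial>lborel)"
      by (intro nn_integral_cong) (auto split: split_indicator)
    then show ?thesis using t by simp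
  qed
  \<comment> \<open>for \<open>\<bar>w\<bar> < r\<close>: Cauchy-Schwarz in \<open>x\<close> over \<open>E\<close>, uniformly in \<open>w\<close>\<close>
  have near: "(\<integral>\<^sup>+x. G (x + w) * indicator E x \<partial>lborel) \<le> ennreal (sqrt t)" for w
  proof -
    have "(\<integral>\<^sup>+x. G (x + w) ^ 2 \<partial>lborel) \<le> ennreal (1\<^sup>2)"
      using nn_integral_lborel_shift[of "\<lambda>x. G x ^ 2" w] G2 by (simp add: add.commute)
    then have "(\<integral>\<^sup>+x. G (x + w) * indicator E x \<partial>lborel) \<le> ennreal (1 * sqrt t)"
      using indE t by (intro Cauchy_Schwarz_nn_integral_bound) auto
    then show ?thesis by simp
  qed
  \<comment> \<open>for \<open>r \<le> \<bar>w\<bar> < M\<close>: Cauchy-Schwarz in \<open>w\<close>, uniformly in \<open>x\<close>\<close>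
  have far: "(\<integral>\<^sup>+w. G (x + w) * (ennreal (1 / norm w) * indicator ?A w) \<partial>lborel) \<le> ennreal (sqrt K)" for x
  proof -
    have 1: "(\<integral>\<^sup>+w. G (x + w) ^ 2 \<partial>lborel) \<le> ennreal (1\<^sup>2)"
      using nn_integral_lborel_shift[of "\<lambda>x. G x ^ 2" x] G2 by simp
    have "(\<integral>\<^sup>+w. (ennreal (1 / norm w) * indicator ?A w)\<^sup>2 \<partial>lborel)
       = (\<integral>\<^sup>+w. ennreal (1 / (norm w)\<^sup>2) * indicator ?A w \<partial>lborel)"
      by (intro nn_integral_cong) (auto split: split_indicator simp: ennreal_power power_divide)
    also have "\<dots> \<le> ennreal K"
      unfolding K_def by (rule nn_integral_inverse_norm_square_annulus[OF r])
    finally have "(\<integral>\<^sup>+w. G (x + w) * (ennreal (1 / norm w) * indicator ?A w) \<partial>lborel) \<le> ennreal (1 * sqrt K)"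
      using 1 K by (intro Cauchy_Schwarz_nn_integral_bound) auto
    then show ?thesis by simp
  qed
  have avg: "(\<integral>\<^sup>+z. U (x + z) * indicator ?B z \<partial>lborel) \<le> ennreal (M * (sqrt pi * M))" for x
  proof -
    have "(\<integral>\<^sup>+z. U (x + z) ^ 2 \<partial>lborel) \<le> ennreal (M\<^sup>2)"
      using nn_integral_lborel_shift[of "\<lambda>x. U x ^ 2" x] U2 by simp
    moreover have "(\<integral>\<^sup>+z. (indicator ?B z)\<^sup>2 \<partial>lborel) = (\<integral>\<^sup>+z. indicator ?B z \<partial>lborel)"
      by (intro nn_integral_cong) (auto split: split_indicator)
    then have "(\<integral>\<^sup>+z. (indicator ?B z)\<^sup>2 \<partial>lborel) \<le> ennreal ((sqrt pi * M)\<^sup>2)"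
      using M by (simp add: emeasure_ball_plane power_mult_distrib)
    ultimately show ?thesis
      using M by (intro Cauchy_Schwarz_nn_integral_bound) auto
  qed
  have "ennreal (pi * M\<^sup>2) * (\<integral>\<^sup>+x. U x * indicator E x \<partial>lborel)
     = (\<integral>\<^sup>+x. (ennreal (pi * M\<^sup>2) * U x) * indicator E x \<partial>lborel)"
    by (simp add: nn_integral_cmult[symmetric] mult.assoc)
  also have "\<dots> \<le> (\<integral>\<^sup>+x. (ennreal (M * (sqrt pi * M)) + ennreal (M\<^sup>2 / 2) * 
       ((\<integral>\<^sup>+w. G (x + w) * (ennreal (1 / norm w) * indicator (ball 0 r) w) \<partial>lborel) + ennreal (sqrt K))) * indicator E x \<partial>lborel)"
  proof (intro nn_integral_mono mult_right_mono)
    fix x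
    have "(\<integral>\<^sup>+w. G (x + w) * ennreal (1 / norm w) * indicator ?B w \<partial>lborel)
       \<le> (\<integral>\<^sup>+w. G (x + w) * (ennreal (1 / norm w) * indicator (ball 0 r) w)
          + G (x + w) * (ennreal (1 / norm w) * indicator ?A w) \<partial>lborel)"
      by (intro nn_integral_mono) (auto split: split_indicator)
    also have "\<dots> = (\<integral>\<^sup>+w. G (x + w) * (ennreal (1 / norm w) * indicator (ball 0 r) w) \<partial>lborel)
        + (\<integral>\<^sup>+w. G (x + w) * (ennreal (1 / norm w) * indicator ?A w) \<partial>lborel)"
      by (rule nn_integral_add) measurable
    also have "\<dots> \<le> (\<integral>\<^sup>+w. G (x + w) * (ennreal (1 / norm w) * indicator (ball 0 r) w) \<partial>lborel) + ennreal (sqrt K)"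
      by (intro add_left_mono far)
    finally have *: "(\<integral>\<^sup>+w. G (x + w) * ennreal (1 / norm w) * indicator ?B w \<partial>lborel)
       \<le> (\<integral>\<^sup>+w. G (x + w) * (ennreal (1 / norm w) * indicator (ball 0 r) w) \<partial>lborel) + ennreal (sqrt K)" .
    show "ennreal (pi * M\<^sup>2) * U x \<le> ennreal (M * (sqrt pi * M)) + ennreal (M\<^sup>2 / 2) * 
       ((\<integral>\<^sup>+w. G (x + w) * (ennreal (1 / norm w) * indicator (ball 0 r) w) \<partial>lborel) + ennreal (sqrt K))"
      by (rule order_trans[OF disc_average_bound[OF _ _ M H]])
         (auto intro!: add_mono mult_left_mono avg *)
  qed auto
  also have "\<dots> = (\<integral>\<^sup>+x. (ennreal (M * (sqrt pi * M)) + ennreal (M\<^sup>2 / 2) * ennreal (sqrt K)) * indicator E x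
      + ennreal (M\<^sup>2 / 2) * (\<integral>\<^sup>+w. G (x + w) * (ennreal (1 / norm w) * indicator (ball 0 r) w) * indicator E x \<partial>lborel) \<partial>lborel)"
    by (intro nn_integral_cong) (auto simp: nn_integral_multc distrib_left distrib_right mult_ac add_ac split: split_indicator)
  also have "\<dots> = (ennreal (M * (sqrt pi * M)) + ennreal (M\<^sup>2 / 2) * ennreal (sqrt K)) * ennreal t
      + ennreal (M\<^sup>2 / 2) * (\<integral>\<^sup>+x. \<integral>\<^sup>+w. G (x + w) * (ennreal (1 / norm w) * indicator (ball 0 r) w) * indicator E x \<partial>lborel \<partial>lborel)"
    by (subst nn_integral_add, measurable, subst nn_integral_cmult, measurable, subst nn_integral_cmult_indicator)
       (auto simp: t)
  also have "(\<integral>\<^sup>+x. \<integral>\<^sup>+w. G (x + w) * (ennreal (1 / norm w) * indicator (ball 0 r) w) * indicator E x \<partial>lborel \<partial>lborel)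
     = (\<integral>\<^sup>+w. \<integral>\<^sup>+x. G (x + w) * (ennreal (1 / norm w) * indicator (ball 0 r) w) * indicator E x \<partial>lborel \<partial>lborel)"
    by (rule lborel_pair.Fubini') measurable
  also have "\<dots> = (\<integral>\<^sup>+w. (ennreal (1 / norm w) * indicator (ball 0 r) w) * (\<integral>\<^sup>+x. G (x + w) * indicator E x \<partial>lborel) \<partial>lborel)"
    by (intro nn_integral_cong) (simp add: nn_integral_cmult[symmetric] mult_ac)
  also have "\<dots> \<le> (\<integral>\<^sup>+w. (ennreal (1 / norm w) * indicator (ball (0::real\<times>real) r) w) * ennreal (sqrt t) \<partial>lborel)"
    by (intro nn_integral_mono mult_left_mono near) auto
  also have "\<dots> = (\<integral>\<^sup>+w. (ennreal (1 / norm w) * indicator (ball (0::real\<times>real) r) w) \<partial>lborel) * ennreal (sqrt t)"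
    by (rule nn_integral_multc) measurable
  also have "\<dots> \<le> ennreal (2 * pi * r) * ennreal (sqrt t)"
    by (intro mult_right_mono nn_integral_inverse_norm_ball r) auto
  also have "(ennreal (M * (sqrt pi * M)) + ennreal (M\<^sup>2 / 2) * ennreal (sqrt K)) * ennreal t
      + ennreal (M\<^sup>2 / 2) * (ennreal (2 * pi * r) * ennreal (sqrt t))
     = ennreal ((M * (sqrt pi * M) + M\<^sup>2 / 2 * sqrt K) * t + M\<^sup>2 / 2 * (2 * pi * r * sqrt t))"
  proof -
    have "(ennreal a + ennreal c * ennreal k) * ennreal t + ennreal c * (ennreal d * ennreal e)
       = ennreal ((a + c * k) * t + c * (d * e))" if "0 \<le> a" "0 \<le> c" "0 \<le> k" "0 \<le> d" "0 \<le> e" for a c k d e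
      using that t by (simp add: ennreal_mult ennreal_plus)
    then show ?thesis using M r t K by simp
  qed
  also have "(M * (sqrt pi * M) + M\<^sup>2 / 2 * sqrt K) * t + M\<^sup>2 / 2 * (2 * pi * r * sqrt t)
     = pi * M\<^sup>2 * (t * (2 / sqrt pi + sqrt ((max 0 (ln (pi * M\<^sup>2 / t)) + 1) / (4 * pi))))"
  proof -
    have "r * sqrt t = t / sqrt pi"
      using t by (simp add: r_def real_sqrt_divide)
    moreover have "ln (pi * M\<^sup>2 / t) = 2 * ln (M / r)"
    proof -
      have "pi * M\<^sup>2 / t = (M / r)\<^sup>2" using t by (simp add: r_def power_divide field_simps)
      then show ?thesis using M r by (simp add: ln_realpow)
    qed
    then have "sqrt ((max 0 (ln (pi * M\<^sup>2 / t)) + 1) / (4 * pi)) = sqrt (K / (2 * pi)\<^sup>2)"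
      by (simp add: K_def field_simps power2_eq_square max_def)
    then have "sqrt ((max 0 (ln (pi * M\<^sup>2 / t)) + 1) / (4 * pi)) = sqrt K / (2 * pi)"
      by (simp only: real_sqrt_divide real_sqrt_abs) simp
    moreover have "(M * (sqrt pi * M) + M\<^sup>2 / 2 * k) * t + M\<^sup>2 / 2 * (2 * pi * p)
       = pi * M\<^sup>2 * (t * (2 / sqrt pi + k / (2 * pi)))" if "p = t / sqrt pi" for k p
    proof -
      have *: "x * pi / sqrt pi = x * sqrt pi" for x :: real
        by (simp add: real_div_sqrt flip: times_divide_eq_right)
      have "pi * M\<^sup>2 * (t * (2 / sqrt pi + k / (2 * pi))) = 2 * t * M\<^sup>2 * pi / sqrt pi + M\<^sup>2 * t * k / 2"
        by (simp add: algebra_simps)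
      also have "\<dots> = M\<^sup>2 * t * sqrt pi + M\<^sup>2 * t * pi / sqrt pi + M\<^sup>2 * t * k / 2"
        unfolding * by simp
      also have "\<dots> = (M * (sqrt pi * M) + M\<^sup>2 / 2 * k) * t + M\<^sup>2 / 2 * (2 * pi * p)"
        unfolding that by (simp add: algebra_simps power2_eq_square)
      finally show ?thesis by simp
    qed
    ultimately show ?thesis by (simp add: mult.assoc)
  qed
  finally have "ennreal (pi * M\<^sup>2) * (\<integral>\<^sup>+x. U x * indicator E x \<partial>lborel)
    \<le> ennreal (pi * M\<^sup>2 * (t * (2 / sqrt pi + sqrt ((max 0 (ln (pi * M\<^sup>2 / t)) + 1) / (4 * pi)))))"
    by (simp add: add_left_mono mult_left_mono)
  also have "\<dots> = ennreal (pi * M\<^sup>2) * ennreal (t * (2 / sqrt pi + sqrt ((max 0 (ln (pi * M\<^sup>2 / t)) + 1) / (4 * pi))))"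
    using t by (intro ennreal_mult) (auto intro!: mult_nonneg_nonneg add_nonneg_nonneg)
  finally show ?thesis
    using M by (subst (asm) ennreal_mult_le_mult_iff) auto
qed

section \<open>Mollification in the plane\<close>

definition mollify :: "(real \<times> real \<Rightarrow> real) \<Rightarrow> (real \<times> real \<Rightarrow> real) \<Rightarrow> real \<times> real \<Rightarrow> real" where
  "mollify \<kappa> f x = (\<integral>y. f y * \<kappa> (x - y) \<partial>lborel)"


lemma nn_integral_lborel_reflect:
  fixes f :: "'a::euclidean_space \<Rightarrow> ennreal"
  assumes [measurable]: "f \<in> borel_measurable borel"
  shows "(\<integral>\<^sup>+x. f (c - x) \<partial>lborel) = (\<integral>\<^sup>+x. f x \<partial>lborel)"
proof -
  have "(\<integral>\<^sup>+x. f x \<partial>lborel) = (\<integral>\<^sup>+x. f x \<partial>density (distr lborel borel (\<lambda>x. c + (-1) *\<^sub>R x)) (\<lambda>_. 1))"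
    using lborel_affine[of "-1" c] by simp
  also have "\<dots> = (\<integral>\<^sup>+x. f x \<partial>distr lborel borel (\<lambda>x. c + (-1) *\<^sub>R x))"
    by (simp add: density_1)
  also have "\<dots> = (\<integral>\<^sup>+x. f (c - x) \<partial>lborel)"
    by (subst nn_integral_distr) auto
  finally show ?thesis by simp
qed

text \<open>
  Enclose \<open>K\<close> in an open \<open>U\<close> of nearly the same measure. For small \<open>w\<close> the translate of \<open>K\<close> stays
  inside \<open>U\<close> and has the measure of \<open>K\<close>, so both differences of \<open>K\<close> and its translate are small.
\<close>

lemma indicator_translation_continuous:
  fixes K :: "'a::euclidean_space set"
  assumes K: "compact K" and "\<delta> > 0"
  obtains \<rho> where "\<rho> > 0" "\<And>w. norm w < \<rho> \<Longrightarrow>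
    (\<integral>\<^sup>+y. ennreal \<bar>indicator K (y + w) - indicator K y\<bar> \<partial>lborel) \<le> ennreal \<delta>"
proof -
  have Kb[measurable]: "K \<in> sets borel" using K by (simp add: compact_imp_closed)
  obtain U where U: "open U" "K \<subseteq> U" and UK: "emeasure lebesgue (U - K) < ennreal (\<delta> / 2)"
  proof (rule sets_lebesgue_outer_open)
    show "K \<in> sets lebesgue" using Kb by simp
    show "0 < \<delta> / 2" using \<open>\<delta> > 0\<close> by simp
  qed blast
  have [measurable]: "U \<in> sets borel" using U by simp
  have UK': "emeasure lborel (U - K) \<le> ennreal (\<delta> / 2)"
    using UK by simp
  obtain \<rho> where \<rho>: "\<rho> > 0" "(\<Union>x\<in>K. ball x \<rho>) \<subseteq> U"
    using compact_subset_open_imp_ball_epsilon_subset[OF K U] by blast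
  have finK: "emeasure lborel K < \<infinity>" using emeasure_bounded_finite[OF compact_imp_bounded[OF K]] by simp
  show thesis
  proof (rule that[OF \<rho>(1)])
    fix w :: 'a assume w: "norm w < \<rho>"
    define L where "L = (\<lambda>y. y + w) -` K"
    have [measurable]: "L \<in> sets borel"
      unfolding L_def using measurable_sets[of "\<lambda>y. y + w" borel borel K] by simp
    have LU: "L \<subseteq> U"
    proof
      fix y assume "y \<in> L"
      then have "y + w \<in> K" by (simp add: L_def)
      moreover have "y \<in> ball (y + w) \<rho>" using w by (simp add: dist_norm)
      ultimately show "y \<in> U" using \<rho>(2) by blast
    qed
    have LK: "emeasure lborel L = emeasure lborel K"
    proof -
      have "emeasure lborel L = (\<integral>\<^sup>+y. indicator K (w + y) \<partial>lborel)"
      proof -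
        have "indicator K (w + y) = (indicator L y :: ennreal)" for y
          by (simp add: L_def indicator_def add.commute)
        then show ?thesis by simp
      qed
      also have "\<dots> = emeasure lborel K"
        by (subst nn_integral_lborel_shift) auto
      finally show ?thesis .
    qed
    have Lfin: "emeasure lborel L \<noteq> \<infinity>" "emeasure lborel K \<noteq> \<infinity>" using LK finK by auto
    have "(\<integral>\<^sup>+y. ennreal \<bar>indicator K (y + w) - indicator K y\<bar> \<partial>lborel)
       \<le> (\<integral>\<^sup>+y. indicator (U - L) y + indicator (U - K) y \<partial>lborel)"
    proof (rule nn_integral_mono)
      fix y
      have "indicator K (y + w) = (indicator L y :: real)" by (simp add: L_def indicator_def)
      then show "ennreal \<bar>indicator K (y + w) - indicator K y\<bar> \<le> indicator (U - L) y + indicator (U - K) y"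
        using LU U(2) by (auto split: split_indicator)
    qed
    also have "\<dots> = emeasure lborel (U - L) + emeasure lborel (U - K)"
      by (subst nn_integral_add) auto
    also have "emeasure lborel (U - L) = emeasure lborel U - emeasure lborel L"
      by (rule emeasure_Diff) (use Lfin LU in simp_all)
    also have "\<dots> = emeasure lborel (U - K)"
      unfolding LK by (rule emeasure_Diff[symmetric]) (use Lfin U in simp_all)
    also have "emeasure lborel (U - K) + emeasure lborel (U - K) \<le> ennreal (\<delta> / 2) + ennreal (\<delta> / 2)"
      by (intro add_mono UK')
    also have "\<dots> = ennreal \<delta>"
      using \<open>\<delta> > 0\<close> by (subst ennreal_plus[symmetric]) auto
    finally show "(\<integral>\<^sup>+y. ennreal \<bar>indicator K (y + w) - indicator K y\<bar> \<partial>lborel) \<le> ennreal \<delta>" .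
  qed
qed

lemma continuous_compact_support_bounded:
  fixes \<phi> :: "'a::euclidean_space \<Rightarrow> real"
  assumes "continuous_on UNIV \<phi>" and "\<And>z. \<rho> \<le> norm z \<Longrightarrow> \<phi> z = 0"
  obtains B where "0 \<le> B" "\<And>z. \<bar>\<phi> z\<bar> \<le> B"
proof -
  have "compact (\<phi> ` cball 0 \<rho>)"
    using assms(1) by (intro compact_continuous_image) (auto intro: continuous_on_subset)
  then have "bounded (\<phi> ` cball 0 \<rho>)" by (rule compact_imp_bounded)
  then obtain B where B: "\<bar>y\<bar> \<le> B" if "y \<in> \<phi> ` cball 0 \<rho>" for y
    unfolding bounded_real by metis
  show thesis
  proof (rule that[of "max B 0"])
    fix z show "\<bar>\<phi> z\<bar> \<le> max B 0"
      using B[of "\<phi> z"] assms(2)[of z] by (cases "norm z \<le> \<rho>") auto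
  qed simp
qed

text \<open>
  Square integrable functions are locally integrable, by \<open>\<bar>f\<bar> \<le> f\<^sup>2 + 1\<close>.
\<close>

lemma integrable_square_times_compact_support:
  fixes f \<phi> :: "'a::euclidean_space \<Rightarrow> real"
  assumes [measurable]: "f \<in> borel_measurable borel" "\<phi> \<in> borel_measurable borel"
    and f2: "integrable lborel (\<lambda>x. (f x)\<^sup>2)"
    and B: "\<And>y. \<bar>\<phi> y\<bar> \<le> B" and \<rho>: "\<And>y. \<rho> \<le> norm y \<Longrightarrow> \<phi> y = 0"
  shows "integrable lborel (\<lambda>y. f y * \<phi> y)"
proof (rule Bochner_Integration.integrable_bound)
  show "integrable lborel (\<lambda>y. B * ((f y)\<^sup>2 + indicator (cball 0 \<rho>) y))"
    by (intro integrable_mult_right Bochner_Integration.integrable_add f2 integrable_real_indicator)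
       (auto simp: emeasure_bounded_finite[unfolded infinity_ennreal_def])
  have B0: "0 \<le> B" using B[of 0] by simp
  have "norm (f y * \<phi> y) \<le> norm (B * ((f y)\<^sup>2 + indicator (cball 0 \<rho>) y))" for y
  proof (cases "norm y \<le> \<rho>")
    case True
    have "\<bar>f y\<bar> \<le> (f y)\<^sup>2 + 1"
    proof -
      have "0 \<le> (\<bar>f y\<bar> - 1)\<^sup>2" by simp
      then have "2 * \<bar>f y\<bar> \<le> \<bar>f y\<bar>\<^sup>2 + 1" by (simp add: power2_diff)
      then show ?thesis by simp
    qed
    then have "\<bar>f y\<bar> * \<bar>\<phi> y\<bar> \<le> ((f y)\<^sup>2 + 1) * B"
      using B by (intro mult_mono) auto
    then show ?thesis using True B0 by (simp add: abs_mult mult_ac)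
  next
    case False
    then show ?thesis using \<rho>[of y] B0 by simp
  qed
  then show "AE y in lborel. norm (f y * \<phi> y) \<le> norm (B * ((f y)\<^sup>2 + indicator (cball 0 \<rho>) y))"
    by simp
qed measurable

lemma integrable_mollify:
  fixes f \<kappa> :: "real \<times> real \<Rightarrow> real"
  assumes [measurable]: "f \<in> borel_measurable borel" 
    and f2: "integrable lborel (\<lambda>x. (f x)\<^sup>2)"
    and \<kappa>: "continuous_on UNIV \<kappa>" "\<And>z. \<rho> \<le> norm z \<Longrightarrow> \<kappa> z = 0"
  shows "integrable lborel (\<lambda>y. f y * \<kappa> (x - y))"
proof -
  have [measurable]: "\<kappa> \<in> borel_measurable borel" by (rule borel_measurable_continuous_onI[OF \<kappa>(1)])
  obtain B where B: "\<And>z. \<bar>\<kappa> z\<bar> \<le> B" using continuous_compact_support_bounded[OF \<kappa>] by metis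
  show ?thesis
  proof (rule integrable_square_times_compact_support[OF _ _ f2 B])
    fix y :: "real \<times> real" assume "\<rho> + norm x \<le> norm y"
    then have "\<rho> \<le> norm (x - y)" using norm_triangle_ineq2[of y x] by (simp add: norm_minus_commute)
    then show "\<kappa> (x - y) = 0" by (rule \<kappa>(2))
  qed measurable
qed

lemma borel_measurable_mollify[measurable]:
  fixes f \<kappa> :: "real \<times> real \<Rightarrow> real"
  assumes [measurable]: "f \<in> borel_measurable borel" and \<kappa>: "continuous_on UNIV \<kappa>"
  shows "mollify \<kappa> f \<in> borel_measurable borel"
proof -
  have [measurable]: "\<kappa> \<in> borel_measurable borel" by (rule borel_measurable_continuous_onI[OF \<kappa>])
  have "(\<lambda>x. \<integral>y. f y * \<kappa> (x - y) \<partial>lborel) \<in> borel_measurable lborel"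
    by (rule lborel.borel_measurable_lebesgue_integral) measurable
  then show ?thesis by (simp add: mollify_def[abs_def])
qed

text \<open>
  Jensen's inequality for the probability density \<open>\<kappa> (x - y)\<close>, in the guise of Cauchy-Schwarz.
\<close>

lemma mollify_square_le:
  fixes f \<kappa> :: "real \<times> real \<Rightarrow> real"
  assumes [measurable]: "f \<in> borel_measurable borel" 
    and \<kappa>: "continuous_on UNIV \<kappa>" "\<And>z. 0 \<le> \<kappa> z" and \<kappa>1: "(\<integral>\<^sup>+z. ennreal (\<kappa> z) \<partial>lborel) = 1"
  shows "ennreal ((mollify \<kappa> f x)\<^sup>2) \<le> (\<integral>\<^sup>+y. ennreal ((f y)\<^sup>2) * ennreal (\<kappa> (x - y)) \<partial>lborel)"
proof -
  have [measurable]: "\<kappa> \<in> borel_measurable borel" by (rule borel_measurable_continuous_onI[OF \<kappa>(1)])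
  have "ennreal \<bar>mollify \<kappa> f x\<bar> \<le> (\<integral>\<^sup>+y. ennreal \<bar>f y * \<kappa> (x - y)\<bar> \<partial>lborel)"
  proof (cases "integrable lborel (\<lambda>y. f y * \<kappa> (x - y))")
    case True
    then show ?thesis using integral_norm_bound_ennreal[OF True] by (simp add: mollify_def)
  next
    case False
    then show ?thesis by (simp add: mollify_def not_integrable_integral_eq)
  qed
  also have "\<dots> = (\<integral>\<^sup>+y. ennreal (\<bar>f y\<bar> * sqrt (\<kappa> (x - y))) * ennreal (sqrt (\<kappa> (x - y))) \<partial>lborel)"
    using \<kappa>(2) by (intro nn_integral_cong) (simp add: ennreal_mult[symmetric] abs_mult mult.assoc)
  finally have "(ennreal \<bar>mollify \<kappa> f x\<bar>)\<^sup>2 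
    \<le> (\<integral>\<^sup>+y. ennreal (\<bar>f y\<bar> * sqrt (\<kappa> (x - y))) * ennreal (sqrt (\<kappa> (x - y))) \<partial>lborel)\<^sup>2"
    by (rule power_mono) simp
  also have "\<dots> \<le> (\<integral>\<^sup>+y. (ennreal (\<bar>f y\<bar> * sqrt (\<kappa> (x - y))))\<^sup>2 \<partial>lborel) * (\<integral>\<^sup>+y. (ennreal (sqrt (\<kappa> (x - y))))\<^sup>2 \<partial>lborel)"
    by (rule Cauchy_Schwarz_nn_integral) measurable
  also have "(\<integral>\<^sup>+y. (ennreal (sqrt (\<kappa> (x - y))))\<^sup>2 \<partial>lborel) = (\<integral>\<^sup>+y. ennreal (\<kappa> (x - y)) \<partial>lborel)"
    using \<kappa>(2) by (intro nn_integral_cong) (simp add: ennreal_power)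
  also have "\<dots> = 1"
    using nn_integral_lborel_reflect[of "\<lambda>z. ennreal (\<kappa> z)" x] \<kappa>1 by simp
  also have "(\<integral>\<^sup>+y. (ennreal (\<bar>f y\<bar> * sqrt (\<kappa> (x - y))))\<^sup>2 \<partial>lborel)
     = (\<integral>\<^sup>+y. ennreal ((f y)\<^sup>2) * ennreal (\<kappa> (x - y)) \<partial>lborel)"
    using \<kappa>(2) by (intro nn_integral_cong) (simp add: ennreal_power ennreal_mult[symmetric] power_mult_distrib)
  finally show ?thesis by (simp add: ennreal_power)
qed

lemma nn_integral_convolution:
  fixes \<kappa> g :: "real \<times> real \<Rightarrow> ennreal"
  assumes [measurable]: "g \<in> borel_measurable borel" "\<kappa> \<in> borel_measurable borel"
    and \<kappa>1: "(\<integral>\<^sup>+z. \<kappa> z \<partial>lborel) = 1"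
  shows "(\<integral>\<^sup>+x. \<integral>\<^sup>+y. g y * \<kappa> (x - y) \<partial>lborel \<partial>lborel) = (\<integral>\<^sup>+y. g y \<partial>lborel)"
proof -
  have "(\<integral>\<^sup>+x. \<integral>\<^sup>+y. g y * \<kappa> (x - y) \<partial>lborel \<partial>lborel) = (\<integral>\<^sup>+y. \<integral>\<^sup>+x. g y * \<kappa> (x - y) \<partial>lborel \<partial>lborel)"
    by (rule lborel_pair.Fubini') measurable
  also have "\<dots> = (\<integral>\<^sup>+y. g y \<partial>lborel)"
  proof (rule nn_integral_cong)
    fix y
    have "(\<integral>\<^sup>+x. g y * \<kappa> (x - y) \<partial>lborel) = g y * (\<integral>\<^sup>+x. \<kappa> (x - y) \<partial>lborel)"
      by (rule nn_integral_cmult) measurable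
    also have "(\<integral>\<^sup>+x. \<kappa> (x - y) \<partial>lborel) = 1"
      using nn_integral_lborel_shift[of \<kappa> "- y"] \<kappa>1 by simp
    finally show "(\<integral>\<^sup>+x. g y * \<kappa> (x - y) \<partial>lborel) = g y" by simp
  qed
  finally show ?thesis .
qed

lemma nn_integral_mollify_square_le:
  fixes f \<kappa> :: "real \<times> real \<Rightarrow> real"
  assumes [measurable]: "f \<in> borel_measurable borel" 
    and \<kappa>: "continuous_on UNIV \<kappa>" "\<And>z. 0 \<le> \<kappa> z" and \<kappa>1: "(\<integral>\<^sup>+z. ennreal (\<kappa> z) \<partial>lborel) = 1"
  shows "(\<integral>\<^sup>+x. ennreal ((mollify \<kappa> f x)\<^sup>2) \<partial>lborel) \<le> (\<integral>\<^sup>+x. ennreal ((f x)\<^sup>2) \<partial>lborel)"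
proof -
  have [measurable]: "\<kappa> \<in> borel_measurable borel" by (rule borel_measurable_continuous_onI[OF \<kappa>(1)])
  have "(\<integral>\<^sup>+x. ennreal ((mollify \<kappa> f x)\<^sup>2) \<partial>lborel)
     \<le> (\<integral>\<^sup>+x. \<integral>\<^sup>+y. ennreal ((f y)\<^sup>2) * ennreal (\<kappa> (x - y)) \<partial>lborel \<partial>lborel)"
    by (intro nn_integral_mono mollify_square_le assms)
  also have "\<dots> = (\<integral>\<^sup>+x. ennreal ((f x)\<^sup>2) \<partial>lborel)"
    by (rule nn_integral_convolution) (use \<kappa>1 in auto)
  finally show ?thesis .
qed

text \<open>
  The mollified function satisfies the hypothesis of \<open>disc_average_bound\<close>. The fundamental theorem of
  calculus is applied to the kernel along the segment, not to the mollified function, so that no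
  differentiation under the integral sign occurs: Fubini moves the \<open>\<tau>\<close>-integral outside, and
  \<open>weak\<close> turns \<open>v\<close> against a derivative of the kernel into the gradient against the kernel.
\<close>

lemma mollify_increment_le:
  fixes v h1 h2 \<kappa> \<kappa>1 \<kappa>2 :: "real \<times> real \<Rightarrow> real"
  assumes [measurable]: "v \<in> borel_measurable borel" "h1 \<in> borel_measurable borel" "h2 \<in> borel_measurable borel"
    and v2: "integrable lborel (\<lambda>x. (v x)\<^sup>2)"
    and \<kappa>: "continuous_on UNIV \<kappa>" "\<And>p. \<rho> \<le> norm p \<Longrightarrow> \<kappa> p = 0"
    and \<kappa>1: "continuous_on UNIV \<kappa>1" "\<And>p. \<rho> \<le> norm p \<Longrightarrow> \<kappa>1 p = 0"
    and \<kappa>2: "continuous_on UNIV \<kappa>2" "\<And>p. \<rho> \<le> norm p \<Longrightarrow> \<kappa>2 p = 0"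
    and deriv: "\<And>p z \<tau>. ((\<lambda>\<tau>. \<kappa> (p + \<tau> *\<^sub>R z)) has_real_derivative
        fst z * \<kappa>1 (p + \<tau> *\<^sub>R z) + snd z * \<kappa>2 (p + \<tau> *\<^sub>R z)) (at \<tau>)"
    and weak: "\<And>x. mollify \<kappa>1 v x = mollify \<kappa> h1 x" "\<And>x. mollify \<kappa>2 v x = mollify \<kappa> h2 x"
  shows "ennreal \<bar>mollify \<kappa> v x\<bar> \<le> ennreal \<bar>mollify \<kappa> v (x + z)\<bar> + ennreal (norm z) *
    (\<integral>\<^sup>+\<tau>. ennreal (norm (mollify \<kappa> h1 (x + \<tau> *\<^sub>R z), mollify \<kappa> h2 (x + \<tau> *\<^sub>R z))) * indicator {0..1} \<tau> \<partial>lborel)"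
proof -
  have [measurable]: "\<kappa> \<in> borel_measurable borel" "\<kappa>1 \<in> borel_measurable borel" "\<kappa>2 \<in> borel_measurable borel"
    using \<kappa> \<kappa>1 \<kappa>2 by (auto intro: borel_measurable_continuous_onI)
  define D where "D = (\<lambda>p. fst z * \<kappa>1 p + snd z * \<kappa>2 p)"
  have Dcont: "continuous_on UNIV D" unfolding D_def by (intro continuous_intros \<kappa>1 \<kappa>2)
  have Dsupp: "D p = 0" if "\<rho> \<le> norm p" for p using \<kappa>1(2)[OF that] \<kappa>2(2)[OF that] by (simp add: D_def)
  have [measurable]: "D \<in> borel_measurable borel" by (rule borel_measurable_continuous_onI[OF Dcont])
  obtain B where B: "0 \<le> B" "\<And>p. \<bar>D p\<bar> \<le> B"
    using continuous_compact_support_bounded[OF Dcont Dsupp] by blast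
  let ?H = "\<lambda>\<tau>. fst z * mollify \<kappa> h1 (x + \<tau> *\<^sub>R z) + snd z * mollify \<kappa> h2 (x + \<tau> *\<^sub>R z)"
  have FTC: "\<kappa> (x + z - y) - \<kappa> (x - y) = (\<integral>\<tau>. D (x + \<tau> *\<^sub>R z - y) * indicator {0..1} \<tau> \<partial>lborel)" for y
  proof -
    have "(\<integral>\<tau>. D (x - y + \<tau> *\<^sub>R z) * indicator {0..1} \<tau> \<partial>lborel) = \<kappa> (x - y + 1 *\<^sub>R z) - \<kappa> (x - y + 0 *\<^sub>R z)"
    proof (rule integral_FTC_Icc_real)
      show "((\<lambda>\<tau>. \<kappa> (x - y + \<tau> *\<^sub>R z)) has_real_derivative D (x - y + \<tau> *\<^sub>R z)) (at \<tau>)" for \<tau>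
        unfolding D_def by (rule deriv)
      show "isCont (\<lambda>\<tau>. D (x - y + \<tau> *\<^sub>R z)) \<tau>" for \<tau>
      proof -
        have "continuous_on UNIV (\<lambda>\<tau>. D (x - y + \<tau> *\<^sub>R z))"
          by (rule continuous_on_compose2[OF Dcont]) (auto intro!: continuous_intros)
        then show ?thesis by (simp add: continuous_on_eq_continuous_at)
      qed
    qed simp
    then show ?thesis by (simp add: algebra_simps)
  qed
  define F where "F = (\<lambda>y \<tau>. v y * (D (x + \<tau> *\<^sub>R z - y) * indicator {0..1} \<tau>))"
  have Fint: "integrable (lborel \<Otimes>\<^sub>M lborel) (case_prod F)"
  proof (rule integrableI_bounded)
    show "case_prod F \<in> borel_measurable (lborel \<Otimes>\<^sub>M lborel)"
      unfolding F_def by measurable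
    define Q where "Q = cball (0::real\<times>real) (norm x + norm z + \<rho>)"
    have [measurable]: "Q \<in> sets borel" by (simp add: Q_def)
    have vQ: "integrable lborel (\<lambda>y. v y * (B * indicator Q y))"
    proof (rule integrable_square_times_compact_support[OF _ _ v2])
      show "\<bar>B * indicator Q y\<bar> \<le> B" for y using B(1) by (simp add: indicator_def)
      show "B * indicator Q y = 0" if "norm x + norm z + \<rho> + 1 \<le> norm y" for y
        using that by (simp add: Q_def)
    qed measurable
    have "(\<integral>\<^sup>+p. ennreal (norm (case_prod F p)) \<partial>(lborel \<Otimes>\<^sub>M lborel))
       \<le> (\<integral>\<^sup>+p. ennreal (norm (v (fst p) * (B * indicator Q (fst p)))) * indicator {0..1::real} (snd p) \<partial>(lborel \<Otimes>\<^sub>M lborel))"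
    proof (rule nn_integral_mono)
      fix p :: "(real \<times> real) \<times> real"
      obtain y \<tau> where p: "p = (y, \<tau>)" by (rule prod.exhaust)
      have "\<bar>F y \<tau>\<bar> \<le> \<bar>v y * (B * indicator Q y)\<bar> * indicator {0..1} \<tau>"
      proof (cases "\<tau> \<in> {0..1} \<and> norm (x + \<tau> *\<^sub>R z - y) < \<rho>")
        case True
        have "norm y \<le> norm (x + \<tau> *\<^sub>R z) + norm (x + \<tau> *\<^sub>R z - y)"
          by (metis norm_minus_commute norm_triangle_sub)
        also have "norm (x + \<tau> *\<^sub>R z) \<le> norm x + norm z"
        proof -
          have "norm (\<tau> *\<^sub>R z) \<le> 1 * norm z" using mult_right_mono[of \<tau> 1 "norm z"] True by simp
          then show ?thesis using norm_triangle_ineq[of x "\<tau> *\<^sub>R z"] by linarith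
        qed
        finally have "y \<in> Q" using True by (simp add: Q_def)
        then show ?thesis using True B by (simp add: F_def abs_mult mult_left_mono)
      next
        case False
        then have "F y \<tau> = 0" using Dsupp[of "x + \<tau> *\<^sub>R z - y"] by (auto simp: F_def)
        then show ?thesis by simp
      qed
      then have "ennreal \<bar>F y \<tau>\<bar> \<le> ennreal (\<bar>v y * (B * indicator Q y)\<bar> * indicator {0..1} \<tau>)"
        by (rule ennreal_leI)
      then show "ennreal (norm (case_prod F p)) \<le> ennreal (norm (v (fst p) * (B * indicator Q (fst p)))) * indicator {0..1::real} (snd p)"
        by (simp add: p ennreal_mult' ennreal_indicator)
    qed
    also have "\<dots> = (\<integral>\<^sup>+y. \<integral>\<^sup>+\<tau>. ennreal (norm (v y * (B * indicator Q y))) * indicator {0..1::real} \<tau> \<partial>lborel \<partial>(lborel::(real\<times>real) measure))"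
    proof -
      have "(\<lambda>p. ennreal (norm (v (fst p) * (B * indicator Q (fst p)))) * indicator {0..1::real} (snd p))
          \<in> borel_measurable (lborel \<Otimes>\<^sub>M lborel)"
        by measurable
      from lborel.nn_integral_fst[OF this] show ?thesis by simp
    qed
    also have "\<dots> = (\<integral>\<^sup>+y. ennreal (norm (v y * (B * indicator Q y))) \<partial>lborel)"
      by (intro nn_integral_cong) (subst nn_integral_cmult_indicator, auto)
    also have "\<dots> < \<infinity>" using vQ by (simp add: integrable_iff_bounded)
    finally show "(\<integral>\<^sup>+p. ennreal (norm (case_prod F p)) \<partial>(lborel \<Otimes>\<^sub>M lborel)) < \<infinity>" .
  qed
  have "mollify \<kappa> v (x + z) - mollify \<kappa> v x = (\<integral>y. v y * \<kappa> (x + z - y) - v y * \<kappa> (x - y) \<partial>lborel)"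
    unfolding mollify_def
    by (intro Bochner_Integration.integral_diff[symmetric] integrable_mollify[OF _ v2 \<kappa>]) auto
  also have "\<dots> = (\<integral>y. (\<integral>\<tau>. F y \<tau> \<partial>lborel) \<partial>lborel)"
  proof (rule Bochner_Integration.integral_cong[OF refl])
    fix y
    have "(\<integral>\<tau>. F y \<tau> \<partial>lborel) = v y * (\<integral>\<tau>. D (x + \<tau> *\<^sub>R z - y) * indicator {0..1} \<tau> \<partial>lborel)"
      unfolding F_def by (rule integral_mult_right_zero)
    then show "v y * \<kappa> (x + z - y) - v y * \<kappa> (x - y) = (\<integral>\<tau>. F y \<tau> \<partial>lborel)"
      by (simp add: FTC[symmetric] right_diff_distrib)
  qed
  also have "\<dots> = (\<integral>\<tau>. (\<integral>y. F y \<tau> \<partial>lborel) \<partial>lborel)"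
    by (rule lborel_pair.Fubini_integral[OF Fint, symmetric])
  also have "\<dots> = (\<integral>\<tau>. ?H \<tau> * indicator {0..1} \<tau> \<partial>lborel)"
  proof (rule Bochner_Integration.integral_cong[OF refl])
    fix \<tau> :: real
    have "(\<integral>y. F y \<tau> \<partial>lborel) = (\<integral>y. indicator {0..1} \<tau> * (fst z * (v y * \<kappa>1 (x + \<tau> *\<^sub>R z - y)) + snd z * (v y * \<kappa>2 (x + \<tau> *\<^sub>R z - y))) \<partial>lborel)"
      by (intro Bochner_Integration.integral_cong) (auto simp: F_def D_def algebra_simps)
    also have "\<dots> = indicator {0..1} \<tau> * (fst z * mollify \<kappa>1 v (x + \<tau> *\<^sub>R z) + snd z * mollify \<kappa>2 v (x + \<tau> *\<^sub>R z))"
      unfolding mollify_def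
      by (simp add: Bochner_Integration.integral_add integrable_mollify[OF _ v2 \<kappa>1] integrable_mollify[OF _ v2 \<kappa>2])
    finally show "(\<integral>y. F y \<tau> \<partial>lborel) = ?H \<tau> * indicator {0..1} \<tau>"
      by (simp add: weak)
  qed
  finally have diff: "mollify \<kappa> v (x + z) - mollify \<kappa> v x = (\<integral>\<tau>. ?H \<tau> * indicator {0..1} \<tau> \<partial>lborel)" .
  have "ennreal \<bar>\<integral>\<tau>. ?H \<tau> * indicator {0..1} \<tau> \<partial>lborel\<bar> \<le> (\<integral>\<^sup>+\<tau>. ennreal \<bar>?H \<tau> * indicator {0..1} \<tau>\<bar> \<partial>lborel)"
  proof (cases "integrable lborel (\<lambda>\<tau>. ?H \<tau> * indicator {0..1} \<tau>)")
    case True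
    then show ?thesis using integral_norm_bound_ennreal[OF True] by simp
  next
    case False
    then show ?thesis by (simp add: not_integrable_integral_eq)
  qed
  also have "\<dots> \<le> (\<integral>\<^sup>+\<tau>. ennreal (norm z) * (ennreal (norm (mollify \<kappa> h1 (x + \<tau> *\<^sub>R z), mollify \<kappa> h2 (x + \<tau> *\<^sub>R z))) * indicator {0..1} \<tau>) \<partial>lborel)"
  proof (rule nn_integral_mono)
    fix \<tau> :: real
    have "\<bar>?H \<tau>\<bar> \<le> norm z * norm (mollify \<kappa> h1 (x + \<tau> *\<^sub>R z), mollify \<kappa> h2 (x + \<tau> *\<^sub>R z))"
      using Cauchy_Schwarz_ineq2[of z "(mollify \<kappa> h1 (x + \<tau> *\<^sub>R z), mollify \<kappa> h2 (x + \<tau> *\<^sub>R z))"]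
      by (simp add: inner_prod_def)
    then show "ennreal \<bar>?H \<tau> * indicator {0..1} \<tau>\<bar> \<le> ennreal (norm z) * (ennreal (norm (mollify \<kappa> h1 (x + \<tau> *\<^sub>R z), mollify \<kappa> h2 (x + \<tau> *\<^sub>R z))) * indicator {0..1} \<tau>)"
      by (auto simp: ennreal_mult'[symmetric] indicator_def intro!: ennreal_leI)
  qed
  also have "\<dots> = ennreal (norm z) * (\<integral>\<^sup>+\<tau>. ennreal (norm (mollify \<kappa> h1 (x + \<tau> *\<^sub>R z), mollify \<kappa> h2 (x + \<tau> *\<^sub>R z))) * indicator {0..1} \<tau> \<partial>lborel)"
    using \<kappa>(1) by (intro nn_integral_cmult) measurable
  finally have *: "ennreal \<bar>mollify \<kappa> v (x + z) - mollify \<kappa> v x\<bar> \<le> \<dots>" unfolding diff .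
  have "ennreal \<bar>mollify \<kappa> v x\<bar> \<le> ennreal (\<bar>mollify \<kappa> v (x + z)\<bar> + \<bar>mollify \<kappa> v (x + z) - mollify \<kappa> v x\<bar>)"
    by (intro ennreal_leI) linarith
  also have "\<dots> = ennreal \<bar>mollify \<kappa> v (x + z)\<bar> + ennreal \<bar>mollify \<kappa> v (x + z) - mollify \<kappa> v x\<bar>"
    by (rule ennreal_plus) auto
  finally show ?thesis using * by (meson add_left_mono order_trans)
qed

text \<open>
  The difference \<open>d\<close> of the smoothed indicator and the indicator lies between \<open>-1\<close> and \<open>1\<close>, hence
  \<open>d\<^sup>2 \<le> \<bar>d\<bar>\<close>, and \<open>\<bar>d y\<bar>\<close> is at most the \<open>\<kappa>\<close>-average of \<open>\<bar>1\<^sub>K (y + w) - 1\<^sub>K y\<bar>\<close>.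
\<close>

lemma smoothed_indicator_close:
  fixes \<kappa> :: "real \<times> real \<Rightarrow> real"
  assumes [measurable]: "K \<in> sets borel"
    and \<kappa>: "continuous_on UNIV \<kappa>" "\<And>z. 0 \<le> \<kappa> z" "\<And>z. \<rho> \<le> norm z \<Longrightarrow> \<kappa> z = 0"
    and \<kappa>1: "(\<integral>\<^sup>+z. ennreal (\<kappa> z) \<partial>lborel) = 1"
    and \<rho>: "\<And>w. norm w < \<rho> \<Longrightarrow>
      (\<integral>\<^sup>+y. ennreal \<bar>indicator K (y + w) - indicator K y\<bar> \<partial>lborel) \<le> ennreal \<delta>"
  defines "d \<equiv> \<lambda>y. (\<integral>x. indicator K x * \<kappa> (x - y) \<partial>lborel) - indicator K y"
  shows "(\<integral>\<^sup>+y. ennreal ((d y)\<^sup>2) \<partial>lborel) \<le> ennreal \<delta>"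
proof -
  have [measurable]: "\<kappa> \<in> borel_measurable borel" by (rule borel_measurable_continuous_onI[OF \<kappa>(1)])
  have \<kappa>sh: "(\<integral>\<^sup>+x. ennreal (\<kappa> (x - y)) \<partial>lborel) = 1" for y
    using nn_integral_lborel_shift[of "\<lambda>z. ennreal (\<kappa> z)" "- y"] \<kappa>1 by simp
  have hk: "has_bochner_integral lborel (\<lambda>x. \<kappa> (x - y)) 1" for y
    using \<kappa>(2) by (intro has_bochner_integral_nn_integral) (auto simp: \<kappa>sh)
  have ik: "integrable lborel (\<lambda>x. indicator K x * \<kappa> (x - y))" for y
    using integrable_mult_indicator[of K lborel "\<lambda>x. \<kappa> (x - y)"] hk[of y]
    by (simp add: has_bochner_integral_iff)
  define q where "q = (\<lambda>y. \<integral>\<^sup>+w. ennreal \<bar>indicator K (y + w) - indicator K y\<bar> * ennreal (\<kappa> w) \<partial>lborel)"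
  have d_eq: "d y = (\<integral>x. (indicator K x - indicator K y) * \<kappa> (x - y) \<partial>lborel)" for y
  proof -
    have "(\<integral>x. (indicator K x - indicator K y) * \<kappa> (x - y) \<partial>lborel)
       = (\<integral>x. indicator K x * \<kappa> (x - y) \<partial>lborel) - (\<integral>x. indicator K y * \<kappa> (x - y) \<partial>lborel)"
      using ik[of y] hk[of y] by (simp add: left_diff_distrib has_bochner_integral_iff)
    then show ?thesis using hk[of y] by (simp add: d_def has_bochner_integral_iff)
  qed
  have dq: "ennreal \<bar>d y\<bar> \<le> q y" for y
  proof -
    have "integrable lborel (\<lambda>x. (indicator K x - indicator K y) * \<kappa> (x - y))"
      using ik[of y] hk[of y] by (simp add: left_diff_distrib has_bochner_integral_iff)
    from integral_norm_bound_ennreal[OF this]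
    have "ennreal \<bar>d y\<bar> \<le> (\<integral>\<^sup>+x. ennreal \<bar>(indicator K x - indicator K y) * \<kappa> (x - y)\<bar> \<partial>lborel)"
      by (simp add: d_eq)
    also have "\<dots> = (\<integral>\<^sup>+w. ennreal \<bar>(indicator K (y + w) - indicator K y) * \<kappa> (y + w - y)\<bar> \<partial>lborel)"
      by (rule nn_integral_lborel_shift[symmetric]) measurable
    also have "\<dots> = q y"
      unfolding q_def using \<kappa>(2) by (intro nn_integral_cong) (simp add: abs_mult ennreal_mult)
    finally show ?thesis .
  qed
  have q1: "q y \<le> 1" for y
  proof -
    have "q y \<le> (\<integral>\<^sup>+w. ennreal (\<kappa> w) \<partial>lborel)"
      unfolding q_def by (intro nn_integral_mono) (auto simp: indicator_def)
    then show ?thesis by (simp add: \<kappa>1)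
  qed
  have "(\<integral>\<^sup>+y. ennreal ((d y)\<^sup>2) \<partial>lborel) \<le> (\<integral>\<^sup>+y. q y \<partial>lborel)"
  proof (rule nn_integral_mono)
    fix y
    have "ennreal \<bar>d y\<bar> \<le> 1" using dq[of y] q1[of y] by (rule order_trans)
    then have "\<bar>d y\<bar> \<le> 1" by simp
    then have "\<bar>d y\<bar> * \<bar>d y\<bar> \<le> \<bar>d y\<bar> * 1" by (intro mult_left_mono) auto
    then have "(d y)\<^sup>2 \<le> \<bar>d y\<bar>" by (simp add: power2_eq_square)
    then show "ennreal ((d y)\<^sup>2) \<le> q y" using dq[of y] by (meson ennreal_leI order_trans)
  qed
  also have "\<dots> = (\<integral>\<^sup>+w. \<integral>\<^sup>+y. ennreal \<bar>indicator K (y + w) - indicator K y\<bar> * ennreal (\<kappa> w) \<partial>lborel \<partial>lborel)"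
    unfolding q_def by (rule lborel_pair.Fubini') measurable
  also have "\<dots> \<le> (\<integral>\<^sup>+w. ennreal \<delta> * ennreal (\<kappa> w) \<partial>lborel)"
  proof (rule nn_integral_mono)
    fix w :: "real \<times> real"
    have "(\<integral>\<^sup>+y. ennreal \<bar>indicator K (y + w) - indicator K y\<bar> * ennreal (\<kappa> w) \<partial>lborel)
       = (\<integral>\<^sup>+y. ennreal \<bar>indicator K (y + w) - indicator K y\<bar> \<partial>lborel) * ennreal (\<kappa> w)"
      by (rule nn_integral_multc) measurable
    also have "\<dots> \<le> ennreal \<delta> * ennreal (\<kappa> w)"
    proof (cases "norm w < \<rho>")
      case True
      then show ?thesis by (intro mult_right_mono \<rho>) auto
    next
      case False
      then show ?thesis using \<kappa>(3)[of w] by simp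
    qed
    finally show "(\<integral>\<^sup>+y. ennreal \<bar>indicator K (y + w) - indicator K y\<bar> * ennreal (\<kappa> w) \<partial>lborel) \<le> ennreal \<delta> * ennreal (\<kappa> w)" .
  qed
  also have "\<dots> = ennreal \<delta>"
    by (simp add: nn_integral_cmult \<kappa>1)
  finally show ?thesis .
qed

lemma integral_mollify_swap:
  fixes v \<kappa> :: "real \<times> real \<Rightarrow> real"
  assumes [measurable]: "v \<in> borel_measurable borel"
    and v2: "integrable lborel (\<lambda>x. (v x)\<^sup>2)" and K: "compact K"
    and \<kappa>: "continuous_on UNIV \<kappa>" "\<And>z. \<rho> \<le> norm z \<Longrightarrow> \<kappa> z = 0"
  shows "(\<integral>x. indicator K x * mollify \<kappa> v x \<partial>lborel)
    = (\<integral>y. v y * (\<integral>x. indicator K x * \<kappa> (x - y) \<partial>lborel) \<partial>lborel)"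
    and "integrable lborel (\<lambda>y. v y * (\<integral>x. indicator K x * \<kappa> (x - y) \<partial>lborel))"
    and "integrable lborel (\<lambda>x. indicator K x * mollify \<kappa> v x)"
proof -
  have [measurable]: "K \<in> sets borel" using K by (simp add: compact_imp_closed)
  have [measurable]: "\<kappa> \<in> borel_measurable borel" by (rule borel_measurable_continuous_onI[OF \<kappa>(1)])
  obtain B where B: "0 \<le> B" "\<And>p. \<bar>\<kappa> p\<bar> \<le> B"
    using continuous_compact_support_bounded[OF \<kappa>] by blast
  obtain N where N: "\<And>x. x \<in> K \<Longrightarrow> norm x \<le> N"
    using compact_imp_bounded[OF K] unfolding bounded_iff by metis
  define F where "F = (\<lambda>x y. indicator K x * (v y * \<kappa> (x - y)))"
  have Fint: "integrable (lborel \<Otimes>\<^sub>M lborel) (case_prod F)"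
  proof (rule integrableI_bounded)
    show "case_prod F \<in> borel_measurable (lborel \<Otimes>\<^sub>M lborel)"
      unfolding F_def by measurable
    define Q where "Q = cball (0::real\<times>real) (N + \<rho>)"
    have [measurable]: "Q \<in> sets borel" by (simp add: Q_def)
    have vQ: "integrable lborel (\<lambda>y. v y * (B * indicator Q y))"
    proof (rule integrable_square_times_compact_support[OF _ _ v2])
      show "\<bar>B * indicator Q y\<bar> \<le> B" for y using B(1) by (simp add: indicator_def)
      show "B * indicator Q y = 0" if "N + \<rho> + 1 \<le> norm y" for y
        using that by (simp add: Q_def)
    qed measurable
    let ?g = "\<lambda>p. indicator K (fst p) * ennreal (norm (v (snd p) * (B * indicator Q (snd p))))"
    have "(\<integral>\<^sup>+p. ennreal (norm (case_prod F p)) \<partial>(lborel \<Otimes>\<^sub>M lborel))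
       \<le> (\<integral>\<^sup>+p. ?g p \<partial>(lborel \<Otimes>\<^sub>M lborel))"
    proof (rule nn_integral_mono)
      fix p :: "(real \<times> real) \<times> (real \<times> real)"
      obtain x y where p: "p = (x, y)" by (rule prod.exhaust)
      have "\<bar>F x y\<bar> \<le> indicator K x * \<bar>v y * (B * indicator Q y)\<bar>"
      proof (cases "x \<in> K \<and> norm (x - y) < \<rho>")
        case True
        have "norm y \<le> norm x + norm (x - y)"
          by (metis norm_minus_commute norm_triangle_sub)
        then have "y \<in> Q" using True N[of x] by (simp add: Q_def)
        then show ?thesis using True B by (simp add: F_def abs_mult mult_left_mono)
      next
        case False
        then have "F x y = 0" using \<kappa>(2)[of "x - y"] by (auto simp: F_def)
        then show ?thesis by simp
      qed
      then have "ennreal \<bar>F x y\<bar> \<le> ennreal (indicator K x * \<bar>v y * (B * indicator Q y)\<bar>)"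
        by (rule ennreal_leI)
      then show "ennreal (norm (case_prod F p)) \<le> ?g p"
        by (simp add: p ennreal_mult' ennreal_indicator)
    qed
    also have "\<dots> = (\<integral>\<^sup>+x. \<integral>\<^sup>+y. indicator K x * ennreal (norm (v y * (B * indicator Q y))) \<partial>lborel \<partial>lborel)"
    proof -
      have "?g \<in> borel_measurable (lborel \<Otimes>\<^sub>M lborel)"
        by measurable
      from lborel.nn_integral_fst[OF this] show ?thesis by simp
    qed
    also have "\<dots> = (\<integral>\<^sup>+x. indicator K x * (\<integral>\<^sup>+y. ennreal (norm (v y * (B * indicator Q y))) \<partial>lborel) \<partial>lborel)"
      by (intro nn_integral_cong nn_integral_cmult) measurable
    also have "\<dots> = (\<integral>\<^sup>+y. ennreal (norm (v y * (B * indicator Q y))) \<partial>lborel) * emeasure lborel K"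
      by (subst nn_integral_multc) (auto simp: mult.commute)
    also have "\<dots> < \<infinity>" 
      using vQ emeasure_bounded_finite[OF compact_imp_bounded[OF K]]
      by (simp add: integrable_iff_bounded ennreal_mult_less_top)
    finally show "(\<integral>\<^sup>+p. ennreal (norm (case_prod F p)) \<partial>(lborel \<Otimes>\<^sub>M lborel)) < \<infinity>" .
  qed
  have 1: "(\<integral>y. F x y \<partial>lborel) = indicator K x * mollify \<kappa> v x" for x
    unfolding F_def mollify_def by (rule integral_mult_right_zero)
  have 2: "(\<integral>x. F x y \<partial>lborel) = v y * (\<integral>x. indicator K x * \<kappa> (x - y) \<partial>lborel)" for y
  proof -
    have "(\<integral>x. F x y \<partial>lborel) = (\<integral>x. v y * (indicator K x * \<kappa> (x - y)) \<partial>lborel)"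
      by (simp add: F_def mult_ac)
    then show ?thesis by simp
  qed
  show "(\<integral>x. indicator K x * mollify \<kappa> v x \<partial>lborel)
    = (\<integral>y. v y * (\<integral>x. indicator K x * \<kappa> (x - y) \<partial>lborel) \<partial>lborel)"
    using lborel_pair.Fubini_integral[OF Fint] by (simp add: 1 2)
  show "integrable lborel (\<lambda>y. v y * (\<integral>x. indicator K x * \<kappa> (x - y) \<partial>lborel))"
    using lborel_pair.integrable_snd[OF Fint] by (simp add: 2)
  show "integrable lborel (\<lambda>x. indicator K x * mollify \<kappa> v x)"
    using lborel_pair.integrable_fst'[OF Fint] by (simp add: 1)
qed

text \<open>
  Mollification is moved onto the indicator of \<open>K\<close> and the error is estimated by Cauchy-Schwarz, so \<open>v\<close>
  enters only through its \<open>L\<^sup>2\<close> norm.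
\<close>

lemma integral_mollify_close:
  fixes v :: "real \<times> real \<Rightarrow> real"
  assumes [measurable]: "v \<in> borel_measurable borel"
    and v2: "integrable lborel (\<lambda>x. (v x)\<^sup>2)" and K: "compact K" and "e > 0"
  obtains \<rho> where "\<rho> > 0" "\<And>\<kappa>. \<lbrakk>continuous_on UNIV \<kappa>; \<And>z. 0 \<le> \<kappa> z; \<And>z. \<rho> \<le> norm z \<Longrightarrow> \<kappa> z = 0;
      (\<integral>\<^sup>+z. ennreal (\<kappa> z) \<partial>lborel) = 1\<rbrakk> \<Longrightarrow>
    \<bar>(\<integral>x. indicator K x * mollify \<kappa> v x \<partial>lborel) - (\<integral>x. indicator K x * v x \<partial>lborel)\<bar> \<le> e"
proof -
  have Kb[measurable]: "K \<in> sets borel" using K by (simp add: compact_imp_closed)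
  define N where "N = sqrt (\<integral>x. (v x)\<^sup>2 \<partial>lborel)"
  have N: "0 \<le> N" by (simp add: N_def)
  have vN: "(\<integral>\<^sup>+x. (ennreal \<bar>v x\<bar>)\<^sup>2 \<partial>lborel) \<le> ennreal (N\<^sup>2)"
    using nn_integral_eq_integral[OF v2] by (simp add: N_def ennreal_power)
  \<comment> \<open>\<open>N\<close> may be zero, hence the \<open>+ 1\<close>\<close>
  define \<delta> where "\<delta> = e / (N + 1)"
  have \<delta>: "0 < \<delta>" "N * \<delta> \<le> e" using \<open>e > 0\<close> N by (auto simp: \<delta>_def field_simps)
  obtain \<rho> where \<rho>: "\<rho> > 0" "\<And>w. norm w < \<rho> \<Longrightarrow>
    (\<integral>\<^sup>+y. ennreal \<bar>indicator K (y + w) - indicator K y\<bar> \<partial>lborel) \<le> ennreal (\<delta>\<^sup>2)"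
    using indicator_translation_continuous[OF K, of "\<delta>\<^sup>2"] \<delta> by auto
  show thesis
  proof (rule that[OF \<rho>(1)])
    fix \<kappa> :: "real \<times> real \<Rightarrow> real"
    assume \<kappa>: "continuous_on UNIV \<kappa>" "\<And>z. 0 \<le> \<kappa> z" "\<And>z. \<rho> \<le> norm z \<Longrightarrow> \<kappa> z = 0"
       "(\<integral>\<^sup>+z. ennreal (\<kappa> z) \<partial>lborel) = 1"
    have [measurable]: "\<kappa> \<in> borel_measurable borel" by (rule borel_measurable_continuous_onI[OF \<kappa>(1)])
    note swap = integral_mollify_swap[OF _ v2 K \<kappa>(1) \<kappa>(3), simplified]
    let ?k = "\<lambda>y. \<integral>x. indicator K x * \<kappa> (x - y) \<partial>lborel"
    have [measurable]: "?k \<in> borel_measurable borel"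
      using lborel.borel_measurable_lebesgue_integral[of "\<lambda>y x. indicator K x * \<kappa> (x - y)" lborel] by simp
    obtain M where M: "\<And>x. x \<in> K \<Longrightarrow> norm x \<le> M"
      using compact_imp_bounded[OF K] unfolding bounded_iff by metis
    have iK: "integrable lborel (\<lambda>y. v y * indicator K y)"
    proof (rule integrable_square_times_compact_support[OF _ _ v2])
      show "\<bar>indicator K y\<bar> \<le> (1::real)" for y by (simp add: indicator_def)
      show "indicator K y = (0::real)" if "M + 1 \<le> norm y" for y
        using that M[of y] by (auto simp: indicator_def)
    qed measurable
    have "(\<integral>x. indicator K x * mollify \<kappa> v x \<partial>lborel) - (\<integral>x. indicator K x * v x \<partial>lborel)
       = (\<integral>y. v y * ?k y \<partial>lborel) - (\<integral>y. v y * indicator K y \<partial>lborel)"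
      using swap(1) by (simp add: mult.commute)
    also have "\<dots> = (\<integral>y. v y * ?k y - v y * indicator K y \<partial>lborel)"
      using swap(2) iK by (intro Bochner_Integration.integral_diff[symmetric]) auto
    finally have eq: "(\<integral>x. indicator K x * mollify \<kappa> v x \<partial>lborel) - (\<integral>x. indicator K x * v x \<partial>lborel)
       = (\<integral>y. v y * ?k y - v y * indicator K y \<partial>lborel)" .
    have "integrable lborel (\<lambda>y. v y * ?k y - v y * indicator K y)"
      using swap(2) iK by (intro Bochner_Integration.integrable_diff) auto
    from integral_norm_bound_ennreal[OF this]
    have "ennreal \<bar>\<integral>y. v y * ?k y - v y * indicator K y \<partial>lborel\<bar>
       \<le> (\<integral>\<^sup>+y. ennreal \<bar>v y\<bar> * ennreal \<bar>?k y - indicator K y\<bar> \<partial>lborel)"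
      by (simp add: abs_mult ennreal_mult flip: right_diff_distrib)
    also have "\<dots> \<le> ennreal (N * \<delta>)"
    proof (rule Cauchy_Schwarz_nn_integral_bound[OF _ _ vN])
      show "(\<integral>\<^sup>+y. (ennreal \<bar>?k y - indicator K y\<bar>)\<^sup>2 \<partial>lborel) \<le> ennreal (\<delta>\<^sup>2)"
        using smoothed_indicator_close[OF Kb \<kappa>(1,2,3,4) \<rho>(2)] by (simp add: ennreal_power)
    qed (use N \<delta> in auto)
    also have "\<dots> \<le> ennreal e" using \<delta> by (intro ennreal_leI) auto
    finally show "\<bar>(\<integral>x. indicator K x * mollify \<kappa> v x \<partial>lborel) - (\<integral>x. indicator K x * v x \<partial>lborel)\<bar> \<le> e"
      unfolding eq using \<open>e > 0\<close> by simp
  qed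
qed

section \<open>Smooth functions of one variable and bumps\<close>

text \<open>
  The existential form exposes the next derivative in inductions.
\<close>

primrec Ck_real :: "nat \<Rightarrow> (real \<Rightarrow> real) \<Rightarrow> bool" where
  "Ck_real 0 f \<longleftrightarrow> continuous_on UNIV f"
| "Ck_real (Suc k) f \<longleftrightarrow> (\<exists>f'. (\<forall>x. (f has_real_derivative f' x) (at x)) \<and> Ck_real k f')"

lemma continuous_on_if_DERIV:
  assumes "\<And>x. (f has_real_derivative f' x) (at x)"
  shows "continuous_on UNIV f"
  using assms by (meson DERIV_isCont continuous_at_imp_continuous_on)

lemma Ck_real_SucI:
  "(\<And>x. (f has_real_derivative f' x) (at x)) \<Longrightarrow> Ck_real k f' \<Longrightarrow> Ck_real (Suc k) f"
  by auto

lemma Ck_real_Suc_D: "Ck_real (Suc k) f \<Longrightarrow> Ck_real k f"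
proof (induction k arbitrary: f)
  case 0
  then show ?case by (auto intro: continuous_on_if_DERIV)
next
  case (Suc k)
  then show ?case by (metis Ck_real.simps(2))
qed

lemma Ck_real_const: "Ck_real k (\<lambda>x. c)"
proof (induction k arbitrary: c)
  case (Suc k)
  then show ?case by (auto intro!: exI[of _ "\<lambda>x. 0"])
qed simp

lemma Ck_real_add: "Ck_real k f \<Longrightarrow> Ck_real k g \<Longrightarrow> Ck_real k (\<lambda>x. f x + g x)"
proof (induction k arbitrary: f g)
  case (Suc k)
  obtain f' g' where d: "\<And>x. (f has_real_derivative f' x) (at x)" "Ck_real k f'"
      "\<And>x. (g has_real_derivative g' x) (at x)" "Ck_real k g'"
    using Suc.prems by auto
  have "((\<lambda>x. f x + g x) has_real_derivative f' x + g' x) (at x)" for x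
    by (intro DERIV_add d)
  then show ?case using Suc.IH[OF d(2) d(4)] by (rule Ck_real_SucI)
qed (simp add: continuous_on_add)

lemma Ck_real_mult: "Ck_real k f \<Longrightarrow> Ck_real k g \<Longrightarrow> Ck_real k (\<lambda>x. f x * g x)"
proof (induction k arbitrary: f g)
  case (Suc k)
  obtain f' g' where d: "\<And>x. (f has_real_derivative f' x) (at x)" "Ck_real k f'"
      "\<And>x. (g has_real_derivative g' x) (at x)" "Ck_real k g'"
    using Suc.prems by auto
  have "((\<lambda>x. f x * g x) has_real_derivative f' x * g x + g' x * f x) (at x)" for x
    by (intro DERIV_mult d)
  moreover have "Ck_real k (\<lambda>x. f' x * g x + g' x * f x)"
    using Suc.prems d by (intro Ck_real_add Suc.IH) (auto intro: Ck_real_Suc_D simp del: Ck_real.simps)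
  ultimately show ?case by (rule Ck_real_SucI)
qed (simp add: continuous_on_mult)

lemma Ck_real_affine: "Ck_real k f \<Longrightarrow> Ck_real k (\<lambda>x. f (a * x + b))"
proof (induction k arbitrary: f)
  case 0
  then show ?case by (auto intro!: continuous_on_compose2[of UNIV f] continuous_intros)
next
  case (Suc k)
  obtain f' where d: "\<And>x. (f has_real_derivative f' x) (at x)" "Ck_real k f'"
    using Suc.prems by auto
  have "((\<lambda>x. f (a * x + b)) has_real_derivative f' (a * x + b) * a) (at x)" for x
    by (rule DERIV_chain2[OF d(1)]) (auto intro!: derivative_eq_intros)
  moreover have "Ck_real k (\<lambda>x. f' (a * x + b) * a)"
    by (rule Ck_real_mult[OF Suc.IH[OF d(2)] Ck_real_const])
  ultimately show ?case by (rule Ck_real_SucI)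
qed

lemma Ck_real_derivative:
  assumes "Ck_real (Suc k) f" "\<And>x. (f has_real_derivative f' x) (at x)"
  shows "Ck_real k f'"
proof -
  obtain g where g: "\<And>x. (f has_real_derivative g x) (at x)" "Ck_real k g"
    using assms(1) by auto
  have "g = f'" using DERIV_unique[OF g(1) assms(2)] by (rule ext)
  then show ?thesis using g by simp
qed

definition smooth_compact :: "(real \<Rightarrow> real) \<Rightarrow> bool" where
  "smooth_compact f \<longleftrightarrow> (\<forall>k. Ck_real k f) \<and> (\<exists>R. \<forall>x. R \<le> \<bar>x\<bar> \<longrightarrow> f x = 0)"

lemma smooth_compactI:
  "(\<And>k. Ck_real k f) \<Longrightarrow> (\<And>x. R \<le> \<bar>x\<bar> \<Longrightarrow> f x = 0) \<Longrightarrow> smooth_compact f"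
  unfolding smooth_compact_def by blast

lemma smooth_compact_derivative_support:
  assumes "\<And>x. R \<le> \<bar>x\<bar> \<Longrightarrow> f x = 0" "(f has_real_derivative D) (at x)" "R < \<bar>x\<bar>"
  shows "D = 0"
proof -
  have "\<forall>\<^sub>F y in nhds x. R < \<bar>y\<bar>"
    using assms(3) by (intro eventually_nhds[THEN iffD2] exI[of _ "{y. R < \<bar>y\<bar>}"])
      (auto intro!: open_Collect_less continuous_intros)
  then have "\<forall>\<^sub>F y in nhds x. f y = 0"
    by eventually_elim (simp add: assms(1))
  then have "(f has_real_derivative D) (at x) = ((\<lambda>_. 0) has_real_derivative D) (at x)"
    by (intro DERIV_cong_ev) auto
  then have "((\<lambda>_. 0::real) has_real_derivative D) (at x)" using assms(2) by blast
  then show ?thesis using DERIV_const DERIV_unique by blast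
qed

lemma smooth_compact_derivative:
  assumes "smooth_compact f" "\<And>x. (f has_real_derivative f' x) (at x)"
  shows "smooth_compact f'"
proof -
  obtain R where R: "f x = 0" if "R \<le> \<bar>x\<bar>" for x
    using assms(1) by (auto simp: smooth_compact_def)
  show ?thesis
  proof (rule smooth_compactI[where R="R + 1"])
    show "Ck_real k f'" for k
      using assms by (intro Ck_real_derivative[of k f]) (auto simp: smooth_compact_def simp del: Ck_real.simps)
    show "f' x = 0" if "R + 1 \<le> \<bar>x\<bar>" for x
      using smooth_compact_derivative_support[OF R assms(2)] that by simp
  qed
qed

lemma smooth_compact_add: 
  assumes "smooth_compact f" "smooth_compact g" shows "smooth_compact (\<lambda>x. f x + g x)"
proof -
  obtain R S where R: "\<And>x. R \<le> \<bar>x\<bar> \<Longrightarrow> f x = 0" and S: "\<And>x. S \<le> \<bar>x\<bar> \<Longrightarrow> g x = 0"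
    using assms unfolding smooth_compact_def by metis
  show ?thesis using assms R S
    by (intro smooth_compactI[where R="max R S"] Ck_real_add) (auto simp: smooth_compact_def)
qed

lemma smooth_compact_cmult: 
  assumes "smooth_compact f" shows "smooth_compact (\<lambda>x. c * f x)"
proof -
  obtain R where R: "\<And>x. R \<le> \<bar>x\<bar> \<Longrightarrow> f x = 0"
    using assms unfolding smooth_compact_def by metis
  show ?thesis using assms R
    by (intro smooth_compactI[where R=R] Ck_real_mult Ck_real_const) (auto simp: smooth_compact_def)
qed

lemma smooth_compact_reflect:
  assumes "smooth_compact f"
  shows "smooth_compact (\<lambda>x. f (c - x))"
proof -
  obtain R where R: "\<And>x. R \<le> \<bar>x\<bar> \<Longrightarrow> f x = 0"
    using assms unfolding smooth_compact_def by metis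
  have "Ck_real k (\<lambda>x. f (c - x))" for k
    using Ck_real_affine[of k f "-1" c] assms by (simp add: smooth_compact_def)
  then show ?thesis using R by (rule smooth_compactI[where R="R + \<bar>c\<bar>"]) auto
qed

lemma smooth_compact_continuous: "smooth_compact f \<Longrightarrow> continuous_on UNIV f"
  unfolding smooth_compact_def by (metis Ck_real.simps(1))

lemma smooth_compact_has_derivative:
  assumes "smooth_compact f"
  obtains f' where "\<And>x. (f has_real_derivative f' x) (at x)" 
  using assms unfolding smooth_compact_def by (metis Ck_real.simps(2))

text \<open>
  The classical flat function \<open>exp (-1/x)\<close>, with a polynomial factor in \<open>1/x\<close> so that the family is
  closed under differentiation.
\<close>

definition exp_recip :: "real poly \<Rightarrow> real \<Rightarrow> real" where
  "exp_recip P x = (if 0 < x then poly P (1 / x) * exp (- (1 / x)) else 0)"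

lemma poly_over_exp_tendsto_0: "((\<lambda>t. t ^ n * poly P t * exp (- t)) \<longlongrightarrow> 0) (at_top :: real filter)"
proof (induction P arbitrary: n)
  case 0
  then show ?case by simp
next
  case (pCons a P)
  have "((\<lambda>t. a * (t ^ n / exp t) + t ^ Suc n * poly P t * exp (- t)) \<longlongrightarrow> a * 0 + 0) (at_top :: real filter)"
    by (intro tendsto_add tendsto_mult tendsto_const tendsto_power_div_exp_0 pCons.IH)
  then show ?case by (simp add: algebra_simps exp_minus divide_inverse)
qed

text \<open>
  Away from the origin this is calculus. At the origin the difference quotient from the right is
  \<open>t P(t) exp (-t)\<close> with \<open>t = 1/h\<close> tending to infinity.
\<close>

lemma DERIV_exp_recip:
  "(exp_recip P has_real_derivative exp_recip ([:0, 0, 1:] * (P - pderiv P)) x) (at x)"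
proof -
  consider "x > 0" | "x < 0" | "x = 0" by linarith
  then show ?thesis
  proof cases
    case 1
    have "((\<lambda>x. poly P (1 / x) * exp (- (1 / x))) has_real_derivative 
        poly (pderiv P) (1 / x) * (- 1 / x\<^sup>2) * exp (- (1 / x)) + exp (- (1 / x)) * (1 / x\<^sup>2) * poly P (1 / x)) (at x)"
      using 1 by (auto intro!: derivative_eq_intros DERIV_chain2[OF poly_DERIV] simp: power2_eq_square)
    also have "poly (pderiv P) (1 / x) * (- 1 / x\<^sup>2) * exp (- (1 / x)) + exp (- (1 / x)) * (1 / x\<^sup>2) * poly P (1 / x)
       = exp_recip ([:0, 0, 1:] * (P - pderiv P)) x"
      using 1 by (simp add: exp_recip_def field_simps power2_eq_square)
    finally have *: "((\<lambda>x. poly P (1 / x) * exp (- (1 / x))) has_real_derivative exp_recip ([:0, 0, 1:] * (P - pderiv P)) x) (at x)" .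
    have "\<forall>\<^sub>F y in nhds x. 0 < y" using eventually_nhds_in_open[of "{0<..}" x] 1 by simp
    then have ev: "\<forall>\<^sub>F y in nhds x. exp_recip P y = poly P (1 / y) * exp (- (1 / y))"
      by eventually_elim (simp add: exp_recip_def)
    show ?thesis using * by (simp only: DERIV_cong_ev[OF refl ev refl])
  next
    case 2
    have "\<forall>\<^sub>F y in nhds x. y < 0" using eventually_nhds_in_open[of "{..<0}" x] 2 by simp
    then have ev: "\<forall>\<^sub>F y in nhds x. exp_recip P y = 0"
      by eventually_elim (simp add: exp_recip_def)
    have "((\<lambda>_. 0) has_real_derivative exp_recip ([:0, 0, 1:] * (P - pderiv P)) x) (at x)"
      using 2 by (simp add: exp_recip_def)
    then show ?thesis by (simp only: DERIV_cong_ev[OF refl ev refl])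
  next
    case 3
    have "((\<lambda>h. exp_recip P h / h) \<longlongrightarrow> 0) (at (0::real))"
    proof (rule filterlim_split_at)
      have "\<forall>\<^sub>F h in at_left (0::real). exp_recip P h / h = 0"
        unfolding eventually_at_filter by (rule always_eventually) (simp add: exp_recip_def)
      then show "((\<lambda>h. exp_recip P h / h) \<longlongrightarrow> 0) (at_left (0::real))"
        by (rule tendsto_eventually)
      have "((\<lambda>h. (inverse h) ^ 1 * poly P (inverse h) * exp (- inverse h)) \<longlongrightarrow> 0) (at_right (0::real))"
        by (rule filterlim_compose[OF poly_over_exp_tendsto_0 filterlim_inverse_at_top_right])
      moreover have "\<forall>\<^sub>F h in at_right (0::real). (inverse h) ^ 1 * poly P (inverse h) * exp (- inverse h) = exp_recip P h / h"
        unfolding eventually_at_filter by (rule always_eventually) (simp add: exp_recip_def field_simps)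
      ultimately show "((\<lambda>h. exp_recip P h / h) \<longlongrightarrow> 0) (at_right (0::real))"
        by (rule Lim_transform_eventually)
    qed
    then show ?thesis using 3 by (simp add: DERIV_def exp_recip_def)
  qed
qed

lemma Ck_real_exp_recip: "Ck_real k (exp_recip P)"
proof (induction k arbitrary: P)
  case 0
  show ?case using DERIV_exp_recip by (auto intro: continuous_on_if_DERIV)
next
  case (Suc k)
  then show ?case using DERIV_exp_recip by (metis Ck_real.simps(2))
qed

text \<open>
  The product of two flat functions facing each other is positive exactly between their end points;
  it remains to divide by its integral.
\<close>

lemma smooth_bump_exists:
  fixes \<epsilon> :: real
  assumes "\<epsilon> > 0"
  obtains b where "smooth_compact b" "\<And>x. 0 \<le> b x" "\<And>x. \<epsilon> \<le> \<bar>x\<bar> \<Longrightarrow> b x = 0"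
    "(\<integral>\<^sup>+x. ennreal (b x) \<partial>lborel) = 1"
proof -
  define f where "f = (\<lambda>x. exp_recip 1 (1 / \<epsilon> * x + 1) * exp_recip 1 (- 1 / \<epsilon> * x + 1))"
  have fpos: "0 < f x" if "\<bar>x\<bar> < \<epsilon>" for x
  proof -
    have "0 < 1 / \<epsilon> * x + 1" "0 < - 1 / \<epsilon> * x + 1"
      using that assms by (auto simp: field_simps abs_less_iff)
    then show ?thesis by (simp add: f_def exp_recip_def)
  qed
  have fz: "f x = 0" if "\<epsilon> \<le> \<bar>x\<bar>" for x
  proof -
    have "\<not> 0 < 1 / \<epsilon> * x + 1 \<or> \<not> 0 < - 1 / \<epsilon> * x + 1"
      using that assms by (auto simp: field_simps abs_if split: if_splits)
    then show ?thesis by (auto simp: f_def exp_recip_def)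
  qed
  have f0: "0 \<le> f x" for x using fpos[of x] fz[of x] by (cases "\<bar>x\<bar> < \<epsilon>") auto
  have Ck: "Ck_real k f" for k
    unfolding f_def by (intro Ck_real_mult Ck_real_affine Ck_real_exp_recip)
  have fc: "continuous_on UNIV f" using Ck[of 0] by simp
  have [measurable]: "f \<in> borel_measurable borel" by (rule borel_measurable_continuous_onI[OF fc])
  obtain B where B: "0 \<le> B" "\<And>x. \<bar>f x\<bar> \<le> B"
    using continuous_compact_support_bounded[of f \<epsilon>] fc fz by auto
  define I where "I = (\<integral>\<^sup>+x. ennreal (f x) \<partial>lborel)"
  have "I \<le> (\<integral>\<^sup>+x. ennreal B * indicator {-\<epsilon>..\<epsilon>} x \<partial>lborel)"
    unfolding I_def
  proof (rule nn_integral_mono)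
    fix x show "ennreal (f x) \<le> ennreal B * indicator {-\<epsilon>..\<epsilon>} x"
      using B(2)[of x] fz[of x] f0[of x] by (auto simp: indicator_def intro!: ennreal_leI)
  qed
  also have "\<dots> < \<infinity>" using assms by (simp add: nn_integral_cmult_indicator ennreal_mult_less_top)
  finally have Ifin: "I < \<infinity>" .
  have "I \<noteq> 0"
  proof
    assume "I = 0"
    then have "AE x in lborel. f x = 0"
      unfolding I_def using f0 by (subst (asm) nn_integral_0_iff_AE) (auto simp: order_antisym)
    then have "AE x in lborel. x \<notin> {-\<epsilon><..<\<epsilon>}"
      by eventually_elim (use fpos in \<open>auto simp: abs_less_iff\<close>, force)
    then have "{-\<epsilon><..<\<epsilon>} \<in> null_sets lborel"
      by (subst (asm) AE_iff_null_sets[symmetric]) auto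
    then show False using assms by (auto simp: null_sets_def)
  qed
  obtain c where c: "I = ennreal c" "c > 0"
    using Ifin \<open>I \<noteq> 0\<close> by (cases I) (auto simp: less_le)
  show thesis
  proof (rule that[of "\<lambda>x. 1 / c * f x"])
    show "smooth_compact (\<lambda>x. 1 / c * f x)"
      by (intro smooth_compact_cmult smooth_compactI[of f \<epsilon>] Ck fz)
    show "0 \<le> 1 / c * f x" for x using f0 c by simp
    show "1 / c * f x = 0" if "\<epsilon> \<le> \<bar>x\<bar>" for x using fz that by simp
    have "(\<integral>\<^sup>+x. ennreal (1 / c * f x) \<partial>lborel) = (\<integral>\<^sup>+x. ennreal (1 / c) * ennreal (f x) \<partial>lborel)"
      using c f0 by (intro nn_integral_cong ennreal_mult) auto
    also have "\<dots> = ennreal (1 / c) * I" unfolding I_def by (rule nn_integral_cmult) measurable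
    also have "\<dots> = 1" using c by (simp flip: ennreal_mult)
    finally show "(\<integral>\<^sup>+x. ennreal (1 / c * f x) \<partial>lborel) = 1" .
  qed
qed

section \<open>Logarithmic coordinates on the half-plane\<close>

text \<open>
  The factor \<open>1/x\<^sup>m\<close> makes the family closed under differentiation: the derivative replaces \<open>a\<close> by
  \<open>a' - m a\<close> and \<open>m\<close> by \<open>m + 1\<close>. The function vanishes near the origin when \<open>a\<close> has compact support.
\<close>

definition log_pullback :: "nat \<Rightarrow> (real \<Rightarrow> real) \<Rightarrow> real \<Rightarrow> real" where
  "log_pullback m a x = (if 0 < x then a (ln x) / x ^ m else 0)"

lemma log_pullback_near_0:
  assumes "\<And>t. R \<le> \<bar>t\<bar> \<Longrightarrow> a t = 0" "x < exp (- R)"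
  shows "log_pullback m a x = 0"
proof (cases "0 < x")
  case True
  then have "ln x < - R" using assms(2) by (metis ln_less_cancel_iff exp_gt_zero ln_exp)
  then have "a (ln x) = 0" by (intro assms(1)) auto
  then show ?thesis by (simp add: log_pullback_def)
qed (simp add: log_pullback_def)

lemma DERIV_log_pullback:
  assumes a: "smooth_compact a" "\<And>t. (a has_real_derivative a' t) (at t)"
  shows "(log_pullback m a has_real_derivative log_pullback (Suc m) (\<lambda>t. a' t + - real m * a t) x) (at x)"
proof (cases "0 < x")
  case True
  have "((\<lambda>x. a (ln x) / x ^ m) has_real_derivative (a' (ln x) * (1 / x) * x ^ m - a (ln x) * (real m * x ^ (m - 1))) / (x ^ m * x ^ m)) (at x)"
    using True by (auto intro!: derivative_eq_intros DERIV_chain2[OF a(2)])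
  also have "(a' (ln x) * (1 / x) * x ^ m - a (ln x) * (real m * x ^ (m - 1))) / (x ^ m * x ^ m)
     = log_pullback (Suc m) (\<lambda>t. a' t + - real m * a t) x"
    using True by (cases m) (auto simp: log_pullback_def field_simps)
  finally have *: "((\<lambda>x. a (ln x) / x ^ m) has_real_derivative log_pullback (Suc m) (\<lambda>t. a' t + - real m * a t) x) (at x)" .
  have ev: "\<forall>\<^sub>F y in nhds x. log_pullback m a y = a (ln y) / y ^ m"
    using eventually_nhds_in_open[of "{0<..}" x] True
    by (auto elim!: eventually_mono simp: log_pullback_def)
  show ?thesis using * by (simp only: DERIV_cong_ev[OF refl ev refl])
next
  case False
  obtain R where R: "\<And>t. R \<le> \<bar>t\<bar> \<Longrightarrow> a t = 0" using a(1) by (auto simp: smooth_compact_def)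
  have "x < exp (- R)" using False by (meson exp_gt_zero less_le_trans not_less)
  then have ev: "\<forall>\<^sub>F y in nhds x. log_pullback m a y = 0"
    using eventually_nhds_in_open[of "{..<exp (- R)}" x] log_pullback_near_0[OF R]
    by (auto elim!: eventually_mono)
  have "((\<lambda>_. 0) has_real_derivative log_pullback (Suc m) (\<lambda>t. a' t + - real m * a t) x) (at x)"
    using False by (simp add: log_pullback_def)
  then show ?thesis by (simp only: DERIV_cong_ev[OF refl ev refl])
qed

lemma Ck_real_log_pullback: "smooth_compact a \<Longrightarrow> Ck_real k (log_pullback m a)"
proof (induction k arbitrary: a m)
  case 0
  obtain a' where "\<And>t. (a has_real_derivative a' t) (at t)"
    using smooth_compact_has_derivative[OF 0] by metis
  from DERIV_log_pullback[OF 0 this] show ?case by (auto intro: continuous_on_if_DERIV)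
next
  case (Suc k)
  obtain a' where a': "\<And>t. (a has_real_derivative a' t) (at t)"
    using smooth_compact_has_derivative[OF Suc.prems] by metis
  have "smooth_compact (\<lambda>t. a' t + - real m * a t)"
    by (intro smooth_compact_add smooth_compact_cmult smooth_compact_derivative[OF Suc.prems a'] Suc.prems)
  from Suc.IH[OF this] show ?case using DERIV_log_pullback[OF Suc.prems a'] by (rule Ck_real_SucI[rotated])
qed

lemma pd1_product:
  assumes "\<And>t. (p has_real_derivative p' t) (at t)"
  shows "pd1 (\<lambda>x. p (fst x) * c (snd x)) = (\<lambda>x. p' (fst x) * c (snd x))"
proof
  fix x :: "real \<times> real"
  have "((\<lambda>t. p t * c (snd x)) has_real_derivative p' (fst x) * c (snd x)) (at (fst x))"
    by (rule DERIV_cmult_right[OF assms])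
  then show "pd1 (\<lambda>x. p (fst x) * c (snd x)) x = p' (fst x) * c (snd x)"
    by (simp add: pd1_def DERIV_imp_deriv)
qed

lemma pd2_product:
  assumes "\<And>t. (c has_real_derivative c' t) (at t)"
  shows "pd2 (\<lambda>x. p (fst x) * c (snd x)) = (\<lambda>x. p (fst x) * c' (snd x))"
proof
  fix x :: "real \<times> real"
  have "((\<lambda>t. p (fst x) * c t) has_real_derivative p (fst x) * c' (snd x)) (at (snd x))"
    by (rule DERIV_cmult[OF assms])
  then show "pd2 (\<lambda>x. p (fst x) * c (snd x)) x = p (fst x) * c' (snd x)"
    by (simp add: pd2_def DERIV_imp_deriv)
qed

lemma C_k_product:
  assumes "\<forall>k. Ck_real k p" "\<forall>k. Ck_real k c"
  shows "C_k k (\<lambda>x. p (fst x) * c (snd x))"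
  using assms
proof (induction k arbitrary: p c)
  case 0
  have "continuous_on UNIV p" "continuous_on UNIV c" using 0[THEN spec[of _ 0]] by auto
  then show ?case
    by (auto intro!: continuous_intros continuous_on_compose2[of UNIV p] continuous_on_compose2[of UNIV c])
next
  case (Suc k)
  obtain p' where p': "\<And>t. (p has_real_derivative p' t) (at t)"
    using Suc.prems(1)[THEN spec[of _ 1]] by auto
  obtain c' where c': "\<And>t. (c has_real_derivative c' t) (at t)"
    using Suc.prems(2)[THEN spec[of _ 1]] by auto
  have p'k: "\<forall>k. Ck_real k p'" using Suc.prems(1) p' Ck_real_derivative by blast
  have c'k: "\<forall>k. Ck_real k c'" using Suc.prems(2) c' Ck_real_derivative by blast
  have "(\<lambda>x. p (fst x)) differentiable (at x)" "(\<lambda>x. c (snd x)) differentiable (at x)" for x :: "real \<times> real"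
  proof -
    have "p differentiable (at (fst x))" "c differentiable (at (snd x))"
      using p' c' real_differentiable_def by blast+
    then show "(\<lambda>x. p (fst x)) differentiable (at x)" "(\<lambda>x. c (snd x)) differentiable (at x)"
      using differentiable_chain_at[of fst x p] differentiable_chain_at[of snd x c]
      by (auto simp: o_def bounded_linear_imp_differentiable bounded_linear_fst bounded_linear_snd)
  qed
  then have "(\<lambda>x. p (fst x) * c (snd x)) differentiable_on UNIV"
    by (auto simp: differentiable_on_def intro!: differentiable_mult)
  then show ?case
    using Suc.IH[OF p'k Suc.prems(2)] Suc.IH[OF Suc.prems(1) c'k]
    by (simp add: pd1_product[OF p'] pd2_product[OF c'])
qed

lemma product_test_function:
  assumes a: "smooth_compact a" and c: "smooth_compact c"
  shows "(\<lambda>x. log_pullback m a (fst x) * c (snd x)) \<in> test_functions"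
proof -
  let ?\<phi> = "\<lambda>x. log_pullback m a (fst x) * c (snd x)"
  obtain R where R: "\<And>t. R \<le> \<bar>t\<bar> \<Longrightarrow> a t = 0" using a by (auto simp: smooth_compact_def)
  obtain S where S: "\<And>t. S \<le> \<bar>t\<bar> \<Longrightarrow> c t = 0" using c by (auto simp: smooth_compact_def)
  let ?Q = "{exp (- R)..exp R} \<times> {- S..S}"
  have "{x. ?\<phi> x \<noteq> 0} \<subseteq> ?Q"
  proof
    fix x assume x: "x \<in> {x. ?\<phi> x \<noteq> 0}"
    obtain s t where st: "x = (s, t)" by (metis surj_pair)
    have ne: "log_pullback m a s * c t \<noteq> 0" using x st by simp
    have 1: "\<not> s < exp (- R)" using ne log_pullback_near_0[OF R] by auto
    have 2: "\<bar>t\<bar> < S" using ne S[of t] by (cases "\<bar>t\<bar> < S") auto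
    have 3: "0 < s" using ne by (cases "0 < s") (auto simp: log_pullback_def)
    have "\<bar>ln s\<bar> < R" using ne 3 R[of "ln s"] by (cases "\<bar>ln s\<bar> < R") (auto simp: log_pullback_def)
    then have "s \<le> exp R" using 3 by (metis abs_less_iff exp_le_cancel_iff exp_ln less_imp_le)
    then show "x \<in> ?Q" using 1 2 st by auto
  qed
  moreover have cQ: "compact ?Q" by (intro compact_Times compact_Icc)
  ultimately have cl: "closure {x. ?\<phi> x \<noteq> 0} \<subseteq> ?Q" by (intro closure_minimal compact_imp_closed)
  then have "compact (closure {x. ?\<phi> x \<noteq> 0})"
    using compact_Int_closed[OF cQ, of "closure {x. ?\<phi> x \<noteq> 0}"] by (simp add: Int_absorb1)
  moreover have "?Q \<subseteq> half_plane"
  proof -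
    have "0 < s" if "exp (- R) \<le> s" for s using that by (meson exp_gt_zero less_le_trans)
    then show ?thesis by (auto simp: half_plane_def)
  qed
  moreover have "C_k k ?\<phi>" for k
    using a c by (intro C_k_product) (auto simp: Ck_real_log_pullback smooth_compact_def)
  ultimately show ?thesis using cl by (auto simp: test_functions_def)
qed

definition log_coords :: "real \<times> real \<Rightarrow> real \<times> real" where
  "log_coords x = (ln (fst x), snd x)"

lemma borel_measurable_fst_snd_plane[measurable]:
  "fst \<in> borel_measurable (borel :: (real \<times> real) measure)"
  "snd \<in> borel_measurable (borel :: (real \<times> real) measure)"
  by (intro borel_measurable_continuous_onI continuous_on_fst continuous_on_snd continuous_on_id)+

lemma log_coords_measurable[measurable]: "log_coords \<in> borel_measurable borel"
  unfolding log_coords_def[abs_def] by (intro borel_measurable_Pair) measurable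

lemma half_plane_sets[measurable]: "half_plane \<in> sets borel"
  unfolding half_plane_def by measurable

lemma borel_measurable_cone_measure:
  "f \<in> borel_measurable borel \<Longrightarrow> f \<in> borel_measurable cone_measure"
  unfolding cone_measure_def
  by (auto intro!: measurable_restrict_space1 measurable_completion)

lemma nn_integral_cone_measure:
  fixes f :: "real \<times> real \<Rightarrow> ennreal"
  assumes [measurable]: "f \<in> borel_measurable borel"
  shows "(\<integral>\<^sup>+x. f x \<partial>cone_measure) = (\<integral>\<^sup>+x. ennreal (1 / fst x) * f x * indicator half_plane x \<partial>lborel)"
proof -
  have 1: "(\<lambda>x. ennreal (1 / fst x)) \<in> borel_measurable (lebesgue_on half_plane)"
    by (intro measurable_restrict_space1 measurable_completion) measurable
  have 2: "f \<in> borel_measurable (lebesgue_on half_plane)"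
    by (intro measurable_restrict_space1 measurable_completion) measurable
  show ?thesis
    unfolding cone_measure_def
    by (subst nn_integral_density[OF 1 2], subst nn_integral_restrict_space)
       (auto simp: nn_integral_completion)
qed

text \<open>
  A box in logarithmic coordinates is the product of \<open>{exp l\<^sub>1<..<exp u\<^sub>1}\<close>, on which \<open>1/s\<close> has
  integral \<open>u\<^sub>1 - l\<^sub>1\<close>, and an unchanged interval; boxes determine Lebesgue measure.
\<close>

lemma distr_cone_measure: "distr cone_measure borel log_coords = (lborel :: (real \<times> real) measure)"
proof (rule lborel_eqI[symmetric])
  fix l u :: "real \<times> real"
  assume lu: "\<And>b. b \<in> Basis \<Longrightarrow> l \<bullet> b \<le> u \<bullet> b"
  obtain l1 l2 u1 u2 where l: "l = (l1, l2)" and u: "u = (u1, u2)" by (metis surj_pair)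
  have le: "l1 \<le> u1" "l2 \<le> u2"
    using lu[of "(1, 0)"] lu[of "(0, 1)"] by (auto simp: l u Basis_prod_def)
  have lm: "log_coords \<in> measurable cone_measure borel"
    by (rule borel_measurable_cone_measure) measurable
  have meas: "(\<lambda>x. indicator (box l u) (log_coords x) :: ennreal) \<in> borel_measurable borel"
    by measurable
  have "emeasure (distr cone_measure borel log_coords) (box l u)
     = (\<integral>\<^sup>+x. indicator (box l u) (log_coords x) \<partial>cone_measure)"
  proof -
    have "emeasure (distr cone_measure borel log_coords) (box l u)
       = (\<integral>\<^sup>+p. indicator (box l u) p \<partial>distr cone_measure borel log_coords)"
      by simp
    also have "\<dots> = (\<integral>\<^sup>+x. indicator (box l u) (log_coords x) \<partial>cone_measure)"
      by (rule nn_integral_distr[OF lm]) simp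
    finally show ?thesis .
  qed
  also have "\<dots> = (\<integral>\<^sup>+x. ennreal (1 / fst x) * indicator (box l u) (log_coords x) * indicator half_plane x \<partial>lborel)"
    by (rule nn_integral_cone_measure[OF meas])
  also have "\<dots> = (\<integral>\<^sup>+x. ennreal (1 / fst x) * indicator {exp l1<..<exp u1} (fst x) * indicator {l2<..<u2} (snd x) \<partial>lborel)"
  proof (intro nn_integral_cong)
    fix x :: "real \<times> real"
    obtain s t where x: "x = (s, t)" by (metis surj_pair)
    have "(log_coords x \<in> box l u \<and> x \<in> half_plane) \<longleftrightarrow> (s \<in> {exp l1<..<exp u1} \<and> t \<in> {l2<..<u2})"
    proof (cases "0 < s")
      case True
      then have "l1 < ln s \<longleftrightarrow> exp l1 < s" "ln s < u1 \<longleftrightarrow> s < exp u1"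
        by (metis exp_less_cancel_iff exp_ln)+
      then show ?thesis using True
        by (auto simp: x l u log_coords_def half_plane_def mem_box Basis_prod_def)
    next
      case False
      then have "\<not> exp l1 < s" by (meson exp_gt_zero less_trans)
      then show ?thesis using False by (auto simp: x half_plane_def)
    qed
    then show "ennreal (1 / fst x) * indicator (box l u) (log_coords x) * indicator half_plane x
       = ennreal (1 / fst x) * indicator {exp l1<..<exp u1} (fst x) * indicator {l2<..<u2} (snd x)"
      by (auto simp: x indicator_def)
  qed
  also have "\<dots> = (\<integral>\<^sup>+s. \<integral>\<^sup>+t. ennreal (1 / s) * indicator {exp l1<..<exp u1} s * indicator {l2<..<u2} t \<partial>lborel \<partial>lborel)"
  proof -
    let ?g = "\<lambda>x::real\<times>real. ennreal (1 / fst x) * indicator {exp l1<..<exp u1} (fst x) * indicator {l2<..<u2} (snd x)"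
    have "?g \<in> borel_measurable (lborel \<Otimes>\<^sub>M lborel)" by measurable
    from lborel.nn_integral_fst[OF this] show ?thesis by (simp add: lborel_prod)
  qed
  also have "\<dots> = (\<integral>\<^sup>+s. ennreal (1 / s) * indicator {exp l1<..<exp u1} s * ennreal (u2 - l2) \<partial>lborel)"
    using le by (intro nn_integral_cong) (subst nn_integral_cmult_indicator, auto)
  also have "\<dots> = (\<integral>\<^sup>+s. ennreal (1 / s) * indicator {exp l1<..<exp u1} s \<partial>lborel) * ennreal (u2 - l2)"
    by (rule nn_integral_multc) measurable
  also have "(\<integral>\<^sup>+s. ennreal (1 / s) * indicator {exp l1<..<exp u1} s \<partial>lborel)
     = (\<integral>\<^sup>+s. ennreal (1 / s) * indicator {exp l1..exp u1} s \<partial>lborel)"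
  proof (rule nn_integral_cong_AE)
    have "AE s in lborel. s \<noteq> exp l1 \<and> s \<noteq> exp u1" 
      using AE_lborel_singleton[of "exp l1"] AE_lborel_singleton[of "exp u1"] by eventually_elim auto
    then show "AE s in lborel. ennreal (1 / s) * indicator {exp l1<..<exp u1} s = ennreal (1 / s) * indicator {exp l1..exp u1} s"
      by eventually_elim (auto simp: indicator_def)
  qed
  also have "\<dots> = ennreal (ln (exp u1) - ln (exp l1))"
  proof (rule nn_integral_FTC_Icc)
    fix s assume "s \<in> {exp l1..exp u1}"
    then have "0 < s" by (meson atLeastAtMost_iff exp_gt_zero less_le_trans)
    then show "(ln has_real_derivative 1 / s) (at s)" "0 \<le> 1 / s"
      by (auto intro!: derivative_eq_intros)
  qed (use le in auto)
  also have "ennreal (ln (exp u1) - ln (exp l1)) * ennreal (u2 - l2) = ennreal (\<Prod>b\<in>Basis. (u - l) \<bullet> b)"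
  proof -
    have "(\<Prod>b\<in>Basis. (u - l) \<bullet> b) = (u1 - l1) * (u2 - l2)"
      by (simp add: Basis_prod_def prod.union_disjoint l u)
    then show ?thesis using le by (simp add: ennreal_mult)
  qed
  finally show "emeasure (distr cone_measure borel log_coords) (box l u) = ennreal (\<Prod>b\<in>Basis. (u - l) \<bullet> b)" .
qed simp

lemma log_coords_cone_measurable[measurable]: "log_coords \<in> measurable cone_measure borel"
  by (rule borel_measurable_cone_measure) measurable

lemma nn_integral_log_coords:
  assumes "F \<in> borel_measurable borel"
  shows "(\<integral>\<^sup>+x. F (log_coords x) \<partial>cone_measure) = (\<integral>\<^sup>+p. F p \<partial>lborel)"
proof -
  have "(\<integral>\<^sup>+p. F p \<partial>lborel) = (\<integral>\<^sup>+p. F p \<partial>distr cone_measure borel log_coords)" 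
    unfolding distr_cone_measure ..
  also have "\<dots> = (\<integral>\<^sup>+x. F (log_coords x) \<partial>cone_measure)"
    using assms by (intro nn_integral_distr) auto
  finally show ?thesis by simp
qed

lemma integral_log_coords:
  fixes F :: "real \<times> real \<Rightarrow> real"
  assumes "F \<in> borel_measurable borel"
  shows "(\<integral>x. F (log_coords x) \<partial>cone_measure) = (\<integral>p. F p \<partial>lborel)"
proof -
  have "(\<integral>p. F p \<partial>lborel) = (\<integral>p. F p \<partial>distr cone_measure borel log_coords)" 
    unfolding distr_cone_measure ..
  also have "\<dots> = (\<integral>x. F (log_coords x) \<partial>cone_measure)"
    using assms by (intro integral_distr) auto
  finally show ?thesis by simp
qed

text \<open>
  Functions measurable for the cone measure are only Lebesgue measurable. Passing to Borel functions
  of the logarithmic coordinates makes product measures and Fubini available.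
\<close>

lemma cone_measurable_log_coords_version:
  fixes f :: "real \<times> real \<Rightarrow> real"
  assumes "f \<in> borel_measurable cone_measure"
  obtains F where "F \<in> borel_measurable borel" "AE x in cone_measure. f x = F (log_coords x)"
proof -
  have "f \<in> borel_measurable (lebesgue_on half_plane)"
    using assms by (simp add: cone_measure_def)
  then have "(\<lambda>x. indicator half_plane x *\<^sub>R f x) \<in> borel_measurable lebesgue"
    by (subst (asm) borel_measurable_restrict_space_iff) auto
  from completion_ex_borel_measurable_real[OF this]
  obtain g where [measurable]: "g \<in> borel_measurable borel"
    and g: "AE x in lborel. indicator half_plane x *\<^sub>R f x = g x" by auto
  have "AE x in lebesgue. indicator half_plane x *\<^sub>R f x = g x"
    using g by (rule AE_completion)
  then have "AE x in lebesgue_on half_plane. f x = g x"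
    by (subst AE_restrict_space_iff) (auto elim!: eventually_mono)
  moreover have "AE x in lebesgue_on half_plane. x \<in> half_plane"
    by (subst AE_restrict_space_iff) auto
  ultimately have "AE x in lebesgue_on half_plane. f x = g (exp (fst (log_coords x)), snd (log_coords x))"
    by eventually_elim (auto simp: log_coords_def half_plane_def)
  moreover have "(\<lambda>x. ennreal (1 / fst x)) \<in> borel_measurable (lebesgue_on half_plane)"
    by (intro measurable_restrict_space1 measurable_completion) measurable
  ultimately have "AE x in cone_measure. f x = g (exp (fst (log_coords x)), snd (log_coords x))"
    unfolding cone_measure_def by (subst AE_density) (auto elim!: eventually_mono)
  then show thesis
    by (intro that[of "\<lambda>p. g (exp (fst p), snd p)"]) auto
qed

text \<open>
  Tensor products suffice as test functions, because the mollifiers used are of this form.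
\<close>

definition has_weak_gradient ::
    "(real \<times> real \<Rightarrow> real) \<Rightarrow> (real \<times> real \<Rightarrow> real) \<Rightarrow> (real \<times> real \<Rightarrow> real) \<Rightarrow> bool" where
  "has_weak_gradient v h1 h2 \<longleftrightarrow> (\<forall>a a' c c'. smooth_compact a \<longrightarrow> smooth_compact c \<longrightarrow>
     (\<forall>t. (a has_real_derivative a' t) (at t)) \<longrightarrow> (\<forall>t. (c has_real_derivative c' t) (at t)) \<longrightarrow>
     (\<integral>p. v p * (a' (fst p) * c (snd p)) \<partial>lborel) = - (\<integral>p. h1 p * (a (fst p) * c (snd p)) \<partial>lborel) \<and>
     (\<integral>p. v p * (a (fst p) * c' (snd p)) \<partial>lborel) = - (\<integral>p. h2 p * (a (fst p) * c (snd p)) \<partial>lborel))"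

text \<open>
  The pairing of a function with a test function is with respect to Lebesgue measure; the factor
  \<open>1/x\<^sub>1\<close> in the test function converts it to the cone measure.
\<close>

lemma regular_distribution_log_coords:
  assumes f: "f \<in> borel_measurable cone_measure" and [measurable]: "F \<in> borel_measurable borel"
    and fF: "AE x in cone_measure. f x = F (log_coords x)"
    and [measurable]: "q \<in> borel_measurable borel" "c \<in> borel_measurable borel"
  shows "regular_distribution f (\<lambda>x. log_pullback 1 q (fst x) * c (snd x))
     = (\<integral>p. F p * (q (fst p) * c (snd p)) \<partial>lborel)"
proof -
  have [measurable]: "f \<in> borel_measurable (lebesgue_on half_plane)"
    using f by (simp add: cone_measure_def)
  have qc: "(\<lambda>p. q (fst p) * c (snd p)) \<in> borel_measurable borel" by measurable
  have qcl: "(\<lambda>x. q (ln (fst x)) * c (snd x)) \<in> borel_measurable borel" by measurable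
  then have [measurable]: "(\<lambda>x. q (ln (fst x)) * c (snd x)) \<in> borel_measurable (lebesgue_on half_plane)"
    by (intro measurable_restrict_space1 measurable_completion) simp
  have fm: "(\<lambda>x. f x * (q (ln (fst x)) * c (snd x))) \<in> borel_measurable (lebesgue_on half_plane)"
    by measurable
  have gm: "(\<lambda>x. 1 / fst x) \<in> borel_measurable (lebesgue_on half_plane)"
    by (intro measurable_restrict_space1 measurable_completion) measurable
  have g0: "AE x in lebesgue_on half_plane. 0 \<le> 1 / fst x"
    by (rule AE_I2) (auto simp: half_plane_def)
  have "regular_distribution f (\<lambda>x. log_pullback 1 q (fst x) * c (snd x))
    = (\<integral>x. (1 / fst x) *\<^sub>R (f x * (q (ln (fst x)) * c (snd x))) \<partial>lebesgue_on half_plane)"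
    unfolding regular_distribution_def
    by (intro Bochner_Integration.integral_cong) (auto simp: log_pullback_def half_plane_def)
  also have "\<dots> = (\<integral>x. f x * (q (ln (fst x)) * c (snd x)) \<partial>cone_measure)"
    unfolding cone_measure_def by (rule integral_density[OF fm gm g0, symmetric])
  also have "\<dots> = (\<integral>x. F (log_coords x) * (q (fst (log_coords x)) * c (snd (log_coords x))) \<partial>cone_measure)"
  proof (rule integral_cong_AE)
    show "(\<lambda>x. f x * (q (ln (fst x)) * c (snd x))) \<in> borel_measurable cone_measure"
      using fm by (simp add: cone_measure_def)
    show "(\<lambda>x. F (log_coords x) * (q (fst (log_coords x)) * c (snd (log_coords x)))) \<in> borel_measurable cone_measure"
      by measurable
    show "AE x in cone_measure. f x * (q (ln (fst x)) * c (snd x)) = F (log_coords x) * (q (fst (log_coords x)) * c (snd (log_coords x)))"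
      using fF by eventually_elim (simp add: log_coords_def)
  qed
  also have "\<dots> = (\<integral>p. F p * (q (fst p) * c (snd p)) \<partial>lborel)"
    by (rule integral_log_coords) measurable
  finally show ?thesis .
qed

text \<open>
  Test with \<open>a (ln x\<^sub>1) / x\<^sub>1 * c (x\<^sub>2)\<close>. In the first component the weight \<open>x\<^sub>1\<close> of the cone derivative
  cancels the denominator, and differentiating \<open>a (ln x\<^sub>1)\<close> brings it back.
\<close>

lemma cone_gradient_log_coords:
  assumes u: "square_integrable u"
    and g1: "represented_in_L2 (dist_cone_d1 u) g1" and g2: "represented_in_L2 (dist_cone_d2 u) g2"
    and V: "V \<in> borel_measurable borel" "AE x in cone_measure. u x = V (log_coords x)"
    and H1: "H1 \<in> borel_measurable borel" "AE x in cone_measure. g1 x = H1 (log_coords x)"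
    and H2: "H2 \<in> borel_measurable borel" "AE x in cone_measure. g2 x = H2 (log_coords x)"
  shows "has_weak_gradient V H1 H2"
  unfolding has_weak_gradient_def
proof (intro allI impI conjI)
  fix a a' c c' :: "real \<Rightarrow> real"
  assume a: "smooth_compact a" and c: "smooth_compact c"
    and "\<forall>t. (a has_real_derivative a' t) (at t)" "\<forall>t. (c has_real_derivative c' t) (at t)"
  then have a': "\<And>t. (a has_real_derivative a' t) (at t)" and c': "\<And>t. (c has_real_derivative c' t) (at t)"
    by auto
  have bm: "f \<in> borel_measurable borel" if "smooth_compact f" for f
    by (rule borel_measurable_continuous_onI[OF smooth_compact_continuous[OF that]])
  note m = bm[OF a] bm[OF c] bm[OF smooth_compact_derivative[OF a a']] bm[OF smooth_compact_derivative[OF c c']]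
  have um: "u \<in> borel_measurable cone_measure" using u by (simp add: square_integrable_def)
  have gm: "g1 \<in> borel_measurable cone_measure" "g2 \<in> borel_measurable cone_measure"
    using g1 g2 by (simp_all add: represented_in_L2_def square_integrable_def)
  let ?\<phi> = "\<lambda>x. log_pullback 1 a (fst x) * c (snd x)"
  have \<phi>: "?\<phi> \<in> test_functions" by (rule product_test_function[OF a c])
  have "(\<lambda>x. fst x * ?\<phi> x) = (\<lambda>x. log_pullback 0 a (fst x) * c (snd x))"
    by (auto simp: log_pullback_def)
  moreover have "pd1 (\<lambda>x. log_pullback 0 a (fst x) * c (snd x)) = (\<lambda>x. log_pullback 1 a' (fst x) * c (snd x))"
    using pd1_product[OF DERIV_log_pullback[OF a a', where m=0]] by simp
  ultimately have "dist_cone_d1 u ?\<phi> = - regular_distribution u (\<lambda>x. log_pullback 1 a' (fst x) * c (snd x))"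
    by (simp add: dist_cone_d1_def dist_mult_def dist_pd1_def)
  then have "regular_distribution u (\<lambda>x. log_pullback 1 a' (fst x) * c (snd x)) = - regular_distribution g1 ?\<phi>"
    using g1 \<phi> by (simp add: represented_in_L2_def)
  then show "(\<integral>p. V p * (a' (fst p) * c (snd p)) \<partial>lborel) = - (\<integral>p. H1 p * (a (fst p) * c (snd p)) \<partial>lborel)"
    by (simp add: regular_distribution_log_coords[OF um V] regular_distribution_log_coords[OF gm(1) H1] m del: One_nat_def)
  have "dist_cone_d2 u ?\<phi> = - regular_distribution u (\<lambda>x. log_pullback 1 a (fst x) * c' (snd x))"
    by (simp add: dist_cone_d2_def dist_pd2_def pd2_product[OF c'])
  then have "regular_distribution u (\<lambda>x. log_pullback 1 a (fst x) * c' (snd x)) = - regular_distribution g2 ?\<phi>"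
    using g2 \<phi> by (simp add: represented_in_L2_def)
  then show "(\<integral>p. V p * (a (fst p) * c' (snd p)) \<partial>lborel) = - (\<integral>p. H2 p * (a (fst p) * c (snd p)) \<partial>lborel)"
    by (simp add: regular_distribution_log_coords[OF um V] regular_distribution_log_coords[OF gm(2) H2] m del: One_nat_def)
qed

section \<open>Exponential decay of superlevel sets\<close>

text \<open>
  The kernel is \<open>b (p\<^sub>1) b (p\<^sub>2)\<close> for a bump \<open>b\<close>. The last two properties are the weak gradient tested
  against \<open>y \<mapsto> b (x\<^sub>1 - y\<^sub>1) b (x\<^sub>2 - y\<^sub>2)\<close>, the reflection absorbing the minus sign.
\<close>

lemma adapted_mollifier_exists:
  assumes w: "has_weak_gradient v h1 h2" and "\<rho> > 0"
  obtains \<kappa> \<kappa>1 \<kappa>2 :: "real \<times> real \<Rightarrow> real" where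
    "continuous_on UNIV \<kappa>" "\<And>p. \<rho> \<le> norm p \<Longrightarrow> \<kappa> p = 0"
    "continuous_on UNIV \<kappa>1" "\<And>p. \<rho> \<le> norm p \<Longrightarrow> \<kappa>1 p = 0"
    "continuous_on UNIV \<kappa>2" "\<And>p. \<rho> \<le> norm p \<Longrightarrow> \<kappa>2 p = 0"
    "\<And>p. 0 \<le> \<kappa> p" "(\<integral>\<^sup>+p. ennreal (\<kappa> p) \<partial>lborel) = 1"
    "\<And>p z \<tau>. ((\<lambda>\<tau>. \<kappa> (p + \<tau> *\<^sub>R z)) has_real_derivative
        fst z * \<kappa>1 (p + \<tau> *\<^sub>R z) + snd z * \<kappa>2 (p + \<tau> *\<^sub>R z)) (at \<tau>)"
    "\<And>x. mollify \<kappa>1 v x = mollify \<kappa> h1 x" "\<And>x. mollify \<kappa>2 v x = mollify \<kappa> h2 x"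
proof -
  \<comment> \<open>the bump lives within \<open>\<rho>/3\<close>, so it and its derivative vanish from \<open>\<rho>/2\<close> on in each variable\<close>
  have "\<rho> / 3 > 0" using assms by simp
  from smooth_bump_exists[OF this] obtain b where b: "smooth_compact b" "\<And>x. 0 \<le> b x"
    and bz: "\<And>x. \<rho> / 3 \<le> \<bar>x\<bar> \<Longrightarrow> b x = 0" and b1: "(\<integral>\<^sup>+x. ennreal (b x) \<partial>lborel) = 1"
    by metis
  obtain b' where b': "\<And>x. (b has_real_derivative b' x) (at x)"
    using smooth_compact_has_derivative[OF b(1)] by metis
  have b'z: "b' x = 0" if "\<rho> / 2 \<le> \<bar>x\<bar>" for x
    by (rule smooth_compact_derivative_support[where R="\<rho> / 3", OF bz b']) (use that assms in auto)
  have bz: "b x = 0" if "\<rho> / 2 \<le> \<bar>x\<bar>" for x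
    using bz that assms by simp
  have cont: "continuous_on UNIV b" "continuous_on UNIV b'"
    using smooth_compact_continuous b(1) smooth_compact_derivative[OF b(1) b'] by blast+
  have [measurable]: "b \<in> borel_measurable borel" by (rule borel_measurable_continuous_onI[OF cont(1)])
  have cont2: "continuous_on UNIV (\<lambda>p::real\<times>real. f (fst p) * g (snd p))"
    if "continuous_on UNIV f" "continuous_on UNIV g" for f g :: "real \<Rightarrow> real"
    using that by (auto intro!: continuous_intros continuous_on_compose2[of UNIV f] continuous_on_compose2[of UNIV g])
  have far: "\<rho> / 2 \<le> \<bar>fst p\<bar> \<or> \<rho> / 2 \<le> \<bar>snd p\<bar>" if "\<rho> \<le> norm p" for p :: "real \<times> real"
    using norm_Pair_le[of "fst p" "snd p"] that by auto
  show thesis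
  proof (rule that[of "\<lambda>p. b (fst p) * b (snd p)" "\<lambda>p. b' (fst p) * b (snd p)" "\<lambda>p. b (fst p) * b' (snd p)"])
    show "continuous_on UNIV (\<lambda>p::real\<times>real. b (fst p) * b (snd p))"
      "continuous_on UNIV (\<lambda>p::real\<times>real. b' (fst p) * b (snd p))"
      "continuous_on UNIV (\<lambda>p::real\<times>real. b (fst p) * b' (snd p))"
      by (intro cont2 cont)+
    show "b (fst p) * b (snd p) = 0" "b' (fst p) * b (snd p) = 0" "b (fst p) * b' (snd p) = 0"
      if "\<rho> \<le> norm p" for p :: "real \<times> real"
      using far[OF that] bz b'z by auto
    show "0 \<le> b (fst p) * b (snd p)" for p :: "real \<times> real" using b by simp
    show "(\<integral>\<^sup>+p. ennreal (b (fst p) * b (snd p)) \<partial>lborel) = 1"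
    proof -
      have "(\<lambda>p. ennreal (b (fst p) * b (snd p))) \<in> borel_measurable (lborel \<Otimes>\<^sub>M lborel)"
        by measurable
      from lborel.nn_integral_fst[OF this]
      have "(\<integral>\<^sup>+p. ennreal (b (fst p) * b (snd p)) \<partial>lborel) = (\<integral>\<^sup>+s. \<integral>\<^sup>+t. ennreal (b s) * ennreal (b t) \<partial>lborel \<partial>lborel)"
        using b(2) by (simp add: lborel_prod ennreal_mult)
      also have "\<dots> = 1" by (simp add: nn_integral_cmult b1)
      finally show ?thesis .
    qed
    show "((\<lambda>\<tau>. b (fst (p + \<tau> *\<^sub>R z)) * b (snd (p + \<tau> *\<^sub>R z))) has_real_derivative
        fst z * (b' (fst (p + \<tau> *\<^sub>R z)) * b (snd (p + \<tau> *\<^sub>R z))) + snd z * (b (fst (p + \<tau> *\<^sub>R z)) * b' (snd (p + \<tau> *\<^sub>R z)))) (at \<tau>)"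
      for p z :: "real \<times> real" and \<tau> :: real
    proof -
      have "((\<lambda>\<tau>. b (c + \<tau> * d)) has_real_derivative b' (c + \<tau> * d) * d) (at \<tau>)" for c d
        by (rule DERIV_chain2[OF b']) (auto intro!: derivative_eq_intros)
      from DERIV_mult[OF this[of "fst p" "fst z"] this[of "snd p" "snd z"]]
      show ?thesis by (simp add: mult_ac)
    qed
    have refl': "((\<lambda>t. b (x - t)) has_real_derivative - b' (x - t)) (at t)" for x t
    proof -
      have "((\<lambda>t. b (x - t)) has_real_derivative b' (x - t) * (-1)) (at t)"
        by (rule DERIV_chain2[OF b']) (auto intro!: derivative_eq_intros)
      then show ?thesis by simp
    qed
    fix x :: "real \<times> real"
    note W = w[unfolded has_weak_gradient_def, rule_format,
        OF smooth_compact_reflect[OF b(1), of "fst x"] smooth_compact_reflect[OF b(1), of "snd x"] refl' refl']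
    show "mollify (\<lambda>p. b' (fst p) * b (snd p)) v x = mollify (\<lambda>p. b (fst p) * b (snd p)) h1 x"
      "mollify (\<lambda>p. b (fst p) * b' (snd p)) v x = mollify (\<lambda>p. b (fst p) * b (snd p)) h2 x"
      using W by (simp_all add: mollify_def)
  qed
qed

text \<open>
  The estimate holds for every mollification of \<open>v\<close> by \<open>integral_over_set_bound\<close>, since mollifying
  increases neither \<open>L\<^sup>2\<close> norm, and passes to \<open>v\<close> because integrals over \<open>K\<close> converge.
\<close>

lemma integral_over_compact_bound:
  fixes v h1 h2 :: "real \<times> real \<Rightarrow> real"
  assumes [measurable]: "v \<in> borel_measurable borel" "h1 \<in> borel_measurable borel" "h2 \<in> borel_measurable borel"
    and w: "has_weak_gradient v h1 h2"
    and v2: "(\<integral>\<^sup>+x. ennreal ((v x)\<^sup>2) \<partial>lborel) \<le> ennreal (M\<^sup>2)" and M: "M > 0"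
    and h: "(\<integral>\<^sup>+x. ennreal ((h1 x)\<^sup>2 + (h2 x)\<^sup>2) \<partial>lborel) \<le> 1"
    and K: "compact K" and t: "emeasure lborel K = ennreal t" "t > 0"
  shows "(\<integral>x. indicator K x * v x \<partial>lborel)
    \<le> t * (2 / sqrt pi + sqrt ((max 0 (ln (pi * M\<^sup>2 / t)) + 1) / (4 * pi)))"
    (is "_ \<le> ?b")
proof (rule field_le_epsilon)
  fix e :: real assume "e > 0"
  have Kb[measurable]: "K \<in> sets borel" using K by (simp add: compact_imp_closed)
  have iv: "integrable lborel (\<lambda>x. (v x)\<^sup>2)"
    using v2 by (intro integrableI_bounded) (auto intro: le_less_trans)
  show "(\<integral>x. indicator K x * v x \<partial>lborel) \<le> ?b + e"
  proof (rule integral_mollify_close[OF assms(1) iv K \<open>e > 0\<close>])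
    fix \<rho> :: real assume \<rho>: "\<rho> > 0" and close: "\<And>\<kappa>. \<lbrakk>continuous_on UNIV \<kappa>; \<And>z. 0 \<le> \<kappa> z; \<And>z. \<rho> \<le> norm z \<Longrightarrow> \<kappa> z = 0;
        (\<integral>\<^sup>+z. ennreal (\<kappa> z) \<partial>lborel) = 1\<rbrakk> \<Longrightarrow>
      \<bar>(\<integral>x. indicator K x * mollify \<kappa> v x \<partial>lborel) - (\<integral>x. indicator K x * v x \<partial>lborel)\<bar> \<le> e"
    obtain \<kappa> \<kappa>1 \<kappa>2 :: "real \<times> real \<Rightarrow> real" where
      \<kappa>: "continuous_on UNIV \<kappa>" "\<And>p. \<rho> \<le> norm p \<Longrightarrow> \<kappa> p = 0"
      and \<kappa>1: "continuous_on UNIV \<kappa>1" "\<And>p. \<rho> \<le> norm p \<Longrightarrow> \<kappa>1 p = 0"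
      and \<kappa>2: "continuous_on UNIV \<kappa>2" "\<And>p. \<rho> \<le> norm p \<Longrightarrow> \<kappa>2 p = 0"
      and \<kappa>p: "\<And>p. 0 \<le> \<kappa> p" "(\<integral>\<^sup>+p. ennreal (\<kappa> p) \<partial>lborel) = 1"
      and d: "\<And>p z \<tau>. ((\<lambda>\<tau>. \<kappa> (p + \<tau> *\<^sub>R z)) has_real_derivative
          fst z * \<kappa>1 (p + \<tau> *\<^sub>R z) + snd z * \<kappa>2 (p + \<tau> *\<^sub>R z)) (at \<tau>)"
      and m: "\<And>x. mollify \<kappa>1 v x = mollify \<kappa> h1 x" "\<And>x. mollify \<kappa>2 v x = mollify \<kappa> h2 x"
      by (rule adapted_mollifier_exists[OF w \<rho>]) (rule that)
    have [measurable]: "\<kappa> \<in> borel_measurable borel" by (rule borel_measurable_continuous_onI[OF \<kappa>(1)])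
    have [measurable]: "mollify \<kappa> v \<in> borel_measurable borel" "mollify \<kappa> h1 \<in> borel_measurable borel"
      "mollify \<kappa> h2 \<in> borel_measurable borel"
      using \<kappa>(1) by (auto intro!: borel_measurable_mollify)
    let ?U = "\<lambda>x. ennreal \<bar>mollify \<kappa> v x\<bar>"
    let ?G = "\<lambda>x. ennreal (norm (mollify \<kappa> h1 x, mollify \<kappa> h2 x))"
    have "(\<integral>\<^sup>+x. ?U x * indicator K x \<partial>lborel) \<le> ennreal ?b"
    proof (rule integral_over_set_bound[where G="?G"])
      show "?U x \<le> ?U (x + z) + ennreal (norm z) * (\<integral>\<^sup>+\<tau>. ?G (x + \<tau> *\<^sub>R z) * indicator {0..1} \<tau> \<partial>lborel)" for x z
        by (rule mollify_increment_le[OF _ _ _ iv \<kappa> \<kappa>1 \<kappa>2 d m]) measurable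
      have "(\<integral>\<^sup>+x. (?U x)\<^sup>2 \<partial>lborel) = (\<integral>\<^sup>+x. ennreal ((mollify \<kappa> v x)\<^sup>2) \<partial>lborel)"
        by (simp add: ennreal_power)
      also have "\<dots> \<le> (\<integral>\<^sup>+x. ennreal ((v x)\<^sup>2) \<partial>lborel)"
        by (rule nn_integral_mollify_square_le[OF _ \<kappa>(1) \<kappa>p]) measurable
      also note v2
      finally show "(\<integral>\<^sup>+x. (?U x)\<^sup>2 \<partial>lborel) \<le> ennreal (M\<^sup>2)" .
      have "(\<integral>\<^sup>+x. (?G x)\<^sup>2 \<partial>lborel) = (\<integral>\<^sup>+x. ennreal ((mollify \<kappa> h1 x)\<^sup>2) + ennreal ((mollify \<kappa> h2 x)\<^sup>2) \<partial>lborel)"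
        by (intro nn_integral_cong) (simp add: ennreal_power norm_Pair flip: ennreal_plus)
      also have "\<dots> = (\<integral>\<^sup>+x. ennreal ((mollify \<kappa> h1 x)\<^sup>2) \<partial>lborel) + (\<integral>\<^sup>+x. ennreal ((mollify \<kappa> h2 x)\<^sup>2) \<partial>lborel)"
        by (rule nn_integral_add) measurable
      also have "\<dots> \<le> (\<integral>\<^sup>+x. ennreal ((h1 x)\<^sup>2) \<partial>lborel) + (\<integral>\<^sup>+x. ennreal ((h2 x)\<^sup>2) \<partial>lborel)"
        by (intro add_mono nn_integral_mollify_square_le[OF _ \<kappa>(1) \<kappa>p]) measurable
      also have "\<dots> = (\<integral>\<^sup>+x. ennreal ((h1 x)\<^sup>2) + ennreal ((h2 x)\<^sup>2) \<partial>lborel)"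
        by (rule nn_integral_add[symmetric]) measurable
      also have "\<dots> \<le> 1" using h by (simp add: ennreal_plus)
      finally show "(\<integral>\<^sup>+x. (?G x)\<^sup>2 \<partial>lborel) \<le> 1" .
    qed (use M t in auto)
    moreover have "ennreal (\<integral>x. indicator K x * mollify \<kappa> v x \<partial>lborel) \<le> (\<integral>\<^sup>+x. ?U x * indicator K x \<partial>lborel)"
    proof -
      have "integrable lborel (\<lambda>x. indicator K x * mollify \<kappa> v x)"
        using integral_mollify_swap(3)[OF _ iv K \<kappa>] by simp
      from integral_norm_bound_ennreal[OF this]
      have "ennreal \<bar>\<integral>x. indicator K x * mollify \<kappa> v x \<partial>lborel\<bar> \<le> (\<integral>\<^sup>+x. ennreal \<bar>indicator K x * mollify \<kappa> v x\<bar> \<partial>lborel)"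
        by simp
      also have "\<dots> = (\<integral>\<^sup>+x. ?U x * indicator K x \<partial>lborel)"
        by (intro nn_integral_cong) (auto simp: indicator_def)
      finally show ?thesis by (meson abs_ge_self ennreal_leI order_trans)
    qed
    ultimately have "ennreal (\<integral>x. indicator K x * mollify \<kappa> v x \<partial>lborel) \<le> ennreal ?b" by (rule order_trans[rotated])
    moreover have "0 \<le> ?b" using t by (auto intro!: mult_nonneg_nonneg add_nonneg_nonneg)
    ultimately have "(\<integral>x. indicator K x * mollify \<kappa> v x \<partial>lborel) \<le> ?b" by (simp add: ennreal_le_iff)
    then show "(\<integral>x. indicator K x * v x \<partial>lborel) \<le> ?b + e"
      using close[OF \<kappa>(1) \<kappa>p(1) \<kappa>(2) \<kappa>p(2)] by linarith
  qed
qed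

lemma emeasure_lborel_le_if_compact_le:
  fixes A :: "'a::euclidean_space set"
  assumes [measurable]: "A \<in> sets borel" and b: "\<And>K. compact K \<Longrightarrow> K \<subseteq> A \<Longrightarrow> emeasure lborel K \<le> b"
  shows "emeasure lborel A \<le> b"
proof -
  let ?A = "\<lambda>n::nat. A \<inter> cball 0 (real n)"
  have An: "emeasure lborel (?A n) \<le> b" for n
  proof (rule ennreal_le_epsilon)
    fix e :: real assume "0 < e"
    have "?A n \<in> sets lebesgue" by simp
    then obtain T where T: "closed T" "T \<subseteq> ?A n" "emeasure lebesgue (?A n - T) < ennreal e"
      using sets_lebesgue_inner_closed[OF _ \<open>0 < e\<close>] by metis
    have cT: "compact T"
      using T bounded_subset[of "cball 0 (real n)" T] by (auto simp: compact_eq_bounded_closed)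
    have [measurable]: "T \<in> sets borel" using T by simp
    have "emeasure lborel (?A n) = emeasure lborel T + emeasure lborel (?A n - T)"
      using T(2) by (subst plus_emeasure) (auto simp: Un_absorb1 intro!: arg_cong[where f="emeasure lborel"])
    also have "\<dots> \<le> b + ennreal e"
      using T b[OF cT] by (intro add_mono) auto
    finally show "emeasure lborel (?A n) \<le> b + ennreal e" .
  qed
  have "A = (\<Union>n. ?A n)"
    using real_arch_simple by (auto simp: dist_norm)
  then have "emeasure lborel A = emeasure lborel (\<Union>n. ?A n)" by simp
  also have "\<dots> = (SUP n. emeasure lborel (?A n))"
    by (rule SUP_emeasure_incseq[symmetric]) (auto simp: incseq_def intro: order_trans)
  also have "\<dots> \<le> b" by (rule SUP_least) (rule An)
  finally show ?thesis .
qed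

text \<open>
  On a compact \<open>K\<close> of measure \<open>t\<close> inside the superlevel set, \<open>s t \<le> \<integral>\<^sub>K v\<close>, and
  \<open>integral_over_compact_bound\<close> is solved for \<open>t\<close>. The threshold \<open>2\<close> for \<open>s\<close> forces the logarithm in
  that bound to be positive.
\<close>

lemma emeasure_superlevel_le:
  fixes v h1 h2 :: "real \<times> real \<Rightarrow> real"
  assumes [measurable]: "v \<in> borel_measurable borel" "h1 \<in> borel_measurable borel" "h2 \<in> borel_measurable borel"
    and w: "has_weak_gradient v h1 h2"
    and v2: "(\<integral>\<^sup>+x. ennreal ((v x)\<^sup>2) \<partial>lborel) \<le> ennreal (M\<^sup>2)" and M: "M > 0"
    and h: "(\<integral>\<^sup>+x. ennreal ((h1 x)\<^sup>2 + (h2 x)\<^sup>2) \<partial>lborel) \<le> 1"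
    and s: "2 \<le> s"
  shows "emeasure lborel {x. s < v x} \<le> ennreal (pi * M\<^sup>2 * exp (1 - 4 * pi * (s - 2 / sqrt pi)\<^sup>2))"
    (is "_ \<le> ennreal ?b")
proof (rule emeasure_lborel_le_if_compact_le)
  fix K assume K: "compact K" "K \<subseteq> {x. s < v x}"
  have Kb[measurable]: "K \<in> sets borel" using K by (simp add: compact_imp_closed)
  have iv: "integrable lborel (\<lambda>x. (v x)\<^sup>2)"
    using v2 by (intro integrableI_bounded) (auto intro: le_less_trans)
  obtain t where t: "emeasure lborel K = ennreal t" "0 \<le> t"
    using emeasure_bounded_finite[OF compact_imp_bounded[OF K(1)]] by (cases "emeasure lborel K") auto
  have "t \<le> ?b"
  proof (cases "t = 0")
    case True
    then show ?thesis using M by simp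
  next
    case False
    then have tp: "0 < t" using t by simp
    obtain N where N: "\<And>x. x \<in> K \<Longrightarrow> norm x \<le> N"
      using compact_imp_bounded[OF K(1)] unfolding bounded_iff by metis
    have iK: "integrable lborel (\<lambda>y. v y * indicator K y)"
    proof (rule integrable_square_times_compact_support[OF _ _ iv])
      show "\<bar>indicator K y\<bar> \<le> (1::real)" for y by (simp add: indicator_def)
      show "indicator K y = (0::real)" if "N + 1 \<le> norm y" for y
        using that N[of y] by (auto simp: indicator_def)
    qed measurable
    have mK: "measure lborel K = t" using t by (simp add: measure_def)
    have "s * t = (\<integral>x. s * indicator K x \<partial>lborel)"
      by (simp add: mK)
    also have "\<dots> \<le> (\<integral>x. indicator K x * v x \<partial>lborel)"
    proof (rule integral_mono)
      show "integrable lborel (\<lambda>x. s * indicator K x)"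
        using t by (intro integrable_mult_right integrable_real_indicator) auto
      show "integrable lborel (\<lambda>x. indicator K x * v x)" using iK by (simp add: mult.commute)
      show "s * indicator K x \<le> indicator K x * v x" for x
        using K(2) by (auto simp: indicator_def)
    qed
    also have "\<dots> \<le> t * (2 / sqrt pi + sqrt ((max 0 (ln (pi * M\<^sup>2 / t)) + 1) / (4 * pi)))"
      by (rule integral_over_compact_bound[OF _ _ _ w v2 M h K(1) t(1) tp]) measurable
    finally have "s \<le> 2 / sqrt pi + sqrt ((max 0 (ln (pi * M\<^sup>2 / t)) + 1) / (4 * pi))"
      using tp by (simp add: mult.commute)
    then have le: "s - 2 / sqrt pi \<le> sqrt ((max 0 (ln (pi * M\<^sup>2 / t)) + 1) / (4 * pi))" by simp
    \<comment> \<open>\<open>5/4 < sqrt \<pi>\<close> is what makes the level \<open>2\<close> high enough\<close>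
    have "sqrt ((5/4)\<^sup>2) < sqrt pi"
      using pi_gt3 by (intro real_sqrt_less_mono) (simp add: power2_eq_square)
    then have pi54: "5 / 4 < sqrt pi" by simp
    have big: "1 < 2 * sqrt pi * (s - 2 / sqrt pi)"
    proof -
      have "2 * sqrt pi * (s - 2 / sqrt pi) = 2 * sqrt pi * s - 4"
        by (simp add: right_diff_distrib)
      moreover have "2 * sqrt pi * s \<ge> 2 * sqrt pi * 2" using s by (intro mult_left_mono) auto
      ultimately show ?thesis using pi54 by linarith
    qed
    then have "0 < 2 * sqrt pi * (s - 2 / sqrt pi)" by linarith
    then have pos: "0 < s - 2 / sqrt pi" by (rule zero_less_mult_pos) simp
    have "1\<^sup>2 < (2 * sqrt pi * (s - 2 / sqrt pi))\<^sup>2"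
      using big by (intro power_strict_mono) auto
    then have one: "1 < 4 * pi * (s - 2 / sqrt pi)\<^sup>2" by (simp add: power_mult_distrib)
    have "(s - 2 / sqrt pi)\<^sup>2 \<le> (sqrt ((max 0 (ln (pi * M\<^sup>2 / t)) + 1) / (4 * pi)))\<^sup>2"
      using le pos by (intro power_mono) auto
    then have "(s - 2 / sqrt pi)\<^sup>2 \<le> (max 0 (ln (pi * M\<^sup>2 / t)) + 1) / (4 * pi)" by simp
    then have "4 * pi * (s - 2 / sqrt pi)\<^sup>2 \<le> max 0 (ln (pi * M\<^sup>2 / t)) + 1"
      by (simp add: field_simps)
    then have "4 * pi * (s - 2 / sqrt pi)\<^sup>2 - 1 \<le> ln (pi * M\<^sup>2 / t)" using one by linarith
    then have "exp (4 * pi * (s - 2 / sqrt pi)\<^sup>2 - 1) \<le> pi * M\<^sup>2 / t"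
      using M tp by (subst (asm) ln_ge_iff) auto
    then have "t * exp (4 * pi * (s - 2 / sqrt pi)\<^sup>2 - 1) \<le> pi * M\<^sup>2"
      using tp by (simp add: field_simps)
    then have "t * exp (4 * pi * (s - 2 / sqrt pi)\<^sup>2 - 1) * exp (1 - 4 * pi * (s - 2 / sqrt pi)\<^sup>2) \<le> ?b"
      by (intro mult_right_mono) auto
    moreover have "t * exp (4 * pi * (s - 2 / sqrt pi)\<^sup>2 - 1) * exp (1 - 4 * pi * (s - 2 / sqrt pi)\<^sup>2) = t"
      by (simp add: mult.assoc flip: exp_add)
    ultimately show ?thesis by simp
  qed
  then show "emeasure lborel K \<le> ennreal ?b" unfolding t(1) by (rule ennreal_leI)
qed measurable

lemma has_weak_gradient_cmult:
  "has_weak_gradient v h1 h2 \<Longrightarrow> has_weak_gradient (\<lambda>x. c * v x) (\<lambda>x. c * h1 x) (\<lambda>x. c * h2 x)"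
  unfolding has_weak_gradient_def by (simp add: mult.assoc)

lemma emeasure_superlevel_abs_le:
  fixes v h1 h2 :: "real \<times> real \<Rightarrow> real"
  assumes [measurable]: "v \<in> borel_measurable borel" "h1 \<in> borel_measurable borel" "h2 \<in> borel_measurable borel"
    and w: "has_weak_gradient v h1 h2"
    and v2: "(\<integral>\<^sup>+x. ennreal ((v x)\<^sup>2) \<partial>lborel) \<le> ennreal (M\<^sup>2)" and M: "M > 0"
    and h: "(\<integral>\<^sup>+x. ennreal ((h1 x)\<^sup>2 + (h2 x)\<^sup>2) \<partial>lborel) \<le> 1"
    and s: "2 \<le> s"
  shows "emeasure lborel {x. s < \<bar>v x\<bar>} \<le> ennreal (2 * pi * M\<^sup>2 * exp (1 - 4 * pi * (s - 2 / sqrt pi)\<^sup>2))"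
    (is "_ \<le> ennreal (2 * pi * M\<^sup>2 * ?e)")
proof -
  have 1: "emeasure lborel {x. s < v x} \<le> ennreal (pi * M\<^sup>2 * ?e)"
    by (rule emeasure_superlevel_le[OF _ _ _ w v2 M h s]) measurable
  have 2: "emeasure lborel {x. s < - 1 * v x} \<le> ennreal (pi * M\<^sup>2 * ?e)"
    by (rule emeasure_superlevel_le[OF _ _ _ has_weak_gradient_cmult[OF w] _ M _ s]) (use v2 h in auto)
  have "{x. s < \<bar>v x\<bar>} = {x. s < v x} \<union> {x. s < - 1 * v x}" by auto
  then have "emeasure lborel {x. s < \<bar>v x\<bar>} \<le> emeasure lborel {x. s < v x} + emeasure lborel {x. s < - 1 * v x}"
    by (simp only:) (rule emeasure_subadditive; measurable)
  also have "\<dots> \<le> ennreal (pi * M\<^sup>2 * ?e) + ennreal (pi * M\<^sup>2 * ?e)"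
    by (intro add_mono 1 2)
  also have "\<dots> = ennreal (2 * pi * M\<^sup>2 * ?e)"
    by (subst ennreal_plus[symmetric]) auto
  finally show ?thesis .
qed

section \<open>The subcritical exponential inequality\<close>

text \<open>
  The value of \<open>exp (\<alpha>s\<^sup>2)\<close> at \<open>s = k + 3\<close> times the bound on the measure of \<open>{\<bar>v\<bar> > k + 2}\<close> when \<open>M = 1\<close>.
\<close>

definition level_series :: "real \<Rightarrow> nat \<Rightarrow> real" where
  "level_series \<alpha> k = exp (\<alpha> * (real k + 3)\<^sup>2) * (2 * pi * exp (1 - 4 * pi * (real k + 2 - 2 / sqrt pi)\<^sup>2))"

lemma summable_exp_quadratic:
  fixes c0 c1 \<gamma> :: real
  assumes "\<gamma> > 0"
  shows "summable (\<lambda>k. exp (c0 + c1 * real k - \<gamma> * (real k)\<^sup>2))"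
proof (rule summable_comparison_test_ev)
  obtain N :: nat where N: "(\<bar>c1\<bar> + 1 + \<bar>c0\<bar>) / \<gamma> \<le> real N" using real_arch_simple by blast
  have "norm (exp (c0 + c1 * real k - \<gamma> * (real k)\<^sup>2)) \<le> exp (-1) ^ k" if "N + 1 \<le> k" for k
  proof -
    have k: "real N \<le> real k" "1 \<le> real k" using that by auto
    have "\<bar>c1\<bar> + 1 + \<bar>c0\<bar> \<le> \<gamma> * real k"
    proof -
      have "\<bar>c1\<bar> + 1 + \<bar>c0\<bar> \<le> \<gamma> * real N" using N assms by (simp add: field_simps)
      also have "\<dots> \<le> \<gamma> * real k" using k assms by (intro mult_left_mono) auto
      finally show ?thesis .
    qed
    then have "(\<bar>c1\<bar> + 1 + \<bar>c0\<bar>) * real k \<le> \<gamma> * real k * real k"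
      by (intro mult_right_mono) auto
    moreover have "\<bar>c0\<bar> * 1 \<le> \<bar>c0\<bar> * real k" using k by (intro mult_left_mono) auto
    moreover have "c1 * real k \<le> \<bar>c1\<bar> * real k" using k by (intro mult_right_mono) auto
    ultimately have "c0 + c1 * real k - \<gamma> * (real k)\<^sup>2 \<le> - real k"
      by (simp add: power2_eq_square algebra_simps)
    then show ?thesis by (simp flip: exp_of_nat_mult)
  qed
  then show "\<forall>\<^sub>F k in sequentially. norm (exp (c0 + c1 * real k - \<gamma> * (real k)\<^sup>2)) \<le> exp (-1) ^ k"
    unfolding eventually_sequentially by blast
  show "summable (\<lambda>k. exp (-1 :: real) ^ k)" by (rule summable_geometric) simp
qed

text \<open>
  The quadratic term of the exponent has coefficient \<open>\<alpha> - 4\<pi> < 0\<close>; shifting the level by a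
  constant only changes lower order terms. This is where subcriticality enters.
\<close>

lemma summable_level_series:
  assumes "\<alpha> < 4 * pi"
  shows "summable (level_series \<alpha>)"
proof -
  let ?d = "2 - 2 / sqrt pi"
  have "level_series \<alpha> k = 2 * pi * exp ((9 * \<alpha> + 1 - 4 * pi * ?d\<^sup>2) + (6 * \<alpha> - 8 * pi * ?d) * real k - (4 * pi - \<alpha>) * (real k)\<^sup>2)" for k
  proof -
    have eq: "real k + 2 - 2 / sqrt pi = real k + ?d" by simp
    have "level_series \<alpha> k = 2 * pi * exp (\<alpha> * (real k + 3)\<^sup>2 + (1 - 4 * pi * (real k + ?d)\<^sup>2))"
      unfolding level_series_def eq exp_add by simp
    also have "\<alpha> * (real k + 3)\<^sup>2 + (1 - 4 * pi * (real k + d)\<^sup>2)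
       = (9 * \<alpha> + 1 - 4 * pi * d\<^sup>2) + (6 * \<alpha> - 8 * pi * d) * real k - (4 * pi - \<alpha>) * (real k)\<^sup>2" for d
      by (simp add: power2_eq_square algebra_simps)
    finally show ?thesis .
  qed
  then have "level_series \<alpha> = (\<lambda>k. 2 * pi * exp ((9 * \<alpha> + 1 - 4 * pi * ?d\<^sup>2) + (6 * \<alpha> - 8 * pi * ?d) * real k - (4 * pi - \<alpha>) * (real k)\<^sup>2))"
    by (rule ext)
  moreover have "summable \<dots>"
    using assms by (intro summable_mult summable_exp_quadratic) simp
  ultimately show ?thesis by simp
qed

text \<open>
  For \<open>\<bar>y\<bar> \<le> 2\<close> use \<open>exp x - 1 \<le> x exp x\<close>. Otherwise the summand with \<open>k + 2 < \<bar>y\<bar> \<le> k + 3\<close> already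
  dominates.
\<close>

lemma exp_minus_1_le_levels:
  fixes y :: real
  assumes "0 < \<alpha>"
  shows "ennreal (exp (\<alpha> * y\<^sup>2) - 1) \<le> ennreal (\<alpha> * exp (4 * \<alpha>) * y\<^sup>2)
    + (\<Sum>k. ennreal (exp (\<alpha> * (real k + 3)\<^sup>2)) * indicator {y. real k + 2 < \<bar>y\<bar>} y)"
proof (cases "\<bar>y\<bar> \<le> 2")
  case True
  have y4: "y\<^sup>2 \<le> 4" using power_mono[OF True, of 2] by simp
  have "1 - \<alpha> * y\<^sup>2 \<le> exp (- (\<alpha> * y\<^sup>2))" using exp_ge_add_one_self[of "- (\<alpha> * y\<^sup>2)"] by simp
  then have "(1 - \<alpha> * y\<^sup>2) * exp (\<alpha> * y\<^sup>2) \<le> exp (- (\<alpha> * y\<^sup>2)) * exp (\<alpha> * y\<^sup>2)"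
    by (intro mult_right_mono) auto
  then have "exp (\<alpha> * y\<^sup>2) - 1 \<le> \<alpha> * y\<^sup>2 * exp (\<alpha> * y\<^sup>2)"
    by (simp add: algebra_simps flip: exp_add)
  also have "\<dots> \<le> \<alpha> * y\<^sup>2 * exp (4 * \<alpha>)"
    using assms y4 by (intro mult_left_mono) auto
  finally have "ennreal (exp (\<alpha> * y\<^sup>2) - 1) \<le> ennreal (\<alpha> * exp (4 * \<alpha>) * y\<^sup>2)"
    by (intro ennreal_leI) (simp add: mult_ac)
  then show ?thesis by (meson add_increasing2 zero_le)
next
  case False
  define k where "k = nat (\<lceil>\<bar>y\<bar>\<rceil> - 3)"
  have k: "real k = of_int \<lceil>\<bar>y\<bar>\<rceil> - 3" using False unfolding k_def by linarith
  have 1: "real k + 2 < \<bar>y\<bar>" "\<bar>y\<bar> \<le> real k + 3" unfolding k by linarith+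
  have "y\<^sup>2 \<le> (real k + 3)\<^sup>2" using power_mono[OF 1(2), of 2] by simp
  then have "exp (\<alpha> * y\<^sup>2) \<le> exp (\<alpha> * (real k + 3)\<^sup>2)"
    using assms by simp
  then have "exp (\<alpha> * y\<^sup>2) - 1 \<le> exp (\<alpha> * (real k + 3)\<^sup>2)"
    by linarith
  then have "ennreal (exp (\<alpha> * y\<^sup>2) - 1) \<le> ennreal (exp (\<alpha> * (real k + 3)\<^sup>2)) * indicator {y. real k + 2 < \<bar>y\<bar>} y"
    using 1 by (simp add: ennreal_leI)
  also have "\<dots> \<le> (\<Sum>k. ennreal (exp (\<alpha> * (real k + 3)\<^sup>2)) * indicator {y. real k + 2 < \<bar>y\<bar>} y)"
  proof -
    let ?t = "\<lambda>k. ennreal (exp (\<alpha> * (real k + 3)\<^sup>2)) * indicator {y. real k + 2 < \<bar>y\<bar>} y"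
    have "sum ?t {k} \<le> suminf ?t" by (rule sum_le_suminf) simp_all
    then show ?thesis by (simp only: sum.insert finite.emptyI empty_iff sum.empty add_0_right not_False_eq_True)
  qed
  finally show ?thesis by (meson add_increasing zero_le)
qed

lemma subcritical_Trudinger_Moser_plane:
  fixes v h1 h2 :: "real \<times> real \<Rightarrow> real"
  assumes [measurable]: "v \<in> borel_measurable borel" "h1 \<in> borel_measurable borel" "h2 \<in> borel_measurable borel"
    and w: "has_weak_gradient v h1 h2"
    and v2: "(\<integral>\<^sup>+x. ennreal ((v x)\<^sup>2) \<partial>lborel) \<le> ennreal (M\<^sup>2)" and M: "M > 0"
    and h: "(\<integral>\<^sup>+x. ennreal ((h1 x)\<^sup>2 + (h2 x)\<^sup>2) \<partial>lborel) \<le> 1"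
    and \<alpha>: "0 < \<alpha>" "\<alpha> < 4 * pi"
  shows "(\<integral>\<^sup>+x. ennreal (exp (\<alpha> * (v x)\<^sup>2) - 1) \<partial>lborel)
    \<le> ennreal ((\<alpha> * exp (4 * \<alpha>) + (\<Sum>k. level_series \<alpha> k)) * M\<^sup>2)"
proof -
  have sm: "summable (level_series \<alpha>)" by (rule summable_level_series[OF \<alpha>(2)])
  have pos: "0 \<le> level_series \<alpha> k" for k by (simp add: level_series_def)
  have "(\<integral>\<^sup>+x. ennreal (exp (\<alpha> * (v x)\<^sup>2) - 1) \<partial>lborel)
    \<le> (\<integral>\<^sup>+x. ennreal (\<alpha> * exp (4 * \<alpha>) * (v x)\<^sup>2)
      + (\<Sum>k. ennreal (exp (\<alpha> * (real k + 3)\<^sup>2)) * indicator {y. real k + 2 < \<bar>y\<bar>} (v x)) \<partial>lborel)"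
    by (intro nn_integral_mono exp_minus_1_le_levels \<alpha>)
  also have "\<dots> = (\<integral>\<^sup>+x. ennreal (\<alpha> * exp (4 * \<alpha>) * (v x)\<^sup>2) \<partial>lborel)
      + (\<integral>\<^sup>+x. (\<Sum>k. ennreal (exp (\<alpha> * (real k + 3)\<^sup>2)) * indicator {y. real k + 2 < \<bar>y\<bar>} (v x)) \<partial>lborel)"
    by (rule nn_integral_add) measurable
  also have "(\<integral>\<^sup>+x. (\<Sum>k. ennreal (exp (\<alpha> * (real k + 3)\<^sup>2)) * indicator {y. real k + 2 < \<bar>y\<bar>} (v x)) \<partial>lborel)
     = (\<Sum>k. \<integral>\<^sup>+x. ennreal (exp (\<alpha> * (real k + 3)\<^sup>2)) * indicator {y. real k + 2 < \<bar>y\<bar>} (v x) \<partial>lborel)"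
    by (rule nn_integral_suminf) measurable
  also have "\<dots> \<le> (\<Sum>k. ennreal (level_series \<alpha> k * M\<^sup>2))"
  proof (rule suminf_le)
    fix k :: nat
    have "(\<integral>\<^sup>+x. ennreal (exp (\<alpha> * (real k + 3)\<^sup>2)) * indicator {y. real k + 2 < \<bar>y\<bar>} (v x) \<partial>lborel)
       = (\<integral>\<^sup>+x. ennreal (exp (\<alpha> * (real k + 3)\<^sup>2)) * indicator {x. real k + 2 < \<bar>v x\<bar>} x \<partial>lborel)"
      by (intro nn_integral_cong) (simp add: indicator_def)
    also have "\<dots> = ennreal (exp (\<alpha> * (real k + 3)\<^sup>2)) * emeasure lborel {x. real k + 2 < \<bar>v x\<bar>}"
      by (rule nn_integral_cmult_indicator) measurable
    also have "\<dots> \<le> ennreal (exp (\<alpha> * (real k + 3)\<^sup>2)) * ennreal (2 * pi * M\<^sup>2 * exp (1 - 4 * pi * (real k + 2 - 2 / sqrt pi)\<^sup>2))"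
      by (intro mult_left_mono emeasure_superlevel_abs_le[OF _ _ _ w v2 M h]) auto
    also have "\<dots> = ennreal (level_series \<alpha> k * M\<^sup>2)"
      by (subst ennreal_mult[symmetric]) (auto simp: level_series_def mult_ac)
    finally show "(\<integral>\<^sup>+x. ennreal (exp (\<alpha> * (real k + 3)\<^sup>2)) * indicator {y. real k + 2 < \<bar>y\<bar>} (v x) \<partial>lborel)
      \<le> ennreal (level_series \<alpha> k * M\<^sup>2)" .
  qed auto
  also have "\<dots> = ennreal (\<Sum>k. level_series \<alpha> k * M\<^sup>2)"
    using pos sm by (intro suminf_ennreal2 summable_mult2) auto
  also have "(\<Sum>k. level_series \<alpha> k * M\<^sup>2) = (\<Sum>k. level_series \<alpha> k) * M\<^sup>2"
    using sm by (rule suminf_mult2[symmetric])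
  also have "(\<integral>\<^sup>+x. ennreal (\<alpha> * exp (4 * \<alpha>) * (v x)\<^sup>2) \<partial>lborel)
    = (\<integral>\<^sup>+x. ennreal (\<alpha> * exp (4 * \<alpha>)) * ennreal ((v x)\<^sup>2) \<partial>lborel)"
    using \<alpha> by (intro nn_integral_cong ennreal_mult) auto
  also have "\<dots> = ennreal (\<alpha> * exp (4 * \<alpha>)) * (\<integral>\<^sup>+x. ennreal ((v x)\<^sup>2) \<partial>lborel)"
    by (rule nn_integral_cmult) measurable
  also have "\<dots> \<le> ennreal (\<alpha> * exp (4 * \<alpha>)) * ennreal (M\<^sup>2)"
    by (intro mult_left_mono v2) auto
  also have "\<dots> = ennreal (\<alpha> * exp (4 * \<alpha>) * M\<^sup>2)"
    using \<alpha> by (intro ennreal_mult[symmetric]) auto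
  also have "ennreal (\<alpha> * exp (4 * \<alpha>) * M\<^sup>2) + ennreal ((\<Sum>k. level_series \<alpha> k) * M\<^sup>2)
    = ennreal ((\<alpha> * exp (4 * \<alpha>) + (\<Sum>k. level_series \<alpha> k)) * M\<^sup>2)"
    using \<alpha> suminf_nonneg[OF sm pos]
    by (subst ennreal_plus[symmetric]) (auto simp: distrib_right)
  finally show ?thesis by (simp add: add_left_mono add_right_mono)
qed

text \<open>
  Any \<open>l\<close> above the gradient norm and any \<open>M\<close> above the norm of \<open>u\<close> are allowed, so that functions
  whose gradient or norm vanishes are covered as well. The planar inequality is applied to \<open>u / l\<close> in
  logarithmic coordinates.
\<close>

lemma subcritical_Trudinger_Moser_cone:
  assumes u: "u \<in> cone_sobolev" and \<alpha>: "0 < \<alpha>" "\<alpha> < 4 * pi"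
    and l: "L2_cone_norm (cone_grad u) \<le> l" "0 < l" and M: "L2_cone_norm u \<le> M" "0 < M"
  shows "(\<integral>\<^sup>+x. ennreal (exp (\<alpha> * (\<bar>u x\<bar>\<^sup>2 / l\<^sup>2)) - 1) \<partial>cone_measure)
    \<le> ennreal ((\<alpha> * exp (4 * \<alpha>) + (\<Sum>k. level_series \<alpha> k)) * (M\<^sup>2 / l\<^sup>2))"
proof -
  define g1 where "g1 = (SOME g. represented_in_L2 (dist_cone_d1 u) g)"
  define g2 where "g2 = (SOME g. represented_in_L2 (dist_cone_d2 u) g)"
  have u2: "square_integrable u" using u by (simp add: cone_sobolev_def)
  have g1: "represented_in_L2 (dist_cone_d1 u) g1" and g2: "represented_in_L2 (dist_cone_d2 u) g2"
  proof -
    have ex: "\<exists>g. represented_in_L2 (dist_cone_d1 u) g" "\<exists>g. represented_in_L2 (dist_cone_d2 u) g"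
      using u by (auto simp: cone_sobolev_def)
    show "represented_in_L2 (dist_cone_d1 u) g1" "represented_in_L2 (dist_cone_d2 u) g2"
      unfolding g1_def g2_def by (rule someI_ex[OF ex(1)], rule someI_ex[OF ex(2)])
  qed
  have um: "u \<in> borel_measurable cone_measure" "integrable cone_measure (\<lambda>x. (u x)\<^sup>2)"
    using u2 by (simp_all add: square_integrable_def)
  have g1m: "g1 \<in> borel_measurable cone_measure" "integrable cone_measure (\<lambda>x. (g1 x)\<^sup>2)"
    using g1 by (simp_all add: represented_in_L2_def square_integrable_def)
  have g2m: "g2 \<in> borel_measurable cone_measure" "integrable cone_measure (\<lambda>x. (g2 x)\<^sup>2)"
    using g2 by (simp_all add: represented_in_L2_def square_integrable_def)
  obtain V where V: "V \<in> borel_measurable borel" "AE x in cone_measure. u x = V (log_coords x)"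
    using cone_measurable_log_coords_version[OF um(1)] by metis
  obtain H1 where H1: "H1 \<in> borel_measurable borel" "AE x in cone_measure. g1 x = H1 (log_coords x)"
    using cone_measurable_log_coords_version[OF g1m(1)] by metis
  obtain H2 where H2: "H2 \<in> borel_measurable borel" "AE x in cone_measure. g2 x = H2 (log_coords x)"
    using cone_measurable_log_coords_version[OF g2m(1)] by metis
  note [measurable] = V(1) H1(1) H2(1)
  have w: "has_weak_gradient V H1 H2"
    by (rule cone_gradient_log_coords[OF u2 g1 g2 V H1 H2])
  have V2: "(\<integral>\<^sup>+p. ennreal ((V p)\<^sup>2) \<partial>lborel) \<le> ennreal (M\<^sup>2)"
  proof -
    have "(\<integral>\<^sup>+p. ennreal ((V p)\<^sup>2) \<partial>lborel) = (\<integral>\<^sup>+x. ennreal ((V (log_coords x))\<^sup>2) \<partial>cone_measure)"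
      by (rule nn_integral_log_coords[symmetric]) measurable
    also have "\<dots> = (\<integral>\<^sup>+x. ennreal ((u x)\<^sup>2) \<partial>cone_measure)"
      by (rule nn_integral_cong_AE) (use V(2) in \<open>auto elim!: eventually_mono\<close>)
    also have "\<dots> = ennreal (\<integral>x. (u x)\<^sup>2 \<partial>cone_measure)"
      by (rule nn_integral_eq_integral[OF um(2)]) simp
    also have "(\<integral>x. (u x)\<^sup>2 \<partial>cone_measure) = (L2_cone_norm u)\<^sup>2"
      by (simp add: L2_cone_norm_def)
    also have "ennreal \<dots> \<le> ennreal (M\<^sup>2)"
      using M by (intro ennreal_leI power_mono) (auto simp: L2_cone_norm_def)
    finally show ?thesis .
  qed
  have H: "(\<integral>\<^sup>+p. ennreal ((H1 p)\<^sup>2 + (H2 p)\<^sup>2) \<partial>lborel) \<le> ennreal (l\<^sup>2)"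
  proof -
    have "(\<integral>\<^sup>+p. ennreal ((H1 p)\<^sup>2 + (H2 p)\<^sup>2) \<partial>lborel) = (\<integral>\<^sup>+x. ennreal ((H1 (log_coords x))\<^sup>2 + (H2 (log_coords x))\<^sup>2) \<partial>cone_measure)"
      by (rule nn_integral_log_coords[symmetric]) measurable
    also have "\<dots> = (\<integral>\<^sup>+x. ennreal ((g1 x)\<^sup>2 + (g2 x)\<^sup>2) \<partial>cone_measure)"
    proof (rule nn_integral_cong_AE)
      show "AE x in cone_measure. ennreal ((H1 (log_coords x))\<^sup>2 + (H2 (log_coords x))\<^sup>2) = ennreal ((g1 x)\<^sup>2 + (g2 x)\<^sup>2)"
        using H1(2) H2(2) by eventually_elim simp
    qed
    also have "\<dots> = ennreal (\<integral>x. (g1 x)\<^sup>2 + (g2 x)\<^sup>2 \<partial>cone_measure)"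
      by (rule nn_integral_eq_integral[OF Bochner_Integration.integrable_add[OF g1m(2) g2m(2)]]) simp
    also have "(\<integral>x. (g1 x)\<^sup>2 + (g2 x)\<^sup>2 \<partial>cone_measure) = (L2_cone_norm (cone_grad u))\<^sup>2"
      by (simp add: L2_cone_norm_def cone_grad_def norm_Pair g1_def g2_def)
    also have "ennreal \<dots> \<le> ennreal (l\<^sup>2)"
      using l by (intro ennreal_leI power_mono) (auto simp: L2_cone_norm_def)
    finally show ?thesis .
  qed
  have scale: "(\<integral>\<^sup>+p. ennreal (f p / l\<^sup>2) \<partial>lborel) \<le> ennreal (N / l\<^sup>2)"
    if "(\<integral>\<^sup>+p. ennreal (f p) \<partial>lborel) \<le> ennreal N" "\<And>p. 0 \<le> f p" "0 \<le> N"
      and [measurable]: "f \<in> borel_measurable borel"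
    for f :: "real \<times> real \<Rightarrow> real" and N
  proof -
    have "(\<integral>\<^sup>+p. ennreal (f p / l\<^sup>2) \<partial>lborel) = (\<integral>\<^sup>+p. ennreal (1 / l\<^sup>2) * ennreal (f p) \<partial>lborel)"
      using that by (intro nn_integral_cong) (simp flip: ennreal_mult)
    also have "\<dots> = ennreal (1 / l\<^sup>2) * (\<integral>\<^sup>+p. ennreal (f p) \<partial>lborel)"
      by (rule nn_integral_cmult) measurable
    also have "\<dots> \<le> ennreal (1 / l\<^sup>2) * ennreal N" by (intro mult_left_mono that) auto
    also have "\<dots> = ennreal (N / l\<^sup>2)" using that by (simp flip: ennreal_mult)
    finally show ?thesis .
  qed
  have "(\<integral>\<^sup>+x. ennreal (exp (\<alpha> * (\<bar>u x\<bar>\<^sup>2 / l\<^sup>2)) - 1) \<partial>cone_measure)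
     = (\<integral>\<^sup>+x. ennreal (exp (\<alpha> * (1 / l * V (log_coords x))\<^sup>2) - 1) \<partial>cone_measure)"
  proof (rule nn_integral_cong_AE)
    show "AE x in cone_measure. ennreal (exp (\<alpha> * (\<bar>u x\<bar>\<^sup>2 / l\<^sup>2)) - 1) = ennreal (exp (\<alpha> * (1 / l * V (log_coords x))\<^sup>2) - 1)"
      using V(2) by eventually_elim (simp add: power_divide)
  qed
  also have "\<dots> = (\<integral>\<^sup>+p. ennreal (exp (\<alpha> * (1 / l * V p)\<^sup>2) - 1) \<partial>lborel)"
    by (rule nn_integral_log_coords) measurable
  also have "\<dots> \<le> ennreal ((\<alpha> * exp (4 * \<alpha>) + (\<Sum>k. level_series \<alpha> k)) * (M / l)\<^sup>2)"
  proof (rule subcritical_Trudinger_Moser_plane[OF _ _ _ has_weak_gradient_cmult[OF w, of "1 / l"] _ _ _ \<alpha>])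
    show "(\<integral>\<^sup>+p. ennreal ((1 / l * V p)\<^sup>2) \<partial>lborel) \<le> ennreal ((M / l)\<^sup>2)"
      using scale[OF V2] by (simp add: power_divide)
    show "(\<integral>\<^sup>+p. ennreal ((1 / l * H1 p)\<^sup>2 + (1 / l * H2 p)\<^sup>2) \<partial>lborel) \<le> 1"
      using scale[OF H] l by (simp add: power_divide add_divide_distrib)
    show "0 < M / l" using M l by simp
  qed measurable
  finally show ?thesis by (simp add: power_divide)
qed

theorem theorem3p2:
  fixes \<alpha> :: real
  assumes "0 < \<alpha>" and "\<alpha> < 4 * pi"
  shows "(\<exists>C>0. \<forall>u\<in>cone_sobolev. \<not> (AE x in cone_measure. u x = 0) \<longrightarrow>
            (\<integral>\<^sup>+x. ennreal (exp (\<alpha> * (\<bar>u x\<bar>\<^sup>2 / (L2_cone_norm (cone_grad u))\<^sup>2)) - 1) \<partial>cone_measure)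
              \<le> ennreal (C * ((L2_cone_norm u)\<^sup>2 / (L2_cone_norm (cone_grad u))\<^sup>2)))
       \<and> (\<forall>u\<in>cone_sobolev.
            orlicz (\<lambda>s. exp (\<alpha> * s\<^sup>2) - 1) u \<le> ennreal (L2_cone_norm (cone_grad u)))"
proof
  let ?C = "\<alpha> * exp (4 * \<alpha>) + (\<Sum>k. level_series \<alpha> k)"
  have "0 \<le> (\<Sum>k. level_series \<alpha> k)"
    by (intro suminf_nonneg summable_level_series assms) (simp add: level_series_def)
  then have C: "?C > 0" using assms by (simp add: add_pos_nonneg)
  have nonneg: "0 \<le> L2_cone_norm f" for f :: "real \<times> real \<Rightarrow> 'a::real_normed_vector"
    by (simp add: L2_cone_norm_def)
  show "\<exists>C>0. \<forall>u\<in>cone_sobolev. \<not> (AE x in cone_measure. u x = 0) \<longrightarrow>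
            (\<integral>\<^sup>+x. ennreal (exp (\<alpha> * (\<bar>u x\<bar>\<^sup>2 / (L2_cone_norm (cone_grad u))\<^sup>2)) - 1) \<partial>cone_measure)
              \<le> ennreal (C * ((L2_cone_norm u)\<^sup>2 / (L2_cone_norm (cone_grad u))\<^sup>2))"
  proof (intro exI[of _ ?C] conjI ballI impI C)
    fix u assume u: "u \<in> cone_sobolev" and nz: "\<not> (AE x in cone_measure. u x = 0)"
    show "(\<integral>\<^sup>+x. ennreal (exp (\<alpha> * (\<bar>u x\<bar>\<^sup>2 / (L2_cone_norm (cone_grad u))\<^sup>2)) - 1) \<partial>cone_measure)
              \<le> ennreal (?C * ((L2_cone_norm u)\<^sup>2 / (L2_cone_norm (cone_grad u))\<^sup>2))"
    proof (cases "L2_cone_norm (cone_grad u) = 0")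
      case True
      \<comment> \<open>both quotients are \<open>0\<close> since division by zero yields \<open>0\<close>\<close>
      then show ?thesis by simp
    next
      case False
      have i: "integrable cone_measure (\<lambda>x. (u x)\<^sup>2)"
        using u by (simp add: cone_sobolev_def square_integrable_def)
      have "L2_cone_norm u \<noteq> 0"
      proof
        assume "L2_cone_norm u = 0"
        then have "(\<integral>x. (u x)\<^sup>2 \<partial>cone_measure) = 0" by (simp add: L2_cone_norm_def)
        then have "AE x in cone_measure. (u x)\<^sup>2 = 0"
          using integral_nonneg_eq_0_iff_AE[OF i] by simp
        then show False using nz by simp
      qed
      then have "0 < L2_cone_norm u" using nonneg[of u] by linarith
      moreover have "0 < L2_cone_norm (cone_grad u)" using nonneg[of "cone_grad u"] False by linarith
      ultimately show ?thesis
        using subcritical_Trudinger_Moser_cone[OF u assms order_refl _ order_refl] by blast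
    qed
  qed
  show "\<forall>u\<in>cone_sobolev. orlicz (\<lambda>s. exp (\<alpha> * s\<^sup>2) - 1) u \<le> ennreal (L2_cone_norm (cone_grad u))"
  proof
    fix u assume u: "u \<in> cone_sobolev"
    have le: "orlicz (\<lambda>s. exp (\<alpha> * s\<^sup>2) - 1) u \<le> ennreal l" if l: "L2_cone_norm (cone_grad u) \<le> l" "0 < l" for l
    proof -
      have "0 < L2_cone_norm u + 1" using nonneg[of u] by linarith
      then have "(\<integral>\<^sup>+x. ennreal (exp (\<alpha> * (\<bar>u x\<bar>\<^sup>2 / l\<^sup>2)) - 1) \<partial>cone_measure) < \<infinity>"
        using subcritical_Trudinger_Moser_cone[OF u assms l, of "L2_cone_norm u + 1"]
        by (auto intro: le_less_trans)
      then have "(\<integral>\<^sup>+x. ennreal (exp (\<alpha> * (\<bar>u x\<bar> / l)\<^sup>2) - 1) \<partial>cone_measure) < \<infinity>"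
        by (simp add: power_divide)
      then show ?thesis unfolding orlicz_def using l(2) by (intro Inf_lower) auto
    qed
    \<comment> \<open>the infimum ranges over positive \<open>l\<close>, while the gradient norm may be zero\<close>
    show "orlicz (\<lambda>s. exp (\<alpha> * s\<^sup>2) - 1) u \<le> ennreal (L2_cone_norm (cone_grad u))"
    proof (rule ennreal_le_epsilon)
      fix e :: real assume "0 < e"
      then have "orlicz (\<lambda>s. exp (\<alpha> * s\<^sup>2) - 1) u \<le> ennreal (L2_cone_norm (cone_grad u) + e)"
        using nonneg[of "cone_grad u"] by (intro le) auto
      also have "\<dots> = ennreal (L2_cone_norm (cone_grad u)) + ennreal e"
        using nonneg[of "cone_grad u"] \<open>0 < e\<close> by (intro ennreal_plus) auto
      finally show "orlicz (\<lambda>s. exp (\<alpha> * s\<^sup>2) - 1) u \<le> ennreal (L2_cone_norm (cone_grad u)) + ennreal e" .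
    qed
  qed
qed

end
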